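(* Fix a real number $M>2$, let $Q=(0,1)^2$, and let $(X,d_X)$ be the metric space of $BV$ homeomorphisms $f:Q\to Q$ with $f_{|\partial Q}=\mathrm{Id}$ and $Var(f,Q)<M$ defined in the context. Then the set of all $f\in X$ that are $W^{1,1}$ homeomorphisms (i.e. $f\in X\cap W^{1,1}(Q;\mathbb{R}^2)$) is of first category in $(X,d_X)$.
   Context: On $\mathbb{R}^4$ put $|(a,b,c,d)|_\infty=\max\{|a|,|b|,|c|,|d|\}$. For $f=(f_1,f_2):Q\to Q$, the variation of $f$ in $Q$ is $$Var(f,Q):=\sup\left\{\int_Q (f_1\,\mathrm{div}\,\phi_1+f_2\,\mathrm{div}\,\phi_2)\,dx:\ \phi=(\phi_1,\phi_2)\in C^1_c(Q,\mathbb{R}^2\times\mathbb{R}^2),\ |\phi(x)|_\infty\le 1\ \text{for all } x\in Q\right\},$$ and $f$ is $BV$ if $Var(f,Q)<\infty$. For a homeomorphism $f:Q\to Q$ of the open square, $f_{|\partial Q}=\mathrm{Id}$ means that $f$ extends continuously to $\overline Q$ by the identity on $\partial Q$. Define $$X:=\{f:Q\to Q:\ f \text{ is a } BV \text{ homeomorphism},\ f_{|\partial Q}=\mathrm{Id},\ Var(f,Q)<M\},$$ $$d_X(f,g):=\|f-g\|_\infty+\|f^{-1}-g^{-1}\|_\infty+\left|\frac{1}{M-Var(f,Q)}-\frac{1}{M-Var(g,Q)}\right|,$$ where $\|\cdot\|_\infty$ is the supremum norm on $Q$. A set is of first category if its complement is residual, i.e. contains the intersection of countably many open dense subsets. *)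

theory Defs
  imports "HOL-Analysis.Analysis"
begin

definition unit_square :: "(real^2) set" where
  "unit_square = {x. \<forall>i. 0 < x $ i \<and> x $ i < 1}"


section \<open>Test functions\<close>

definition partial_deriv :: "2 \<Rightarrow> (real^2 \<Rightarrow> 'b::real_normed_vector) \<Rightarrow> real^2 \<Rightarrow> 'b" where
  "partial_deriv i f x = frechet_derivative f (at x) (axis i 1)"

text \<open>Functions of class \<open>C\<^sup>k\<close> on a set \<open>S\<close>, which is meant to be open; values outside \<open>S\<close> are
  irrelevant.\<close>

primrec Ck_on :: "nat \<Rightarrow> (real^2) set \<Rightarrow> (real^2 \<Rightarrow> 'b::real_normed_vector) \<Rightarrow> bool" where
  "Ck_on 0 S f \<longleftrightarrow> continuous_on S f"
| "Ck_on (Suc k) S f \<longleftrightarrow>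
     (\<forall>x\<in>S. f differentiable (at x)) \<and> (\<forall>i. Ck_on k S (partial_deriv i f))"

definition compactly_supported_in :: "(real^2) set \<Rightarrow> (real^2 \<Rightarrow> 'b::real_normed_vector) \<Rightarrow> bool" where
  "compactly_supported_in S f \<longleftrightarrow> (\<exists>K. compact K \<and> K \<subseteq> S \<and> (\<forall>x\<in>S - K. f x = 0))"

definition div2 :: "(real^2 \<Rightarrow> real^2) \<Rightarrow> real^2 \<Rightarrow> real" where
  "div2 \<phi> x = (\<Sum>i\<in>UNIV. partial_deriv i \<phi> x $ i)"


section \<open>Variation\<close>

definition linf4 :: "(real^2) \<times> (real^2) \<Rightarrow> real" where
  "linf4 v = Max {\<bar>fst v $ 1\<bar>, \<bar>fst v $ 2\<bar>, \<bar>snd v $ 1\<bar>, \<bar>snd v $ 2\<bar>}"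

definition Var :: "(real^2 \<Rightarrow> real^2) \<Rightarrow> (real^2) set \<Rightarrow> ereal" where
  "Var f S =
     (SUP \<phi>\<in>{\<phi> :: real^2 \<Rightarrow> (real^2) \<times> (real^2).
                Ck_on 1 S \<phi> \<and> compactly_supported_in S \<phi> \<and> (\<forall>x\<in>S. linf4 (\<phi> x) \<le> 1)}.
        ereal (LINT x:S|lebesgue.
          f x $ 1 * div2 (\<lambda>y. fst (\<phi> y)) x + f x $ 2 * div2 (\<lambda>y. snd (\<phi> y)) x))"


section \<open>The Sobolev space \<open>W\<^sup>1\<^sup>,\<^sup>1\<close>\<close>

definition weak_partial_deriv ::
    "(real^2) set \<Rightarrow> 2 \<Rightarrow> (real^2 \<Rightarrow> real) \<Rightarrow> (real^2 \<Rightarrow> real) \<Rightarrow> bool" where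
  "weak_partial_deriv S j u g \<longleftrightarrow>
     (\<forall>\<psi> :: real^2 \<Rightarrow> real. (\<forall>k. Ck_on k S \<psi>) \<and> compactly_supported_in S \<psi> \<longrightarrow>
        (LINT x:S|lebesgue. u x * partial_deriv j \<psi> x) = - (LINT x:S|lebesgue. g x * \<psi> x))"

definition W11 :: "(real^2) set \<Rightarrow> (real^2 \<Rightarrow> real^2) set" where
  "W11 S = {f. \<forall>i. set_integrable lebesgue S (\<lambda>x. f x $ i) \<and>
     (\<forall>j. \<exists>g. set_integrable lebesgue S g \<and> weak_partial_deriv S j (\<lambda>x. f x $ i) g)}"


section \<open>The metric space of homeomorphisms\<close>

text \<open>Maps of the square are represented by functions that are \<open>undefined\<close> outside the square, so
  that equality of functions is equality of maps.\<close>

definition square_homeos :: "(real^2 \<Rightarrow> real^2) set" where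
  "square_homeos = {f \<in> extensional unit_square. \<exists>g. homeomorphism unit_square unit_square f g}"

definition identity_on_boundary :: "(real^2 \<Rightarrow> real^2) \<Rightarrow> bool" where
  "identity_on_boundary f \<longleftrightarrow>
     (\<exists>F. continuous_on (closure unit_square) F \<and> (\<forall>x\<in>unit_square. F x = f x) \<and>
          (\<forall>x\<in>frontier unit_square. F x = x))"

definition BV_homeos :: "real \<Rightarrow> (real^2 \<Rightarrow> real^2) set" where
  "BV_homeos M = {f \<in> square_homeos. Var f unit_square < \<infinity> \<and> identity_on_boundary f \<and>
                    Var f unit_square < ereal M}"

text \<open>The supremum is taken in the extended reals, so that \<open>dX\<close> below is nonnegative for arbitrary
  arguments, as the locale \<open>Metric_space\<close> requires; see \<open>sup_norm_eq\<close> for bounded functions.\<close>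

definition sup_norm :: "(real^2 \<Rightarrow> real^2) \<Rightarrow> real" where
  "sup_norm h = real_of_ereal (SUP x\<in>unit_square. ereal (norm (h x)))"

definition dX :: "real \<Rightarrow> (real^2 \<Rightarrow> real^2) \<Rightarrow> (real^2 \<Rightarrow> real^2) \<Rightarrow> real" where
  "dX M f g =
     sup_norm (\<lambda>x. f x - g x)
     + sup_norm (\<lambda>y. inv_into unit_square f y - inv_into unit_square g y)
     + \<bar>1 / (M - real_of_ereal (Var f unit_square)) - 1 / (M - real_of_ereal (Var g unit_square))\<bar>"

lemma unit_square_nonempty: "unit_square \<noteq> {}"
proof -
  have "(\<chi> i. 1/2) \<in> unit_square" by (simp add: unit_square_def)
  then show ?thesis by blast
qed

lemma bounded_unit_square: "bounded unit_square"
proof (rule bounded_subset[OF bounded_cbox])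
  show "unit_square \<subseteq> cbox 0 1"
    by (auto simp: unit_square_def mem_box_cart less_imp_le)
qed

lemma square_homeos_image: "f \<in> square_homeos \<Longrightarrow> f ` unit_square = unit_square"
  by (auto simp: square_homeos_def homeomorphism_def)

lemma bdd_above_norm_diff:
  assumes "f ` unit_square \<subseteq> unit_square" "g ` unit_square \<subseteq> unit_square"
  shows "bdd_above ((\<lambda>x. norm (f x - g x)) ` unit_square)"
proof -
  obtain B where B: "\<And>x. x \<in> unit_square \<Longrightarrow> norm x \<le> B"
    using bounded_unit_square by (auto simp: bounded_iff)
  have "norm (f x - g x) \<le> B + B" if "x \<in> unit_square" for x
  proof -
    have "f x \<in> unit_square" "g x \<in> unit_square" using assms that by auto
    then have "norm (f x) \<le> B" "norm (g x) \<le> B" using B by auto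
    then show ?thesis using norm_triangle_ineq4[of "f x" "g x"] by linarith
  qed
  then show ?thesis by (intro bdd_aboveI2) auto
qed

lemma sup_norm_nonneg: "0 \<le> sup_norm h"
proof -
  obtain a where a: "a \<in> unit_square" using unit_square_nonempty by blast
  have "(0::ereal) \<le> (SUP x\<in>unit_square. ereal (norm (h x)))"
    by (rule SUP_upper2[OF a]) simp
  then show ?thesis unfolding sup_norm_def by (rule real_of_ereal_pos)
qed

lemma sup_norm_eq:
  assumes "bdd_above ((\<lambda>x. norm (h x)) ` unit_square)"
  shows "sup_norm h = (SUP x\<in>unit_square. norm (h x))"
proof -
  let ?A = "(\<lambda>x. norm (h x)) ` unit_square"
  have "ereal (Sup ?A) = (SUP a\<in>?A. ereal a)"
  proof (rule ereal_Sup)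
    obtain B where B: "\<And>x. x \<in> unit_square \<Longrightarrow> norm (h x) \<le> B"
      using assms by (auto simp: bdd_above_def)
    obtain a where a: "a \<in> unit_square" using unit_square_nonempty by blast
    have "(SUP a\<in>?A. ereal a) \<le> ereal B" using B by (auto intro!: SUP_least)
    moreover have "0 \<le> (SUP a\<in>?A. ereal a)"
      by (rule SUP_upper2[of "norm (h a)"]) (use a in auto)
    ultimately show "\<bar>SUP a\<in>?A. ereal a\<bar> \<noteq> \<infinity>" by auto
  qed
  then have "(SUP x\<in>unit_square. ereal (norm (h x))) = ereal (Sup ?A)"
    by (simp add: image_comp)
  then show ?thesis by (simp add: sup_norm_def)
qed

lemma sup_norm_triangle:
  assumes f: "f ` unit_square \<subseteq> unit_square" and g: "g ` unit_square \<subseteq> unit_square"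
    and h: "h ` unit_square \<subseteq> unit_square"
  shows "sup_norm (\<lambda>x. f x - h x) \<le> sup_norm (\<lambda>x. f x - g x) + sup_norm (\<lambda>x. g x - h x)"
  unfolding sup_norm_eq[OF bdd_above_norm_diff[OF f h]]
    sup_norm_eq[OF bdd_above_norm_diff[OF f g]] sup_norm_eq[OF bdd_above_norm_diff[OF g h]]
proof (rule cSUP_least[OF unit_square_nonempty])
  fix x assume x: "x \<in> unit_square"
  have "norm (f x - h x) \<le> norm (f x - g x) + norm (g x - h x)"
    using norm_triangle_ineq[of "f x - g x" "g x - h x"] by simp
  also have "\<dots> \<le> (SUP x\<in>unit_square. norm (f x - g x)) + (SUP x\<in>unit_square. norm (g x - h x))"
    by (intro add_mono cSUP_upper x bdd_above_norm_diff f g h)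
  finally show "norm (f x - h x) \<le> \<dots>" .
qed

lemma sup_norm_commute: "sup_norm (\<lambda>x. f x - g x) = sup_norm (\<lambda>x. g x - f x)"
  by (simp add: sup_norm_def norm_minus_commute)

lemma inv_into_image_square:
  assumes "f \<in> square_homeos"
  shows "inv_into unit_square f ` unit_square \<subseteq> unit_square"
  using inv_into_into[of _ f unit_square] square_homeos_image[OF assms] by auto

lemma Metric_space_BV_homeos: "Metric_space (BV_homeos M) (dX M)"
proof
  have im: "f ` unit_square \<subseteq> unit_square" if "f \<in> BV_homeos M" for f
    using that square_homeos_image[of f] by (auto simp: BV_homeos_def)
  have inv: "inv_into unit_square f ` unit_square \<subseteq> unit_square" if "f \<in> BV_homeos M" for f
    using that inv_into_image_square[of f] by (simp add: BV_homeos_def)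
  show "0 \<le> dX M f g" for f g
    unfolding dX_def by (intro add_nonneg_nonneg sup_norm_nonneg abs_ge_zero)
  show "dX M f g = dX M g f" for f g
    unfolding dX_def
    using sup_norm_commute[of f g]
      sup_norm_commute[of "inv_into unit_square f" "inv_into unit_square g"]
    by (simp add: abs_minus_commute)
  show "(dX M f g = 0) = (f = g)" if f: "f \<in> BV_homeos M" and g: "g \<in> BV_homeos M" for f g
  proof
    assume d0: "dX M f g = 0"
    have "sup_norm (\<lambda>x. f x - g x) = 0"
      using d0 sup_norm_nonneg[of "\<lambda>x. f x - g x"]
        sup_norm_nonneg[of "\<lambda>y. inv_into unit_square f y - inv_into unit_square g y"]
      unfolding dX_def by linarith
    then have "norm (f x - g x) \<le> 0" if "x \<in> unit_square" for x
      using cSUP_upper[OF that bdd_above_norm_diff[OF im[OF f] im[OF g]]]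
      by (simp add: sup_norm_eq[OF bdd_above_norm_diff[OF im[OF f] im[OF g]]])
    then have "f x = g x" if "x \<in> unit_square" for x using that by simp
    moreover have "f \<in> extensional unit_square" "g \<in> extensional unit_square"
      using f g by (auto simp: BV_homeos_def square_homeos_def)
    ultimately show "f = g" by (meson extensionalityI)
  qed (simp add: dX_def sup_norm_def unit_square_nonempty)
  show "dX M f h \<le> dX M f g + dX M g h"
    if f: "f \<in> BV_homeos M" and g: "g \<in> BV_homeos M" and h: "h \<in> BV_homeos M" for f g h
    using sup_norm_triangle[OF im[OF f] im[OF g] im[OF h]]
      sup_norm_triangle[OF inv[OF f] inv[OF g] inv[OF h]]
    unfolding dX_def by linarith
qed


section \<open>Baire category\<close>

definition residual_in :: "'a topology \<Rightarrow> 'a set \<Rightarrow> bool" where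
  "residual_in T R \<longleftrightarrow>
     (\<exists>U :: nat \<Rightarrow> 'a set.
        (\<forall>n. openin T (U n) \<and> T closure_of U n = topspace T) \<and> (\<Inter>n. U n) \<subseteq> R)"

definition first_category_in :: "'a topology \<Rightarrow> 'a set \<Rightarrow> bool" where
  "first_category_in T A \<longleftrightarrow> residual_in T (topspace T - A)"

end

theory Submission
  imports Defs
begin

text \<open>Let \<open>f\<close> be a homeomorphism in the space. Precompose it with the inverses of the two shears
  \<open>p\<^sub>\<plusminus>(y) = (y\<^sub>1 \<plusminus> \<eta>(y\<^sub>2) R(n y\<^sub>1)/n, y\<^sub>2)\<close>, where \<open>R\<close> is a smoothed triangle wave with slopes close to
  \<open>\<plusminus>1\<close> and \<open>\<eta>\<close> is a cutoff which is \<open>1\<close> on the middle half of the square. The Piola transform turns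
  test fields for \<open>f \<circ> p\<^sub>\<plusminus>\<^sup>-\<^sup>1\<close> into test fields for \<open>f\<close>, and since the Jacobians of \<open>p\<^sub>+\<close> and \<open>p\<^sub>-\<close> add up
  to 2, the variations of the two deformed maps add up to at most \<open>2 (1 + O(1/n)) Var(f)\<close>. As the
  variation is lower semicontinuous under uniform convergence, both of them are close to \<open>Var(f)\<close>
  for large \<open>n\<close>, so both deformed maps are close to \<open>f\<close> in the metric.

  On the other hand, the intervals on which \<open>p\<^sub>+\<close> and \<open>p\<^sub>-\<close> are strongly contracting alternate and fill
  up the unit interval. Hence for one of the two signs a definite part of the horizontal increase of
  \<open>f\<close>, which is prescribed by the boundary values, takes place on intervals of arbitrarily small total
  length. Maps with such concentrated increments form open dense sets, and a Sobolev map cannot lie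
  in all of them because its weak derivative is integrable.\<close>

section \<open>Smooth functions on the line\<close>

text \<open>The metric controls \<open>Var\<close> itself and not only the uniform distance, so
  squeezing a share of the increase of \<open>f\<close> into thin intervals must leave the variation
  almost unchanged. One shear alone offers no such bound: the second component of a pulled back test
  field carries the Jacobian as a factor, which comes close to 2 where the shear stretches.
  Averaging the two signs removes this factor because \<open>linf4\<close> bounds the four
  components of a test field separately. The individual upper bounds are then indirect: one
  variation is small because the other cannot drop much below that of \<open>f\<close>. The cutoff
  fixes the horizontal sides of the square and causes the only other error, the off-diagonal entry
  \<open>k\<close> of the derivative, which has size O(1/n). Increments are measured by vertical
  means whose weight lives where the cutoff is 1, so there the shear is a pure change of the
  horizontal variable. The wave is smoothed because the Piola transform contains first derivatives
  of the shear and must itself be a C^1 test field.\<close>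

primrec Ck_real :: "nat \<Rightarrow> (real \<Rightarrow> real) \<Rightarrow> bool" where
  "Ck_real 0 f \<longleftrightarrow> continuous_on UNIV f"
| "Ck_real (Suc k) f \<longleftrightarrow> (\<exists>f'. (\<forall>x. (f has_real_derivative f' x) (at x)) \<and> Ck_real k f')"

lemma Ck_real_continuous: "Ck_real k f \<Longrightarrow> continuous_on UNIV f"
  by (cases k) (auto intro!: continuous_at_imp_continuous_on dest: DERIV_isCont)

lemma Ck_real_Suc_imp: "Ck_real (Suc k) f \<Longrightarrow> Ck_real k f"
proof (induction k arbitrary: f)
  case 0
  then show ?case using Ck_real_continuous[of "Suc 0"] by auto
next
  case (Suc k)
  then show ?case by (metis Ck_real.simps(2))
qed

lemma Ck_real_diff: "Ck_real k f \<Longrightarrow> Ck_real k g \<Longrightarrow> Ck_real k (\<lambda>x. f x - g x)"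
proof (induction k arbitrary: f g)
  case 0
  then show ?case by (auto intro: continuous_on_diff)
next
  case (Suc k)
  then obtain f' g' where
    "\<And>x. (f has_real_derivative f' x) (at x)" "Ck_real k f'"
    "\<And>x. (g has_real_derivative g' x) (at x)" "Ck_real k g'" by auto
  then show ?case using Suc.IH[of f' g']
    by (auto intro!: exI[of _ "\<lambda>x. f' x - g' x"] DERIV_diff)
qed

lemma Ck_real_affine: "Ck_real k f \<Longrightarrow> Ck_real k (\<lambda>x. c * f (a * x + b))"
proof (induction k arbitrary: f c)
  case 0
  then have "continuous_on UNIV f" by simp
  then have "continuous_on UNIV (\<lambda>x. f (a * x + b))"
    by (rule continuous_on_compose2) (auto intro!: continuous_intros)
  then show ?case by (auto intro!: continuous_intros)
next
  case (Suc k)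
  then obtain f' where f': "\<And>x. (f has_real_derivative f' x) (at x)" "Ck_real k f'" by auto
  have "((\<lambda>x. c * f (a * x + b)) has_real_derivative (c * a) * f' (a * x + b)) (at x)" for x
    by (auto intro!: derivative_eq_intros DERIV_chain2[OF f'(1)])
  then show ?case unfolding Ck_real.simps using Suc.IH[OF f'(2), of "c * a"]
    by (intro exI[of _ "\<lambda>x. (c * a) * f' (a * x + b)"]) auto
qed

section \<open>Exponentially flat bump functions on the unit interval\<close>

lemma continuous_unit_interval_bounded:
  fixes f :: "real \<Rightarrow> real"
  assumes "continuous_on {0..1} f"
  obtains B where "0 < B" "\<And>x. 0 \<le> x \<Longrightarrow> x \<le> 1 \<Longrightarrow> \<bar>f x\<bar> \<le> B"
proof -
  have "bounded (f ` {0..1})"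
    using assms by (intro compact_imp_bounded compact_continuous_image) auto
  then show thesis using that by (auto simp: bounded_pos)
qed

text \<open>This family is closed under differentiation: the polynomial and the power in the
  denominator absorb everything the product and chain rules produce. Smoothness of the standard bump
  \<open>bump_fun 1 0\<close> is then an induction over one differentiability statement.\<close>

definition bump_fun :: "real poly \<Rightarrow> nat \<Rightarrow> real \<Rightarrow> real" where
  "bump_fun P k x = (if 0 < x \<and> x < 1
     then poly P x / (x * (1 - x)) ^ k * exp (- (1 / (x * (1 - x)))) else 0)"

text \<open>Only the term of order \<open>m\<close> of the exponential series at
  \<open>1 / z\<close> is kept, the others being nonnegative. As \<open>m\<close> is free, this
  beats any pole in \<open>z\<close>.\<close>

lemma exp_minus_inverse_le:
  fixes z :: real
  assumes "0 < z"
  shows "exp (- (1 / z)) \<le> fact m * z ^ m"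
proof -
  have "(\<lambda>n. (1 / z) ^ n /\<^sub>R fact n) sums exp (1 / z)" by (rule exp_converges)
  then have "(\<Sum>n\<in>{m}. (1 / z) ^ n /\<^sub>R fact n) \<le> exp (1 / z)"
    using assms by (intro sum_le_suminf[of "\<lambda>n. (1 / z) ^ n /\<^sub>R fact n" "{m}", THEN order_trans])
      (auto simp: sums_iff)
  then show ?thesis using assms
    by (simp add: exp_minus field_simps power_divide)
qed

text \<open>Serves the two endpoints of the unit interval, where the formula for
  \<open>bump_fun\<close> is glued to 0.\<close>

lemma has_real_derivative_zero_quadratic:
  fixes f :: "real \<Rightarrow> real"
  assumes "\<And>x. \<bar>f x\<bar> \<le> C * (x - a)\<^sup>2"
  shows "(f has_real_derivative 0) (at a)"
proof -
  have f0: "f a = 0" using assms[of a] by simp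
  have "((\<lambda>x. (f x - f a) / (x - a)) \<longlongrightarrow> 0) (at a)"
  proof (rule Lim_null_comparison)
    show "\<forall>\<^sub>F x in at a. norm ((f x - f a) / (x - a)) \<le> C * \<bar>x - a\<bar>"
      unfolding eventually_at
    proof (intro exI[of _ 1] conjI ballI impI)
      fix x assume "x \<noteq> a \<and> dist x a < 1"
      then show "norm ((f x - f a) / (x - a)) \<le> C * \<bar>x - a\<bar>"
        using assms[of x] f0 by (simp add: abs_divide divide_le_eq power2_eq_square mult.assoc)
    qed simp
    show "((\<lambda>x. C * \<bar>x - a\<bar>) \<longlongrightarrow> 0) (at a)"
      by (auto intro!: tendsto_eq_intros)
  qed
  then show ?thesis by (simp add: has_field_derivative_iff)
qed

lemma bump_fun_quadratic_bound:
  obtains C where "\<And>x. \<bar>bump_fun P k x\<bar> \<le> C * x\<^sup>2" "\<And>x. \<bar>bump_fun P k x\<bar> \<le> C * (x - 1)\<^sup>2"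
proof -
  have "continuous_on {0..1} (poly P)" by (intro continuous_intros)
  then obtain B where B: "\<And>x. 0 \<le> x \<Longrightarrow> x \<le> 1 \<Longrightarrow> \<bar>poly P x\<bar> \<le> B"
    using continuous_unit_interval_bounded by blast
  have B0: "0 \<le> B" using B[of 0] by simp
  \<comment> \<open>The choice \<open>m = k + 2\<close> in the exponential estimate:
    \<open>k\<close> powers of \<open>z\<close> cancel the pole and two remain.\<close>
  let ?C = "B * fact (k + 2)"
  have key: "\<bar>bump_fun P k x\<bar> \<le> ?C * (x * (1 - x))\<^sup>2" for x
  proof (cases "0 < x \<and> x < 1")
    case True
    define z where "z = x * (1 - x)"
    have z: "0 < z" using True by (simp add: z_def)
    have "\<bar>bump_fun P k x\<bar> = \<bar>poly P x\<bar> / z ^ k * exp (- (1 / z))"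
      using True z by (simp add: bump_fun_def z_def abs_mult)
    also have "\<dots> \<le> B / z ^ k * (fact (k + 2) * z ^ (k + 2))"
      using z B[of x] True exp_minus_inverse_le[OF z, of "k + 2"] B0
      by (intro mult_mono divide_right_mono) auto
    also have "\<dots> = ?C * z\<^sup>2" using z by (simp add: power_add power2_eq_square)
    finally show ?thesis by (simp add: z_def)
  qed (use B0 in \<open>auto simp: bump_fun_def\<close>)
  have C0: "0 \<le> ?C" using B0 by simp
  show thesis
  proof
    fix x
    show "\<bar>bump_fun P k x\<bar> \<le> ?C * x\<^sup>2"
    proof (cases "0 < x \<and> x < 1")
      case True
      then have "(x * (1 - x))\<^sup>2 \<le> x\<^sup>2" by (intro power_mono) (auto simp: mult_le_cancel_left1)
      then show ?thesis using key[of x] C0 by (meson mult_left_mono order_trans)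
    qed (use C0 in \<open>auto simp: bump_fun_def\<close>)
    show "\<bar>bump_fun P k x\<bar> \<le> ?C * (x - 1)\<^sup>2"
    proof (cases "0 < x \<and> x < 1")
      case True
      then have "(x * (1 - x))\<^sup>2 \<le> (1 - x)\<^sup>2" by (intro power_mono) (auto simp: mult_le_cancel_right1)
      then show ?thesis using key[of x] C0 by (metis mult_left_mono order_trans power2_commute)
    qed (use C0 in \<open>auto simp: bump_fun_def\<close>)
  qed
qed

lemma bump_fun_has_derivative:
  "\<exists>Q m. \<forall>x. (bump_fun P k has_real_derivative bump_fun Q m x) (at x)"
proof -
  let ?z = "[:0, 1, -1:] :: real poly" and ?z' = "[:1, -2:] :: real poly"
  \<comment> \<open>The product rule for P z^(-k) exp(-1/z) with z = x (1 - x), put over the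
    denominator z^(k+2). The middle term comes from the pole, the last one from the exponential;
    \<open>?z'\<close> is 1 - 2x.\<close>
  define Q where "Q = pderiv P * ?z\<^sup>2 - smult (real k) (P * ?z' * ?z) + P * ?z'"
  have "(bump_fun P k has_real_derivative bump_fun Q (k + 2) x) (at x)" for x
  proof -
    obtain C where C: "\<And>x. \<bar>bump_fun P k x\<bar> \<le> C * x\<^sup>2" "\<And>x. \<bar>bump_fun P k x\<bar> \<le> C * (x - 1)\<^sup>2"
      using bump_fun_quadratic_bound by blast
    consider "x < 0" | "x = 0" | "x = 1" | "1 < x" | "0 < x" "x < 1" by linarith
    then show ?thesis
    proof cases
      case 1
      have "((\<lambda>x. 0) has_real_derivative bump_fun Q (k + 2) x) (at x)"
        using 1 by (simp add: bump_fun_def)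
      then show ?thesis
        by (rule has_field_derivative_transform_within_open[where S="{..<0}"])
          (use 1 in \<open>auto simp: bump_fun_def\<close>)
    next
      case 4
      have "((\<lambda>x. 0) has_real_derivative bump_fun Q (k + 2) x) (at x)"
        using 4 by (simp add: bump_fun_def)
      then show ?thesis
        by (rule has_field_derivative_transform_within_open[where S="{1<..}"])
          (use 4 in \<open>auto simp: bump_fun_def\<close>)
    next
      case 2
      then show ?thesis using has_real_derivative_zero_quadratic[of "bump_fun P k" C 0] C
        by (simp add: bump_fun_def)
    next
      case 3
      then show ?thesis using has_real_derivative_zero_quadratic[of "bump_fun P k" C 1] C
        by (simp add: bump_fun_def)
    next
      case 5
      define z where "z = x * (1 - x)"
      have z: "z \<noteq> 0" using 5 by (simp add: z_def)
      have dz: "((\<lambda>x. x * (1 - x)) has_real_derivative 1 - 2 * x) (at x)"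
        by (auto intro!: derivative_eq_intros)
      have di: "((\<lambda>x. inverse (x * (1 - x))) has_real_derivative - ((1 - 2 * x) / z\<^sup>2)) (at x)"
        by (rule DERIV_cong[OF DERIV_inverse'[OF dz]])
          (use z in \<open>simp_all add: z_def[symmetric] field_simps power2_eq_square\<close>)
      have dk: "((\<lambda>x. inverse (x * (1 - x)) ^ k) has_real_derivative
          - (real k * (1 - 2 * x) / z ^ (k + 1))) (at x)"
      proof (rule DERIV_cong[OF DERIV_power[OF di]])
        show "real k * (- ((1 - 2 * x) / z\<^sup>2) * inverse (x * (1 - x)) ^ (k - Suc 0)) =
            - (real k * (1 - 2 * x) / z ^ (k + 1))"
          unfolding z_def[symmetric] using z
          by (cases k) (simp_all add: field_simps power2_eq_square)
      qed
      have de: "((\<lambda>x. exp (- inverse (x * (1 - x)))) has_real_derivative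
          exp (- inverse z) * ((1 - 2 * x) / z\<^sup>2)) (at x)"
        by (rule DERIV_cong[OF DERIV_fun_exp[OF DERIV_minus[OF di]]]) (simp add: z_def)
      have "((\<lambda>x. poly P x * inverse (x * (1 - x)) ^ k * exp (- inverse (x * (1 - x))))
          has_real_derivative bump_fun Q (k + 2) x) (at x)"
      proof (rule DERIV_cong[OF DERIV_mult[OF DERIV_mult[OF poly_DERIV dk] de]])
        have Q: "poly Q x = poly (pderiv P) x * z\<^sup>2 - real k * (poly P x * (1 - 2 * x) * z) + poly P x * (1 - 2 * x)"
          by (simp add: Q_def z_def algebra_simps power2_eq_square)
        have "poly Q x * inverse z ^ (k + 2) = poly (pderiv P) x * (z\<^sup>2 * inverse z ^ (k + 2))
            - real k * poly P x * (1 - 2 * x) * (z * inverse z ^ (k + 2))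
            + poly P x * (1 - 2 * x) * inverse z ^ (k + 2)"
          unfolding Q by (simp add: algebra_simps)
        moreover have zi: "z\<^sup>2 * inverse z ^ (k + 2) = inverse z ^ k" "z * inverse z ^ (k + 2) = inverse z ^ (k + 1)"
          using z by (simp_all add: field_simps power2_eq_square)
        ultimately have Qi: "poly Q x * inverse z ^ (k + 2) = poly (pderiv P) x * inverse z ^ k
            - real k * poly P x * (1 - 2 * x) * inverse z ^ (k + 1)
            + poly P x * (1 - 2 * x) * inverse z ^ (k + 2)" by (simp only: zi)
        have Be: "bump_fun Q (k + 2) x = poly Q x * inverse z ^ (k + 2) * exp (- inverse z)"
          using 5 by (simp add: bump_fun_def z_def inverse_eq_divide power_one_over)
        have d: "real k * (1 - 2 * x) / z ^ (k + 1) = real k * (1 - 2 * x) * inverse z ^ (k + 1)"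
          "(1 - 2 * x) / z\<^sup>2 = (1 - 2 * x) * inverse z ^ 2"
          by (simp_all add: divide_inverse power_inverse)
        show "(poly (pderiv P) x * inverse (x * (1 - x)) ^ k +
            - (real k * (1 - 2 * x) / z ^ (k + 1)) * poly P x) * exp (- inverse (x * (1 - x))) +
            exp (- inverse z) * ((1 - 2 * x) / z\<^sup>2) * (poly P x * inverse (x * (1 - x)) ^ k) =
            bump_fun Q (k + 2) x"
          unfolding z_def[symmetric] Be Qi d by (simp add: algebra_simps power2_eq_square)
      qed
      then show ?thesis
        by (rule has_field_derivative_transform_within_open[where S="{0<..<1}"])
          (use 5 in \<open>auto simp: bump_fun_def inverse_eq_divide power_one_over\<close>)
    qed
  qed
  then show ?thesis by blast
qed

lemma Ck_real_bump_fun: "Ck_real n (bump_fun P k)"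
proof (induction n arbitrary: P k)
  case 0
  obtain Q m where "\<And>x. (bump_fun P k has_real_derivative bump_fun Q m x) (at x)"
    using bump_fun_has_derivative by blast
  then show ?case by (auto intro!: continuous_at_imp_continuous_on dest: DERIV_isCont)
next
  case (Suc n)
  then show ?case using bump_fun_has_derivative[of P k] by fastforce
qed

section \<open>Mollifier, smooth step and the two weights built from them\<close>

definition mollifier :: "real \<Rightarrow> real" where
  "mollifier x = bump_fun 1 0 x / integral {0..1} (bump_fun 1 0)"

lemma continuous_on_bump_fun: "continuous_on A (bump_fun P k)"
  using Ck_real_continuous[OF Ck_real_bump_fun] continuous_on_subset by blast

lemma integral_bump_pos: "0 < integral {0..1} (bump_fun 1 0)"
proof -
  have nn: "0 \<le> bump_fun 1 0 x" for x by (simp add: bump_fun_def)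
  have "integral {0..1} (bump_fun 1 0) \<noteq> 0"
  proof
    assume "integral {0..1} (bump_fun 1 0) = 0"
    then have "\<forall>x\<in>{0..1}. bump_fun 1 0 x = 0"
      by (subst (asm) integral_eq_0_iff) (auto simp: nn continuous_on_bump_fun)
    then show False by (auto simp: bump_fun_def dest!: bspec[of _ _ "1/2"])
  qed
  moreover have "0 \<le> integral {0..1} (bump_fun 1 0)"
    by (intro integral_nonneg integrable_continuous_real continuous_on_bump_fun) (auto simp: nn)
  ultimately show ?thesis by simp
qed

lemma mollifier_nonneg: "0 \<le> mollifier x"
  using integral_bump_pos by (simp add: mollifier_def bump_fun_def)

lemma mollifier_eq_0: "x \<le> 0 \<or> 1 \<le> x \<Longrightarrow> mollifier x = 0"
  by (auto simp: mollifier_def bump_fun_def)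

lemma integral_mollifier: "integral {0..1} mollifier = 1"
  using integral_bump_pos by (simp add: mollifier_def[abs_def] divide_inverse)

lemma Ck_real_mollifier: "Ck_real k mollifier"
  using Ck_real_affine[OF Ck_real_bump_fun, of k "1 / integral {0..1} (bump_fun 1 0)" 1 0 1 0]
  by (simp add: mollifier_def[abs_def])

lemma continuous_on_mollifier: "continuous_on A mollifier"
  using Ck_real_continuous[OF Ck_real_mollifier] continuous_on_subset by blast

text \<open>Starting the integral at -1 instead of 0 keeps every point \<open>x \<ge> 0\<close> in
  the interior of the interval to which the fundamental theorem is applied, so the endpoint 0 needs
  no separate argument.\<close>

definition smooth_step :: "real \<Rightarrow> real" where
  "smooth_step x = integral {-1..x} mollifier"

lemma smooth_step_eq_0: "x \<le> 0 \<Longrightarrow> smooth_step x = 0"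
  unfolding smooth_step_def by (subst integral_cong[of _ _ "\<lambda>_. 0"]) (auto simp: mollifier_eq_0)

lemma smooth_step_eq_1:
  assumes "1 \<le> x" shows "smooth_step x = 1"
proof -
  have i: "mollifier integrable_on {a..b}" for a b
    by (rule integrable_continuous_real[OF continuous_on_mollifier])
  have "integral {-1..x} mollifier = integral {-1..0} mollifier + integral {0..1} mollifier + integral {1..x} mollifier"
    using assms i by (simp add: Henstock_Kurzweil_Integration.integral_combine)
  also have "integral {-1..0} mollifier = 0"
    by (subst integral_cong[of _ _ "\<lambda>_. 0"]) (auto simp: mollifier_eq_0)
  also have "integral {1..x} mollifier = 0"
    by (subst integral_cong[of _ _ "\<lambda>_. 0"]) (auto simp: mollifier_eq_0)
  finally show ?thesis by (simp add: smooth_step_def integral_mollifier)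
qed

lemma smooth_step_has_derivative: "(smooth_step has_real_derivative mollifier x) (at x)"
proof (cases "x < 0")
  case True
  have "((\<lambda>x. 0) has_real_derivative mollifier x) (at x)"
    using True by (simp add: mollifier_eq_0)
  then show ?thesis
    by (rule has_field_derivative_transform_within_open[where S="{..<0}"])
      (use True in \<open>auto simp: smooth_step_eq_0\<close>)
next
  case False
  have "((\<lambda>u. integral {-1..u} mollifier) has_real_derivative mollifier x) (at x within {-1..x+1})"
    using False by (intro integral_has_real_derivative continuous_on_mollifier) auto
  moreover have "at x within {-1..x+1} = at x"
    using False by (intro at_within_interior) auto
  ultimately show ?thesis by (simp add: smooth_step_def[abs_def])
qed

lemma smooth_step_mono: "x \<le> y \<Longrightarrow> smooth_step x \<le> smooth_step y"
  using smooth_step_has_derivative mollifier_nonneg by (metis DERIV_nonneg_imp_nondecreasing)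

lemma smooth_step_bounds: "0 \<le> smooth_step x" "smooth_step x \<le> 1"
  using smooth_step_mono[of "min x 0" x] smooth_step_mono[of x "max x 1"]
  by (auto simp: smooth_step_eq_0 smooth_step_eq_1)

lemma Ck_real_smooth_step: "Ck_real k smooth_step"
proof (rule Ck_real_Suc_imp)
  show "Ck_real (Suc k) smooth_step"
    using smooth_step_has_derivative Ck_real_mollifier by auto
qed

text \<open>Rises on [0, 1/4] and falls on [3/4, 1]. It lets the shears fix the bottom and the top
  side and leaves them at full strength on the middle half, where \<open>strip_bump\<close>
  lives.\<close>

definition cutoff :: "real \<Rightarrow> real" where
  "cutoff t = smooth_step (4 * t) - smooth_step (4 * t - 3)"

lemma cutoff_bounds: "0 \<le> cutoff t" "cutoff t \<le> 1"
  using smooth_step_mono[of "4 * t - 3" "4 * t"] smooth_step_bounds[of "4 * t - 3"]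
    smooth_step_bounds[of "4 * t"]
  by (auto simp: cutoff_def)

lemma cutoff_eq_0: "t \<le> 0 \<or> 1 \<le> t \<Longrightarrow> cutoff t = 0"
  by (auto simp: cutoff_def smooth_step_eq_0 smooth_step_eq_1)

lemma cutoff_eq_1: "1/4 \<le> t \<Longrightarrow> t \<le> 3/4 \<Longrightarrow> cutoff t = 1"
  by (auto simp: cutoff_def smooth_step_eq_0 smooth_step_eq_1)

definition cutoff' :: "real \<Rightarrow> real" where
  "cutoff' t = 4 * mollifier (4 * t) - 4 * mollifier (4 * t - 3)"

lemma cutoff_has_derivative: "(cutoff has_real_derivative cutoff' t) (at t)"
  unfolding cutoff_def[abs_def] cutoff'_def
  by (auto intro!: derivative_eq_intros DERIV_chain2[OF smooth_step_has_derivative])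

lemma Ck_real_cutoff': "Ck_real k cutoff'"
  unfolding cutoff'_def[abs_def]
  using Ck_real_diff[OF Ck_real_affine[OF Ck_real_mollifier, of k 4 4 0] Ck_real_affine[OF Ck_real_mollifier, of k 4 4 "-3"]]
  by simp

lemma cutoff'_bounded: obtains C where "0 < C" "\<And>t. 0 \<le> t \<Longrightarrow> t \<le> 1 \<Longrightarrow> \<bar>cutoff' t\<bar> \<le> C"
  using continuous_unit_interval_bounded[of cutoff'] Ck_real_continuous[OF Ck_real_cutoff'[of 0]]
    continuous_on_subset by (metis subset_UNIV)

text \<open>Weight for averaging over vertical lines. It is supported where \<open>cutoff\<close> is
  1, and smooth so that it can be the vertical factor of a test function in the definition of the
  weak derivative.\<close>

definition strip_bump :: "real \<Rightarrow> real" where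
  "strip_bump t = mollifier (2 * t - 1/2)"

lemma strip_bump_nonneg: "0 \<le> strip_bump t"
  by (simp add: strip_bump_def mollifier_nonneg)

lemma strip_bump_eq_0: "t \<le> 1/4 \<or> 3/4 \<le> t \<Longrightarrow> strip_bump t = 0"
  by (auto simp: strip_bump_def intro!: mollifier_eq_0)

lemma Ck_real_strip_bump: "Ck_real k strip_bump"
  using Ck_real_affine[OF Ck_real_mollifier, of k 1 2 "-1/2"]
  by (simp add: strip_bump_def[abs_def])

lemma continuous_on_strip_bump: "continuous_on A strip_bump"
  using Ck_real_continuous[OF Ck_real_strip_bump] continuous_on_subset by blast

lemma strip_bump_bounded: obtains C where "0 < C" "\<And>t. strip_bump t \<le> C"
proof -
  obtain C where C: "\<And>t. 0 \<le> t \<Longrightarrow> t \<le> 1 \<Longrightarrow> \<bar>strip_bump t\<bar> \<le> C"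
    using continuous_unit_interval_bounded[OF continuous_on_strip_bump] by blast
  have "strip_bump t \<le> max C 1" for t
    using C[of t] strip_bump_eq_0[of t] by (cases "0 \<le> t \<and> t \<le> 1") auto
  then show thesis using that[of "max C 1"] by auto
qed

text \<open>The total horizontal increase available: for a map fixing the boundary, the weighted
  mean of the first coordinate tends to 0 at the left side and to this value at the right
  side.\<close>

definition strip_mass :: real where "strip_mass = integral {0..1} strip_bump"

lemma strip_mass_pos: "0 < strip_mass"
proof -
  have "integral {0..1} strip_bump \<noteq> 0"
  proof
    assume "integral {0..1} strip_bump = 0"
    then have "\<forall>x\<in>{0..1}. strip_bump x = 0"
      by (subst (asm) integral_eq_0_iff) (auto simp: strip_bump_nonneg continuous_on_strip_bump)
    then have "strip_bump (1/2) = 0" by auto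
    then show False using integral_bump_pos
      by (auto simp: bump_fun_def strip_bump_def mollifier_def)
  qed
  moreover have "0 \<le> integral {0..1} strip_bump"
    by (intro integral_nonneg integrable_continuous_real continuous_on_strip_bump)
      (auto simp: strip_bump_nonneg)
  ultimately show ?thesis by (simp add: strip_mass_def)
qed

section \<open>Calculus on the unit square\<close>

abbreviation vec2 :: "real \<Rightarrow> real \<Rightarrow> real^2" where
  "vec2 s t \<equiv> vector [s, t]"

lemma vec2_eta: "vec2 (x $ 1) (x $ 2) = x"
  by (simp add: vec_eq_iff forall_2)

lemma vec2_in_unit_square: "vec2 s t \<in> unit_square \<longleftrightarrow> s \<in> {0<..<1} \<and> t \<in> {0<..<1}"
  by (auto simp: unit_square_def forall_2)

lemma unit_square_eq_box: "unit_square = box 0 1"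
  by (auto simp: unit_square_def mem_box_cart)

lemma open_unit_square [simp]: "open unit_square"
  by (simp add: unit_square_eq_box open_box)

lemma closure_unit_square: "closure unit_square = cbox 0 1"
  using unit_square_nonempty by (simp add: unit_square_eq_box closure_box)

lemma frontier_unit_square: "frontier unit_square = cbox 0 1 - unit_square"
  by (simp add: frontier_def closure_unit_square interior_open)

lemma has_derivative_vec2:
  assumes "(f has_derivative f') F" "(g has_derivative g') F"
  shows "((\<lambda>x. vec2 (f x) (g x)) has_derivative (\<lambda>v. vec2 (f' v) (g' v))) F"
proof -
  have eq: "(\<lambda>x. vec2 (a x) (b x)) = (\<lambda>x. a x *\<^sub>R axis 1 1 + b x *\<^sub>R axis 2 1)" for a b :: "'a \<Rightarrow> real"
    by (simp add: fun_eq_iff vec_eq_iff forall_2 axis_def)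
  show ?thesis unfolding eq by (auto intro!: derivative_eq_intros assms)
qed

lemma continuous_on_vec2 [continuous_intros]:
  assumes "continuous_on S f" "continuous_on S g"
  shows "continuous_on S (\<lambda>x. vec2 (f x) (g x))"
proof -
  have eq: "(\<lambda>x. vec2 (f x) (g x)) = (\<lambda>x. f x *\<^sub>R axis 1 1 + g x *\<^sub>R axis 2 1)"
    by (simp add: fun_eq_iff vec_eq_iff forall_2 axis_def)
  show ?thesis unfolding eq by (intro continuous_intros assms)
qed

lemma partial_deriv_eq:
  "(f has_derivative D) (at x) \<Longrightarrow> partial_deriv i f x = D (axis i 1)"
  by (simp add: partial_deriv_def flip: frechet_derivative_at)

lemma has_derivative_partial_deriv:
  assumes "f differentiable (at x)"
  shows "(f has_derivative (\<lambda>v. v $ 1 *\<^sub>R partial_deriv 1 f x + v $ 2 *\<^sub>R partial_deriv 2 f x)) (at x)"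
proof -
  have D: "(f has_derivative frechet_derivative f (at x)) (at x)"
    using assms frechet_derivative_works by blast
  then interpret bounded_linear "frechet_derivative f (at x)" by (rule has_derivative_bounded_linear)
  have "frechet_derivative f (at x) v = v $ 1 *\<^sub>R partial_deriv 1 f x + v $ 2 *\<^sub>R partial_deriv 2 f x" for v
  proof -
    have "v = v $ 1 *\<^sub>R axis 1 1 + v $ 2 *\<^sub>R axis 2 1"
      by (simp add: vec_eq_iff forall_2 axis_def)
    then show ?thesis unfolding partial_deriv_def by (metis add scaleR)
  qed
  then show ?thesis using D by (metis (no_types, lifting) ext)
qed

text \<open>Replaces the recursion through \<open>frechet_derivative\<close> by explicit candidates
  for the partial derivatives, so that C^1 regularity of a composite is shown by writing down its
  derivative.\<close>

lemma Ck_on_1_iff: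
  "Ck_on 1 S f \<longleftrightarrow> (\<exists>A B. continuous_on S A \<and> continuous_on S B \<and>
     (\<forall>x\<in>S. (f has_derivative (\<lambda>v. v $ 1 *\<^sub>R A x + v $ 2 *\<^sub>R B x)) (at x)))"
proof
  assume "Ck_on 1 S f"
  then show "\<exists>A B. continuous_on S A \<and> continuous_on S B \<and>
     (\<forall>x\<in>S. (f has_derivative (\<lambda>v. v $ 1 *\<^sub>R A x + v $ 2 *\<^sub>R B x)) (at x))"
    using has_derivative_partial_deriv
    by (intro exI[of _ "partial_deriv 1 f"] exI[of _ "partial_deriv 2 f"]) auto
next
  assume "\<exists>A B. continuous_on S A \<and> continuous_on S B \<and>
     (\<forall>x\<in>S. (f has_derivative (\<lambda>v. v $ 1 *\<^sub>R A x + v $ 2 *\<^sub>R B x)) (at x))"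
  then obtain A B where A: "continuous_on S A" and B: "continuous_on S B"
    and D: "\<And>x. x \<in> S \<Longrightarrow> (f has_derivative (\<lambda>v. v $ 1 *\<^sub>R A x + v $ 2 *\<^sub>R B x)) (at x)" by blast
  have p: "partial_deriv 1 f x = A x" "partial_deriv 2 f x = B x" if "x \<in> S" for x
    using partial_deriv_eq[OF D[OF that], of 1] partial_deriv_eq[OF D[OF that], of 2]
    by (simp_all add: axis_def)
  have "continuous_on S (partial_deriv 1 f)" "continuous_on S (partial_deriv 2 f)"
    using A B p by (simp_all cong: continuous_on_cong)
  then show "Ck_on 1 S f" using D by (auto simp: forall_2 differentiable_def)
qed

lemma Ck_on_1_differentiable: "Ck_on 1 S f \<Longrightarrow> x \<in> S \<Longrightarrow> f differentiable (at x)"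
  by simp

lemma Ck_on_1_continuous_partial: "Ck_on 1 S f \<Longrightarrow> continuous_on S (partial_deriv i f)"
  by simp

lemma Ck_on_1_bounded_linear:
  assumes "Ck_on 1 S f" "bounded_linear h"
  shows "Ck_on 1 S (\<lambda>x. h (f x))"
proof -
  interpret bounded_linear h by fact
  from assms(1) obtain A B where A: "continuous_on S A" and B: "continuous_on S B"
    and D: "\<And>x. x \<in> S \<Longrightarrow> (f has_derivative (\<lambda>v. v $ 1 *\<^sub>R A x + v $ 2 *\<^sub>R B x)) (at x)"
    unfolding Ck_on_1_iff by blast
  have "((\<lambda>x. h (f x)) has_derivative (\<lambda>v. v $ 1 *\<^sub>R h (A x) + v $ 2 *\<^sub>R h (B x))) (at x)"
    if "x \<in> S" for x
    using has_derivative[OF D[OF that]] by (simp add: add scaleR)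
  then show ?thesis unfolding Ck_on_1_iff using continuous_on[OF A] continuous_on[OF B] by blast
qed

lemma Ck_on_1_add:
  assumes "Ck_on 1 S f" "Ck_on 1 S g"
  shows "Ck_on 1 S (\<lambda>x. f x + g x)"
proof -
  from assms(1) obtain A B where A: "continuous_on S A" and B: "continuous_on S B"
    and D: "\<And>x. x \<in> S \<Longrightarrow> (f has_derivative (\<lambda>v. v $ 1 *\<^sub>R A x + v $ 2 *\<^sub>R B x)) (at x)"
    unfolding Ck_on_1_iff by blast
  from assms(2) obtain A' B' where A': "continuous_on S A'" and B': "continuous_on S B'"
    and D': "\<And>x. x \<in> S \<Longrightarrow> (g has_derivative (\<lambda>v. v $ 1 *\<^sub>R A' x + v $ 2 *\<^sub>R B' x)) (at x)"
    unfolding Ck_on_1_iff by blast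
  have "((\<lambda>x. f x + g x) has_derivative (\<lambda>v. v $ 1 *\<^sub>R (A x + A' x) + v $ 2 *\<^sub>R (B x + B' x))) (at x)"
    if "x \<in> S" for x
    using has_derivative_add[OF D[OF that] D'[OF that]] by (simp add: scaleR_add_right add_ac)
  then show ?thesis unfolding Ck_on_1_iff
    using continuous_on_add[OF A A'] continuous_on_add[OF B B'] by blast
qed

lemma compactly_supported_in_comp:
  "compactly_supported_in S f \<Longrightarrow> h 0 = 0 \<Longrightarrow> compactly_supported_in S (\<lambda>x. h (f x))"
  unfolding compactly_supported_in_def by force

lemma compactly_supported_in_add:
  assumes "compactly_supported_in S f" "compactly_supported_in S g"
  shows "compactly_supported_in S (\<lambda>x. f x + g x)"
proof -
  obtain K K' where "compact K" "K \<subseteq> S" "\<And>x. x \<in> S - K \<Longrightarrow> f x = 0"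
    "compact K'" "K' \<subseteq> S" "\<And>x. x \<in> S - K' \<Longrightarrow> g x = 0"
    using assms unfolding compactly_supported_in_def by blast
  then show ?thesis unfolding compactly_supported_in_def
    by (intro exI[of _ "K \<union> K'"]) (auto intro: compact_Un)
qed

lemma compactly_supported_in_partial_deriv:
  assumes "compactly_supported_in S f" "open S"
  shows "compactly_supported_in S (partial_deriv i f)"
proof -
  obtain K where K: "compact K" "K \<subseteq> S" "\<And>x. x \<in> S - K \<Longrightarrow> f x = 0"
    using assms unfolding compactly_supported_in_def by blast
  have "partial_deriv i f x = 0" if "x \<in> S - K" for x
  proof -
    have "open (S - K)" using K(1) assms(2) by (intro open_Diff compact_imp_closed)
    then have "(f has_derivative (\<lambda>v. 0)) (at x)"
      using that K(3) by (intro has_derivative_transform_within_open[OF has_derivative_const, where s="S - K"]) auto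
    then show ?thesis by (simp add: partial_deriv_eq)
  qed
  then show ?thesis unfolding compactly_supported_in_def using K by blast
qed

lemma compactly_supported_in_bounded:
  assumes "compactly_supported_in S f" "continuous_on S f"
  obtains B where "0 < B" "\<And>x. x \<in> S \<Longrightarrow> norm (f x) \<le> B"
proof -
  obtain K where K: "compact K" "K \<subseteq> S" "\<And>x. x \<in> S - K \<Longrightarrow> f x = 0"
    using assms unfolding compactly_supported_in_def by blast
  have "bounded (f ` K)"
    using K assms(2) by (intro compact_imp_bounded compact_continuous_image) (auto elim: continuous_on_subset)
  then obtain B where B: "0 < B" "\<And>x. x \<in> K \<Longrightarrow> norm (f x) \<le> B" by (auto simp: bounded_pos)
  have "norm (f x) \<le> B" if "x \<in> S" for x
    using B K(3)[of x] that by (cases "x \<in> K") auto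
  then show thesis using that B(1) by blast
qed

lemma div2_eq: "div2 \<phi> x = partial_deriv 1 \<phi> x $ 1 + partial_deriv 2 \<phi> x $ 2"
  by (simp add: div2_def sum_2)

lemma div2_add:
  assumes "\<phi> differentiable (at x)" "\<psi> differentiable (at x)"
  shows "div2 (\<lambda>x. \<phi> x + \<psi> x) x = div2 \<phi> x + div2 \<psi> x"
  using partial_deriv_eq[OF has_derivative_add[OF has_derivative_partial_deriv[OF assms(1)]
      has_derivative_partial_deriv[OF assms(2)]]]
  by (simp add: div2_eq axis_def)

lemma div2_scaleR:
  assumes "\<phi> differentiable (at x)"
  shows "div2 (\<lambda>x. c *\<^sub>R \<phi> x) x = c * div2 \<phi> x"
  using partial_deriv_eq[OF has_derivative_scaleR_right[OF has_derivative_partial_deriv[OF assms(1)]]]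
  by (simp add: div2_eq axis_def algebra_simps)

lemma continuous_on_div2: "Ck_on 1 S \<phi> \<Longrightarrow> continuous_on S (div2 \<phi>)"
  unfolding div2_eq[abs_def] using Ck_on_1_continuous_partial
  by (intro continuous_intros) blast+

text \<open>The divergence inherits the compact support, so continuity on the open set is enough for
  a bound. All pairings below are therefore integrals of bounded continuous functions.\<close>

lemma div2_bounded:
  assumes "Ck_on 1 S \<phi>" "compactly_supported_in S \<phi>" "open S"
  obtains B where "0 < B" "\<And>x. x \<in> S \<Longrightarrow> \<bar>div2 \<phi> x\<bar> \<le> B"
proof -
  have "compactly_supported_in S (\<lambda>x. partial_deriv 1 \<phi> x $ 1 + partial_deriv 2 \<phi> x $ 2)"
    using assms
    by (intro compactly_supported_in_add
      compactly_supported_in_comp[where h="\<lambda>v. v $ 1", OF compactly_supported_in_partial_deriv]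
      compactly_supported_in_comp[where h="\<lambda>v. v $ 2", OF compactly_supported_in_partial_deriv]) auto
  then have "compactly_supported_in S (div2 \<phi>)" by (simp add: div2_eq[abs_def])
  then show thesis using compactly_supported_in_bounded continuous_on_div2[OF assms(1)] that
    by (metis real_norm_def)
qed

text \<open>A partial derivative of a product of this form differentiates one factor and is again of
  this form, so the induction runs over both factors at once.\<close>

lemma Ck_on_tensor:
  "Ck_real k a \<Longrightarrow> Ck_real k b \<Longrightarrow> Ck_on k S (\<lambda>x. a (x $ 1) * b (x $ 2))"
proof (induction k arbitrary: a b)
  case 0
  then have "continuous_on UNIV a" "continuous_on UNIV b" by auto
  then have "continuous_on S (\<lambda>x. a (x $ 1))" "continuous_on S (\<lambda>x. b (x $ 2))"
    by (auto intro!: continuous_on_compose2[of UNIV a] continuous_on_compose2[of UNIV b] continuous_intros)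
  then show ?case by (auto intro: continuous_on_mult)
next
  case (Suc k)
  obtain a' b' where a': "\<And>x. (a has_real_derivative a' x) (at x)" "Ck_real k a'"
    and b': "\<And>x. (b has_real_derivative b' x) (at x)" "Ck_real k b'" using Suc.prems by auto
  have ab: "Ck_real k a" "Ck_real k b" using Suc.prems by (auto intro: Ck_real_Suc_imp simp del: Ck_real.simps)
  have D: "((\<lambda>x. a (x $ 1) * b (x $ 2)) has_derivative
      (\<lambda>v. a (x $ 1) * (b' (x $ 2) * v $ 2) + a' (x $ 1) * v $ 1 * b (x $ 2))) (at x)" for x
    by (intro has_derivative_mult has_derivative_compose[of "\<lambda>x. x $ _", OF _ a'(1)[unfolded has_field_derivative_def]]
      has_derivative_compose[of "\<lambda>x. x $ _", OF _ b'(1)[unfolded has_field_derivative_def]] bounded_linear_imp_has_derivative bounded_linear_vec_nth)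
  have p: "partial_deriv 1 (\<lambda>x. a (x $ 1) * b (x $ 2)) = (\<lambda>x. a' (x $ 1) * b (x $ 2))"
    "partial_deriv 2 (\<lambda>x. a (x $ 1) * b (x $ 2)) = (\<lambda>x. a (x $ 1) * b' (x $ 2))"
    by (simp_all add: fun_eq_iff partial_deriv_eq[OF D] axis_def)
  show ?case
    using D Suc.IH[OF a'(2) ab(2)] Suc.IH[OF ab(1) b'(2)]
    by (auto simp: forall_2 p differentiable_def)
qed

lemma partial_deriv_tensor:
  assumes "(a has_real_derivative a') (at (x $ 1))" "(b has_real_derivative b') (at (x $ 2))"
  shows "partial_deriv 1 (\<lambda>x. a (x $ 1) * b (x $ 2)) x = a' * b (x $ 2)"
proof -
  have D: "((\<lambda>x. a (x $ 1) * b (x $ 2)) has_derivative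
      (\<lambda>v. a (x $ 1) * (b' * v $ 2) + a' * v $ 1 * b (x $ 2))) (at x)"
    by (intro has_derivative_mult has_derivative_compose[of "\<lambda>x. x $ _", OF _ assms(1)[unfolded has_field_derivative_def]]
      has_derivative_compose[of "\<lambda>x. x $ _", OF _ assms(2)[unfolded has_field_derivative_def]] bounded_linear_imp_has_derivative bounded_linear_vec_nth)
  show ?thesis by (simp add: partial_deriv_eq[OF D] axis_def)
qed


section \<open>Integration over the unit square\<close>

lemma set_integrable_continuous_bounded:
  fixes F :: "'a::euclidean_space \<Rightarrow> real"
  assumes S: "open S" "bounded S" and F: "continuous_on S F" "\<And>x. x \<in> S \<Longrightarrow> \<bar>F x\<bar> \<le> B"
  shows "set_integrable lborel S F"
  unfolding set_integrable_def
proof (rule Bochner_Integration.integrable_bound)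
  show "integrable lborel (\<lambda>x. indicator S x *\<^sub>R B)"
    using S emeasure_bounded_finite[of S] by (intro integrable_scaleR_left) simp
  show "(\<lambda>x. indicator S x *\<^sub>R F x) \<in> borel_measurable lborel"
    using S F borel_measurable_continuous_on_indicator[of S F] by simp
  show "AE x in lborel. norm (indicator S x *\<^sub>R F x) \<le> norm (indicator S x *\<^sub>R B)"
    using F(2) by (force simp: indicator_def)
qed

text \<open>The variation is defined with \<open>lebesgue\<close>, Fubini and the box measures live
  on \<open>lborel\<close>. A continuous function cut off outside an open set is Borel, so passing
  to the completion changes nothing.\<close>

lemma
  fixes F :: "'a::euclidean_space \<Rightarrow> real"
  assumes S: "open S" and F: "continuous_on S F"
  shows set_lebesgue_integral_completion: "(LINT x:S|lebesgue. F x) = (LINT x:S|lborel. F x)"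
    and set_integrable_completion: "set_integrable lebesgue S F \<longleftrightarrow> set_integrable lborel S F"
proof -
  have "(\<lambda>x. indicator S x *\<^sub>R F x) \<in> borel_measurable lborel"
    using S F borel_measurable_continuous_on_indicator[of S F] by simp
  then show "(LINT x:S|lebesgue. F x) = (LINT x:S|lborel. F x)"
    "set_integrable lebesgue S F \<longleftrightarrow> set_integrable lborel S F"
    unfolding set_lebesgue_integral_def set_integrable_def
    by (auto intro: integral_completion simp: integrable_completion)
qed

lemma measurable_vec2: "(\<lambda>(s, t). vec2 s t) \<in> borel_measurable (lborel \<Otimes>\<^sub>M lborel)"
  unfolding lborel_prod case_prod_unfold
  by (simp, intro borel_measurable_continuous_onI continuous_intros)

text \<open>Lebesgue measure is determined by its values on boxes, and \<open>vec2\<close> pulls a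
  box back to a product of intervals. This makes Fubini for pairs of reals available on
  \<open>real^2\<close>.\<close>

lemma lborel_real2_eq: "(lborel :: (real^2) measure) = distr (lborel \<Otimes>\<^sub>M lborel) borel (\<lambda>(s, t). vec2 s t)"
proof (rule lborel_eqI)
  fix l u :: "real^2"
  assume lu: "\<And>b. b \<in> Basis \<Longrightarrow> l \<bullet> b \<le> u \<bullet> b"
  then have lu': "l $ i \<le> u $ i" for i by (metis axis_in_Basis_iff cart_eq_inner_axis Basis_real_def insertI1)
  have "(\<lambda>(s, t). vec2 s t) -` box l u = {l $ 1<..<u $ 1} \<times> {l $ 2<..<u $ 2}"
    by (auto simp: mem_box_cart forall_2)
  then have "emeasure (distr (lborel \<Otimes>\<^sub>M lborel) borel (\<lambda>(s, t). vec2 s t)) (box l u) =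
      emeasure (lborel \<Otimes>\<^sub>M lborel) ({l $ 1<..<u $ 1} \<times> {l $ 2<..<u $ 2})"
    by (subst emeasure_distr) (auto simp: measurable_vec2 space_pair_measure)
  also have "\<dots> = ennreal (u $ 1 - l $ 1) * ennreal (u $ 2 - l $ 2)"
    using lu' by (subst lborel.emeasure_pair_measure_Times) auto
  also have "\<dots> = (\<Prod>b\<in>Basis. (u - l) \<bullet> b)"
    using lu' by (simp add: Basis_vec_def UNIV_2 axis_eq_axis inner_axis ennreal_mult mult.commute)
  finally show "emeasure (distr (lborel \<Otimes>\<^sub>M lborel) borel (\<lambda>(s, t). vec2 s t)) (box l u) = (\<Prod>b\<in>Basis. (u - l) \<bullet> b)" .
qed simp

lemma Fubini_unit_square:
  fixes F :: "real^2 \<Rightarrow> real"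
  assumes F: "continuous_on unit_square F" and B: "\<And>x. x \<in> unit_square \<Longrightarrow> \<bar>F x\<bar> \<le> B"
  shows "(LINT x:unit_square|lebesgue. F x) =
    (LINT s:{0<..<1}|lborel. LINT t:{0<..<1}|lborel. F (vec2 s t))"
proof -
  have "set_integrable lborel unit_square F"
    using F B bounded_unit_square by (intro set_integrable_continuous_bounded) auto
  then have int: "integrable (distr (lborel \<Otimes>\<^sub>M lborel) borel (\<lambda>(s, t). vec2 s t))
      (\<lambda>x. indicator unit_square x *\<^sub>R F x)"
    unfolding set_integrable_def by (subst (asm) lborel_real2_eq)
  have m: "(\<lambda>x. indicator unit_square x *\<^sub>R F x) \<in> borel_measurable borel"
    using F by (intro borel_measurable_continuous_on_indicator) auto
  have ind: "indicator unit_square (vec2 s t) *\<^sub>R F (vec2 s t) =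
      indicator {0<..<1} s *\<^sub>R (indicator {0<..<1} t *\<^sub>R F (vec2 s t))" for s t
    by (auto simp: indicator_def vec2_in_unit_square)
  have int': "integrable (lborel \<Otimes>\<^sub>M lborel)
      (\<lambda>(s, t). indicator {0<..<1} s *\<^sub>R (indicator {0<..<1} t *\<^sub>R F (vec2 s t)))"
    using int unfolding integrable_distr_eq[OF measurable_vec2 m] unfolding case_prod_unfold ind .
  have "(LINT x:unit_square|lebesgue. F x) = integral\<^sup>L lborel (\<lambda>x. indicator unit_square x *\<^sub>R F x)"
    using set_lebesgue_integral_completion[OF open_unit_square F] by (simp add: set_lebesgue_integral_def)
  also have "\<dots> = integral\<^sup>L (lborel \<Otimes>\<^sub>M lborel)
      (\<lambda>(s, t). indicator {0<..<1} s *\<^sub>R (indicator {0<..<1} t *\<^sub>R F (vec2 s t)))"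
    unfolding case_prod_unfold ind[symmetric]
    by (subst lborel_real2_eq, subst integral_distr[OF measurable_vec2 m]) (simp add: case_prod_unfold)
  also have "\<dots> = (LINT s:{0<..<1}|lborel. LINT t:{0<..<1}|lborel. F (vec2 s t))"
    using lborel_pair.integral_fst[OF int'] by (simp add: set_lebesgue_integral_def case_prod_unfold)
  finally show ?thesis .
qed

section \<open>Horizontal shears of the square\<close>

lemma integral_change_of_variables_unit_square:
  fixes G :: "real^2 \<Rightarrow> real"
  assumes p: "\<And>y. y \<in> unit_square \<Longrightarrow> (p has_derivative p' y) (at y)"
    and inj: "inj_on p unit_square" and im: "p ` unit_square = unit_square"
    and w: "\<And>y. y \<in> unit_square \<Longrightarrow> \<bar>det (matrix (p' y))\<bar> = w y"
    and G: "set_integrable lebesgue unit_square G"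
  shows "(LINT x:unit_square|lebesgue. G x) = (LINT y:unit_square|lebesgue. w y * G (p y))"
proof -
  \<comment> \<open>The change of variables theorem concerns vector-valued integrands, so the scalar
    one is wrapped as a vector in \<open>real ^ 1\<close> and unwrapped again below.\<close>
  have "(\<lambda>y. \<bar>det (matrix (p' y))\<bar> *\<^sub>R vec (G (p y)) :: real ^ 1) absolutely_integrable_on unit_square \<and>
      integral unit_square (\<lambda>y. \<bar>det (matrix (p' y))\<bar> *\<^sub>R vec (G (p y))) = (vec (integral unit_square G) :: real ^ 1)
    \<longleftrightarrow> (\<lambda>x. vec (G x) :: real ^ 1) absolutely_integrable_on (p ` unit_square) \<and>
      integral (p ` unit_square) (\<lambda>x. vec (G x)) = (vec (integral unit_square G) :: real ^ 1)"
    using p inj by (intro has_absolute_integral_change_of_variables) (auto intro: has_derivative_at_withinI)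
  then have *: "(\<lambda>y. \<bar>det (matrix (p' y))\<bar> * G (p y)) absolutely_integrable_on unit_square \<and>
      integral unit_square (\<lambda>y. \<bar>det (matrix (p' y))\<bar> * G (p y)) = integral unit_square G"
    using G im by (simp add: absolutely_integrable_on_1_iff integral_on_1_eq)
  have "(LINT x:unit_square|lebesgue. G x) = (LINT y:unit_square|lebesgue. \<bar>det (matrix (p' y))\<bar> * G (p y))"
    using conjunct2[OF *] set_lebesgue_integral_eq_integral(2)[OF G]
      set_lebesgue_integral_eq_integral(2)[OF conjunct1[OF *]] by simp
  also have "\<dots> = (LINT y:unit_square|lebesgue. w y * G (p y))"
    by (intro set_lebesgue_integral_cong) (auto simp: w)
  finally show ?thesis .
qed

text \<open>Strictness in \<open>\<tau>'_bound\<close> makes the shear increasing on every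
  horizontal line, and the vanishing end values make it fix the boundary. Two derivatives of each
  profile are required since the Piola transform contains first derivatives of the shear and has to
  be C^1.\<close>

locale shear =
  fixes \<tau> \<tau>' \<tau>'' \<eta> \<eta>' \<eta>'' :: "real \<Rightarrow> real"
  assumes \<tau>_deriv: "\<And>t. (\<tau> has_real_derivative \<tau>' t) (at t)"
    and \<tau>'_deriv: "\<And>t. (\<tau>' has_real_derivative \<tau>'' t) (at t)"
    and \<tau>''_cont: "continuous_on UNIV \<tau>''"
    and \<eta>_deriv: "\<And>t. (\<eta> has_real_derivative \<eta>' t) (at t)"
    and \<eta>'_deriv: "\<And>t. (\<eta>' has_real_derivative \<eta>'' t) (at t)"
    and \<eta>''_cont: "continuous_on UNIV \<eta>''"
    and \<tau>_ends: "\<tau> 0 = 0" "\<tau> 1 = 0" and \<eta>_ends: "\<eta> 0 = 0" "\<eta> 1 = 0"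
    and \<eta>_bounds: "\<And>t. 0 \<le> \<eta> t" "\<And>t. \<eta> t \<le> 1"
    and \<tau>'_bound: "\<And>t. \<bar>\<tau>' t\<bar> < 1"
begin

definition p :: "real^2 \<Rightarrow> real^2" where
  "p y = vec2 (y $ 1 + \<tau> (y $ 1) * \<eta> (y $ 2)) (y $ 2)"

text \<open>The derivative of \<open>p\<close> is the matrix with rows (\<open>w\<close>,
  \<open>k\<close>) and (0, 1), so \<open>w\<close> is also the Jacobian determinant.\<close>

definition w :: "real^2 \<Rightarrow> real" where
  "w y = 1 + \<tau>' (y $ 1) * \<eta> (y $ 2)"

definition k :: "real^2 \<Rightarrow> real" where
  "k y = \<tau> (y $ 1) * \<eta>' (y $ 2)"

lemma jacobian_pos: "0 < 1 + \<tau>' s * \<eta> t"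
proof -
  have "\<bar>\<tau>' s * \<eta> t\<bar> \<le> \<bar>\<tau>' s\<bar>"
    using \<eta>_bounds[of t] by (simp add: abs_mult mult_left_le)
  then show ?thesis using \<tau>'_bound[of s] by linarith
qed

lemma w_pos: "0 < w y" by (simp add: w_def jacobian_pos)

lemma line_mono:
  assumes "s < s'" shows "s + \<tau> s * \<eta> t < s' + \<tau> s' * \<eta> t"
proof (rule DERIV_pos_imp_increasing[OF assms])
  fix x
  have "((\<lambda>s. s + \<tau> s * \<eta> t) has_real_derivative 1 + \<tau>' x * \<eta> t) (at x)"
    by (auto intro!: derivative_eq_intros \<tau>_deriv)
  then show "\<exists>y. ((\<lambda>s. s + \<tau> s * \<eta> t) has_real_derivative y) (at x) \<and> 0 < y"
    using jacobian_pos by blast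
qed

lemma continuous_on_\<tau>\<eta> [continuous_intros]:
  assumes "continuous_on S f"
  shows "continuous_on S (\<lambda>x. \<tau> (f x))" "continuous_on S (\<lambda>x. \<tau>' (f x))" "continuous_on S (\<lambda>x. \<tau>'' (f x))"
    "continuous_on S (\<lambda>x. \<eta> (f x))" "continuous_on S (\<lambda>x. \<eta>' (f x))" "continuous_on S (\<lambda>x. \<eta>'' (f x))"
proof -
  have D: "continuous_on UNIV g" if "\<And>t. (g has_real_derivative g' t) (at t)" for g g' :: "real \<Rightarrow> real"
    using that by (auto intro!: continuous_at_imp_continuous_on dest: DERIV_isCont)
  show "continuous_on S (\<lambda>x. \<tau> (f x))" "continuous_on S (\<lambda>x. \<tau>' (f x))" "continuous_on S (\<lambda>x. \<tau>'' (f x))"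
    "continuous_on S (\<lambda>x. \<eta> (f x))" "continuous_on S (\<lambda>x. \<eta>' (f x))" "continuous_on S (\<lambda>x. \<eta>'' (f x))"
    by (auto intro: continuous_on_compose2[OF D[OF \<tau>_deriv] assms] continuous_on_compose2[OF D[OF \<tau>'_deriv] assms]
      continuous_on_compose2[OF \<tau>''_cont assms] continuous_on_compose2[OF D[OF \<eta>_deriv] assms]
      continuous_on_compose2[OF D[OF \<eta>'_deriv] assms] continuous_on_compose2[OF \<eta>''_cont assms])
qed

lemma p_cont: "continuous_on S p"
  unfolding p_def[abs_def] by (intro continuous_intros)

lemma has_derivative_profile:
  "((\<lambda>y. \<tau> (y $ 1)) has_derivative (\<lambda>v. \<tau>' (y $ 1) * v $ 1)) (at y)"
  "((\<lambda>y. \<tau>' (y $ 1)) has_derivative (\<lambda>v. \<tau>'' (y $ 1) * v $ 1)) (at y)"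
  "((\<lambda>y. \<eta> (y $ 2)) has_derivative (\<lambda>v. \<eta>' (y $ 2) * v $ 2)) (at y)"
  "((\<lambda>y. \<eta>' (y $ 2)) has_derivative (\<lambda>v. \<eta>'' (y $ 2) * v $ 2)) (at y)" for y :: "real^2"
  using has_derivative_compose[OF bounded_linear_imp_has_derivative[OF bounded_linear_vec_nth] \<tau>_deriv[unfolded has_field_derivative_def]]
    has_derivative_compose[OF bounded_linear_imp_has_derivative[OF bounded_linear_vec_nth] \<tau>'_deriv[unfolded has_field_derivative_def]]
    has_derivative_compose[OF bounded_linear_imp_has_derivative[OF bounded_linear_vec_nth] \<eta>_deriv[unfolded has_field_derivative_def]]
    has_derivative_compose[OF bounded_linear_imp_has_derivative[OF bounded_linear_vec_nth] \<eta>'_deriv[unfolded has_field_derivative_def]]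
  by blast+

lemma p_has_derivative:
  "(p has_derivative (\<lambda>v. vec2 (w y * v $ 1 + k y * v $ 2) (v $ 2))) (at y)"
proof -
  have "(p has_derivative (\<lambda>v. vec2 (v $ 1 + (\<tau> (y $ 1) * (\<eta>' (y $ 2) * v $ 2) + \<tau>' (y $ 1) * v $ 1 * \<eta> (y $ 2))) (v $ 2))) (at y)"
    unfolding p_def[abs_def]
    by (intro has_derivative_vec2 has_derivative_add has_derivative_mult has_derivative_profile
      bounded_linear_imp_has_derivative bounded_linear_vec_nth)
  then show ?thesis by (simp add: w_def k_def algebra_simps)
qed

lemma det_p: "\<bar>det (matrix (\<lambda>v. vec2 (w y * v $ 1 + k y * v $ 2) (v $ 2)))\<bar> = w y"
  using w_pos[of y] by (simp add: det_2 matrix_def axis_def)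

lemma inj_p: "inj p"
proof (rule injI)
  fix x y assume "p x = p y"
  then have 2: "x $ 2 = y $ 2" and 1: "x $ 1 + \<tau> (x $ 1) * \<eta> (x $ 2) = y $ 1 + \<tau> (y $ 1) * \<eta> (x $ 2)"
    by (auto simp: p_def vec_eq_iff forall_2)
  have "x $ 1 = y $ 1"
    using line_mono[of "x $ 1" "y $ 1" "x $ 2"] line_mono[of "y $ 1" "x $ 1" "x $ 2"] 1 by linarith
  then show "x = y" using 2 by (simp add: vec_eq_iff forall_2)
qed

lemma p_fixes_boundary: "y \<in> cbox 0 1 - unit_square \<Longrightarrow> p y = y"
proof -
  assume "y \<in> cbox 0 1 - unit_square"
  then have "y $ 1 = 0 \<or> y $ 1 = 1 \<or> y $ 2 = 0 \<or> y $ 2 = 1"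
    by (auto simp: unit_square_def mem_box_cart forall_2)
  then show "p y = y"
    using \<tau>_ends \<eta>_ends by (auto simp: p_def vec_eq_iff forall_2)
qed

lemma p_image: "p ` unit_square = unit_square"
proof (intro subset_antisym subsetI)
  fix x assume "x \<in> p ` unit_square"
  then obtain y where y: "y \<in> unit_square" "x = p y" by blast
  have "0 < y $ 1" "y $ 1 < 1" using y(1) by (auto simp: unit_square_def)
  then show "x \<in> unit_square"
    using line_mono[of 0 "y $ 1" "y $ 2"] line_mono[of "y $ 1" 1 "y $ 2"] \<tau>_ends y
    by (auto simp: p_def unit_square_def forall_2)
next
  fix x assume x: "x \<in> unit_square"
  \<comment> \<open>The shear maps each horizontal line to itself and fixes the points with first
    coordinate 0 and 1, so the intermediate value theorem yields a preimage on the line through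
    \<open>x\<close>.\<close>
  have "\<exists>s\<ge>0. s \<le> 1 \<and> s + \<tau> s * \<eta> (x $ 2) = x $ 1"
    using x \<tau>_ends by (intro IVT' continuous_intros) (auto simp: unit_square_def less_imp_le)
  then obtain s where s: "0 \<le> s" "s \<le> 1" "s + \<tau> s * \<eta> (x $ 2) = x $ 1" by blast
  have "s \<noteq> 0" "s \<noteq> 1" using s(3) x \<tau>_ends by (auto simp: unit_square_def dest!: spec[of _ 1])
  then have "vec2 s (x $ 2) \<in> unit_square" using s x unfolding vec2_in_unit_square by (auto simp: unit_square_def)
  moreover have "p (vec2 s (x $ 2)) = x" using s(3) by (simp add: p_def vec2_eta)
  ultimately show "x \<in> p ` unit_square" by force
qed

lemma p_image_closed: "p ` cbox 0 1 = cbox 0 1"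
proof -
  have eq: "cbox 0 1 = unit_square \<union> (cbox 0 1 - unit_square)"
    using box_subset_cbox[of 0 "1::real^2"] by (auto simp: unit_square_eq_box)
  have "p ` (cbox 0 1 - unit_square) = cbox 0 1 - unit_square"
    using p_fixes_boundary by force
  then show ?thesis using p_image eq by (metis image_Un)
qed

text \<open>Inverting over \<open>UNIV\<close> is possible because \<open>p\<close> is injective on
  the whole plane. One function then serves the open square, the closed square and the
  boundary.\<close>

definition h :: "real^2 \<Rightarrow> real^2" where
  "h = inv_into UNIV p"

lemma h_p: "h (p y) = y" by (simp add: h_def inj_p)

lemma h_cont: "continuous_on (cbox 0 1) h"
  using continuous_on_inv[OF p_cont compact_cbox, of 0 1 h] h_p p_image_closed by simp

lemma p_h: "x \<in> cbox 0 1 \<Longrightarrow> p (h x) = x"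
  using p_image_closed h_p by (metis imageE)

lemma h_image: "h ` unit_square = unit_square"
proof -
  have "h ` p ` unit_square = unit_square" by (simp add: image_image h_p)
  then show ?thesis by (simp only: p_image)
qed

lemma h_fixes_boundary: "y \<in> cbox 0 1 - unit_square \<Longrightarrow> h y = y"
  using p_fixes_boundary h_p by metis

lemma unit_square_subset: "unit_square \<subseteq> cbox 0 1"
  by (simp add: unit_square_eq_box box_subset_cbox)

lemma norm_p_diff: "norm (p y - y) \<le> \<bar>\<tau> (y $ 1)\<bar>"
proof -
  have "norm (p y - y) \<le> (\<Sum>i\<in>UNIV. \<bar>(p y - y) $ i\<bar>)" by (rule norm_le_l1_cart)
  also have "\<dots> = \<bar>\<tau> (y $ 1)\<bar> * \<eta> (y $ 2)" using \<eta>_bounds[of "y $ 2"] by (simp add: sum_2 p_def abs_mult)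
  also have "\<dots> \<le> \<bar>\<tau> (y $ 1)\<bar>" using \<eta>_bounds[of "y $ 2"] by (simp add: mult_left_le)
  finally show ?thesis .
qed

text \<open>The Piola transform of a vector field: the adjugate of the derivative of \<open>p\<close> applied to
  \<open>V \<circ> p\<close>.\<close>

definition pull :: "(real^2 \<Rightarrow> real^2) \<Rightarrow> real^2 \<Rightarrow> real^2" where
  "pull V y = vec2 (V (p y) $ 1 - k y * V (p y) $ 2) (w y * V (p y) $ 2)"

text \<open>The second part is the Piola identity: the second derivatives of \<open>p\<close> enter
  the divergence only through the mixed term \<open>\<tau>' (y $ 1) * \<eta>' (y $ 2)\<close>, once
  with each sign, and cancel.\<close>

lemma pull_C1:
  assumes V: "Ck_on 1 unit_square V"
  shows "Ck_on 1 unit_square (pull V)"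
    and "y \<in> unit_square \<Longrightarrow> div2 (pull V) y = w y * div2 V (p y)"
proof -
  define A where "A = partial_deriv 1 V"
  define B where "B = partial_deriv 2 V"
  have pin: "p y \<in> unit_square" if "y \<in> unit_square" for y using that p_image by blast
  have AB: "continuous_on unit_square (\<lambda>y. A (p y))" "continuous_on unit_square (\<lambda>y. B (p y))"
    using Ck_on_1_continuous_partial[OF V] unfolding A_def B_def
    by (auto intro!: continuous_on_compose2[OF _ p_cont] pin)
  have DV: "(V has_derivative (\<lambda>v. v $ 1 *\<^sub>R A x + v $ 2 *\<^sub>R B x)) (at x)" if "x \<in> unit_square" for x
    unfolding A_def B_def by (intro has_derivative_partial_deriv Ck_on_1_differentiable[OF V that])
  have Vcont: "continuous_on unit_square (\<lambda>y. V (p y))"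
    by (intro continuous_on_compose2[OF _ p_cont, of unit_square])
      (auto simp: p_image intro!: continuous_at_imp_continuous_on has_derivative_continuous[OF DV])
  \<comment> \<open>\<open>P1\<close> and \<open>P2\<close> are the partial derivatives of
    \<open>pull V\<close> according to the product and chain rules; their continuity is where
    \<open>\<tau>''_cont\<close> and \<open>\<eta>''_cont\<close> are needed.\<close>
  define P1 where "P1 = (\<lambda>y. vec2 (w y * A (p y) $ 1 - k y * w y * A (p y) $ 2 - \<tau>' (y $ 1) * \<eta>' (y $ 2) * V (p y) $ 2)
    (w y * w y * A (p y) $ 2 + \<tau>'' (y $ 1) * \<eta> (y $ 2) * V (p y) $ 2))"
  define P2 where "P2 = (\<lambda>y. vec2 (k y * A (p y) $ 1 + B (p y) $ 1 - k y * k y * A (p y) $ 2 - k y * B (p y) $ 2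
      - \<tau> (y $ 1) * \<eta>'' (y $ 2) * V (p y) $ 2)
    (w y * k y * A (p y) $ 2 + w y * B (p y) $ 2 + \<tau>' (y $ 1) * \<eta>' (y $ 2) * V (p y) $ 2))"
  have D: "(pull V has_derivative (\<lambda>v. v $ 1 *\<^sub>R P1 y + v $ 2 *\<^sub>R P2 y)) (at y)" if y: "y \<in> unit_square" for y
  proof -
    have Vp: "((\<lambda>y. V (p y)) has_derivative
        (\<lambda>v. (w y * v $ 1 + k y * v $ 2) *\<^sub>R A (p y) + v $ 2 *\<^sub>R B (p y))) (at y)"
      using has_derivative_compose[OF p_has_derivative DV[OF pin[OF y]]] by simp
    note Vp' = bounded_linear.has_derivative[OF bounded_linear_vec_nth Vp]
    have kd: "(k has_derivative (\<lambda>v. \<tau> (y $ 1) * (\<eta>'' (y $ 2) * v $ 2) + \<tau>' (y $ 1) * v $ 1 * \<eta>' (y $ 2))) (at y)"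
      unfolding k_def[abs_def] by (intro has_derivative_mult has_derivative_profile)
    have wd: "(w has_derivative (\<lambda>v. 0 + (\<tau>' (y $ 1) * (\<eta>' (y $ 2) * v $ 2) + \<tau>'' (y $ 1) * v $ 1 * \<eta> (y $ 2)))) (at y)"
      unfolding w_def[abs_def] by (intro has_derivative_mult has_derivative_add has_derivative_const has_derivative_profile)
    show ?thesis unfolding pull_def[abs_def]
    proof (rule has_derivative_eq_rhs[OF has_derivative_vec2[OF
          has_derivative_diff[OF Vp' has_derivative_mult[OF kd Vp']] has_derivative_mult[OF wd Vp']]])
      show "(\<lambda>v. vec2 (((w y * v $ 1 + k y * v $ 2) *\<^sub>R A (p y) + v $ 2 *\<^sub>R B (p y)) $ 1 -
          (k y * ((w y * v $ 1 + k y * v $ 2) *\<^sub>R A (p y) + v $ 2 *\<^sub>R B (p y)) $ 2 +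
            (\<tau> (y $ 1) * (\<eta>'' (y $ 2) * v $ 2) + \<tau>' (y $ 1) * v $ 1 * \<eta>' (y $ 2)) * V (p y) $ 2))
          (w y * ((w y * v $ 1 + k y * v $ 2) *\<^sub>R A (p y) + v $ 2 *\<^sub>R B (p y)) $ 2 +
            (0 + (\<tau>' (y $ 1) * (\<eta>' (y $ 2) * v $ 2) + \<tau>'' (y $ 1) * v $ 1 * \<eta> (y $ 2))) * V (p y) $ 2)) =
        (\<lambda>v. v $ 1 *\<^sub>R P1 y + v $ 2 *\<^sub>R P2 y)"
        by (simp add: fun_eq_iff vec_eq_iff forall_2 P1_def P2_def algebra_simps)
    qed
  qed
  have wk: "continuous_on unit_square w" "continuous_on unit_square k"
    unfolding w_def[abs_def] k_def[abs_def] by (intro continuous_intros)+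
  have "continuous_on unit_square P1" "continuous_on unit_square P2"
    unfolding P1_def P2_def by (intro continuous_intros AB Vcont wk)+
  then show "Ck_on 1 unit_square (pull V)" using D unfolding Ck_on_1_iff by blast
  show "y \<in> unit_square \<Longrightarrow> div2 (pull V) y = w y * div2 V (p y)"
    using partial_deriv_eq[OF D, of y]
    by (simp add: div2_eq axis_def P1_def P2_def algebra_simps flip: A_def B_def)
qed

lemma pull_compactly_supported:
  assumes "compactly_supported_in unit_square V"
  shows "compactly_supported_in unit_square (pull V)"
proof -
  obtain K where K: "compact K" "K \<subseteq> unit_square" "\<And>x. x \<in> unit_square - K \<Longrightarrow> V x = 0"
    using assms unfolding compactly_supported_in_def by blast
  have "compact (h ` K)"
    using K unit_square_subset by (intro compact_continuous_image continuous_on_subset[OF h_cont]) auto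
  moreover have "h ` K \<subseteq> unit_square" using K(2) h_image by blast
  moreover have "pull V y = 0" if "y \<in> unit_square - h ` K" for y
  proof -
    have "p y \<in> unit_square" "p y \<notin> K" using that p_image h_p by (auto simp: image_iff)
    then show ?thesis using K(3) by (simp add: pull_def vec_eq_iff forall_2)
  qed
  ultimately show ?thesis unfolding compactly_supported_in_def by blast
qed

text \<open>Substitute x = p y; the Piola identity absorbs the Jacobian weight into the divergence
  of the pulled back field.\<close>

lemma integral_comp_h:
  assumes f: "continuous_on unit_square f" "\<And>x. x \<in> unit_square \<Longrightarrow> \<bar>f x\<bar> \<le> B"
    and V: "Ck_on 1 unit_square V" "compactly_supported_in unit_square V"
  shows "(LINT x:unit_square|lebesgue. f (h x) * div2 V x) =
    (LINT y:unit_square|lebesgue. f y * div2 (pull V) y)"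
proof -
  obtain C where C: "0 < C" "\<And>x. x \<in> unit_square \<Longrightarrow> \<bar>div2 V x\<bar> \<le> C"
    using div2_bounded[OF V] by auto
  have "continuous_on unit_square (\<lambda>x. f (h x))"
    using h_image unit_square_subset by (intro continuous_on_compose2[OF f(1)] continuous_on_subset[OF h_cont]) auto
  then have c: "continuous_on unit_square (\<lambda>x. f (h x) * div2 V x)"
    by (intro continuous_on_mult continuous_on_div2 V)
  have B: "\<bar>f (h x) * div2 V x\<bar> \<le> B * C" if "x \<in> unit_square" for x
  proof -
    have "\<bar>f (h x)\<bar> \<le> B" using that f(2) h_image by blast
    then show ?thesis unfolding abs_mult using C that
      by (intro mult_mono) (auto intro: order_trans[OF abs_ge_zero])
  qed
  have "(LINT x:unit_square|lebesgue. f (h x) * div2 V x) =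
      (LINT y:unit_square|lebesgue. w y * (f (h (p y)) * div2 V (p y)))"
    using c B bounded_unit_square
    by (intro integral_change_of_variables_unit_square[OF p_has_derivative inj_on_subset[OF inj_p] p_image det_p])
      (auto intro!: set_integrable_completion[THEN iffD2] set_integrable_continuous_bounded)
  also have "\<dots> = (LINT y:unit_square|lebesgue. f y * div2 (pull V) y)"
    by (intro set_lebesgue_integral_cong) (auto simp: pull_C1[OF V(1)] h_p)
  finally show ?thesis .
qed

end

section \<open>Variation of a sheared map\<close>

text \<open>The generality of the variation arguments: continuity and boundedness suffice for
  pairings, and the class is stable under composition with \<open>h\<close>.\<close>

definition square_map :: "(real^2 \<Rightarrow> real^2) \<Rightarrow> bool" where
  "square_map f \<longleftrightarrow> continuous_on unit_square f \<and> f ` unit_square \<subseteq> unit_square"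

definition var_test :: "(real^2 \<Rightarrow> (real^2) \<times> (real^2)) \<Rightarrow> bool" where
  "var_test \<phi> \<longleftrightarrow> Ck_on 1 unit_square \<phi> \<and> compactly_supported_in unit_square \<phi> \<and>
     (\<forall>x\<in>unit_square. linf4 (\<phi> x) \<le> 1)"

definition pairing :: "(real^2 \<Rightarrow> real^2) \<Rightarrow> (real^2 \<Rightarrow> (real^2) \<times> (real^2)) \<Rightarrow> real" where
  "pairing f \<phi> = (LINT x:unit_square|lebesgue.
     f x $ 1 * div2 (\<lambda>y. fst (\<phi> y)) x + f x $ 2 * div2 (\<lambda>y. snd (\<phi> y)) x)"

lemma Var_unit_square: "Var f unit_square = (SUP \<phi>\<in>Collect var_test. ereal (pairing f \<phi>))"
  by (simp add: Var_def var_test_def[abs_def] pairing_def)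

lemma linf4_le_iff:
  "linf4 v \<le> c \<longleftrightarrow> \<bar>fst v $ 1\<bar> \<le> c \<and> \<bar>fst v $ 2\<bar> \<le> c \<and> \<bar>snd v $ 1\<bar> \<le> c \<and> \<bar>snd v $ 2\<bar> \<le> c"
  by (simp add: linf4_def)

lemma pairing_le_Var: "var_test \<phi> \<Longrightarrow> ereal (pairing f \<phi>) \<le> Var f unit_square"
  unfolding Var_unit_square by (intro SUP_upper) simp

lemma Var_nonneg: "0 \<le> Var f unit_square"
proof -
  have "Ck_on 1 unit_square (\<lambda>x :: real^2. 0 :: (real^2) \<times> (real^2))"
    unfolding Ck_on_1_iff by (intro exI[of _ "\<lambda>x. 0"]) auto
  then have "var_test (\<lambda>x. 0)"
    by (auto simp: var_test_def linf4_le_iff compactly_supported_in_def intro!: exI[of _ "{}"])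
  moreover have "div2 (\<lambda>x. 0) x = 0" for x
    by (simp add: div2_eq partial_deriv_eq[OF has_derivative_const])
  then have "pairing f (\<lambda>x. 0) = 0" by (simp add: pairing_def)
  ultimately show ?thesis using pairing_le_Var[of "\<lambda>x. 0" f] by (simp add: zero_ereal_def)
qed

lemma square_map_bound:
  assumes "square_map f" "x \<in> unit_square" shows "\<bar>f x $ i\<bar> \<le> 1"
proof -
  have "f x \<in> unit_square" using assms by (auto simp: square_map_def)
  then have "0 < f x $ i \<and> f x $ i < 1" by (simp add: unit_square_def)
  then show ?thesis by simp
qed

lemma emeasure_box_real2:
  fixes l u :: "real^2"
  assumes "l $ 1 \<le> u $ 1" "l $ 2 \<le> u $ 2"
  shows "emeasure lborel (box l u) = ennreal ((u $ 1 - l $ 1) * (u $ 2 - l $ 2))"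
  using assms by (subst emeasure_lborel_box)
    (auto simp: Basis_vec_def UNIV_2 axis_eq_axis inner_axis ennreal_mult mult.commute)

lemma emeasure_unit_square: "emeasure lborel unit_square = 1"
  by (simp add: unit_square_eq_box emeasure_box_real2)

lemma square_integral_bound:
  fixes F :: "real^2 \<Rightarrow> real"
  assumes "set_integrable lebesgue unit_square F" "\<And>x. x \<in> unit_square \<Longrightarrow> \<bar>F x\<bar> \<le> B"
  shows "\<bar>LINT x:unit_square|lebesgue. F x\<bar> \<le> B"
proof -
  have e: "emeasure lebesgue unit_square = 1" by (simp add: emeasure_unit_square)
  have "\<bar>LINT x:unit_square|lebesgue. F x\<bar> \<le> (LINT x:unit_square|lebesgue. \<bar>F x\<bar>)"
    using set_integral_norm_bound[OF assms(1)] by simp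
  also have "\<dots> \<le> (LINT x:unit_square|lebesgue. B)"
    using assms e by (intro set_integral_mono set_integrable_abs) (auto simp: set_integrable_def)
  also have "\<dots> = B" using e by (simp add: set_lebesgue_integral_def measure_def)
  finally show ?thesis .
qed

lemma set_integrable_square:
  fixes F :: "real^2 \<Rightarrow> real"
  assumes "continuous_on unit_square F" "\<And>x. x \<in> unit_square \<Longrightarrow> \<bar>F x\<bar> \<le> B"
  shows "set_integrable lebesgue unit_square F"
  using set_integrable_continuous_bounded[OF open_unit_square bounded_unit_square assms]
  by (simp add: set_integrable_completion assms(1))

lemma continuous_on_nth_comp: "continuous_on S f \<Longrightarrow> continuous_on S (\<lambda>x. f x $ i)"
  by (intro continuous_intros)

lemma set_integrable_pairing_term:
  assumes f: "square_map f" and V: "Ck_on 1 unit_square V" "compactly_supported_in unit_square V"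
  shows "set_integrable lebesgue unit_square (\<lambda>x. f x $ i * div2 V x)"
proof -
  obtain C where C: "0 < C" "\<And>x. x \<in> unit_square \<Longrightarrow> \<bar>div2 V x\<bar> \<le> C"
    using div2_bounded[OF V] by auto
  have "\<bar>f x $ i * div2 V x\<bar> \<le> 1 * C" if "x \<in> unit_square" for x
    unfolding abs_mult using C square_map_bound[OF f that] that by (intro mult_mono) auto
  then show ?thesis using f
    by (intro set_integrable_square continuous_on_mult continuous_on_div2 V continuous_on_nth_comp)
      (auto simp: square_map_def)
qed

lemma C1_fst_snd:
  assumes "Ck_on 1 unit_square \<phi>" "compactly_supported_in unit_square \<phi>"
  shows "Ck_on 1 unit_square (\<lambda>y. fst (\<phi> y))" "Ck_on 1 unit_square (\<lambda>y. snd (\<phi> y))"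
    "compactly_supported_in unit_square (\<lambda>y. fst (\<phi> y))" "compactly_supported_in unit_square (\<lambda>y. snd (\<phi> y))"
  using Ck_on_1_bounded_linear[OF assms(1) bounded_linear_fst] Ck_on_1_bounded_linear[OF assms(1) bounded_linear_snd]
    compactly_supported_in_comp[OF assms(2), of fst] compactly_supported_in_comp[OF assms(2), of snd]
  by simp_all

lemma pairing_eq:
  assumes f: "square_map f" and \<phi>: "Ck_on 1 unit_square \<phi>" "compactly_supported_in unit_square \<phi>"
  shows "pairing f \<phi> = (LINT x:unit_square|lebesgue. f x $ 1 * div2 (\<lambda>y. fst (\<phi> y)) x) +
    (LINT x:unit_square|lebesgue. f x $ 2 * div2 (\<lambda>y. snd (\<phi> y)) x)"
  unfolding pairing_def
  by (intro set_integral_add set_integrable_pairing_term f C1_fst_snd[OF \<phi>])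

text \<open>All derivatives fall on the test field, so for fixed \<open>\<phi>\<close> the pairing
  is Lipschitz in the uniform norm. The variation is a supremum of such functionals, whence its
  lower semicontinuity.\<close>

lemma pairing_continuous:
  assumes "var_test \<phi>"
  obtains C where "0 < C" "\<And>f g \<epsilon>. square_map f \<Longrightarrow> square_map g \<Longrightarrow>
    (\<And>x. x \<in> unit_square \<Longrightarrow> norm (f x - g x) \<le> \<epsilon>) \<Longrightarrow> \<bar>pairing f \<phi> - pairing g \<phi>\<bar> \<le> C * \<epsilon>"
proof -
  have \<phi>: "Ck_on 1 unit_square \<phi>" "compactly_supported_in unit_square \<phi>"
    using assms by (auto simp: var_test_def simp del: Ck_on.simps One_nat_def)
  note c = C1_fst_snd[OF \<phi>]
  obtain B1 where B1: "0 < B1" "\<And>x. x \<in> unit_square \<Longrightarrow> \<bar>div2 (\<lambda>y. fst (\<phi> y)) x\<bar> \<le> B1"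
    using div2_bounded[OF c(1) c(3)] by auto
  obtain B2 where B2: "0 < B2" "\<And>x. x \<in> unit_square \<Longrightarrow> \<bar>div2 (\<lambda>y. snd (\<phi> y)) x\<bar> \<le> B2"
    using div2_bounded[OF c(2) c(4)] by auto
  have "\<bar>pairing f \<phi> - pairing g \<phi>\<bar> \<le> (B1 + B2) * \<epsilon>"
    if f: "square_map f" and g: "square_map g" and e: "\<And>x. x \<in> unit_square \<Longrightarrow> norm (f x - g x) \<le> \<epsilon>" for f g \<epsilon>
  proof -
    let ?I = "\<lambda>f x. f x $ 1 * div2 (\<lambda>y. fst (\<phi> y)) x + f x $ 2 * div2 (\<lambda>y. snd (\<phi> y)) x"
    have i: "set_integrable lebesgue unit_square (?I f)" "set_integrable lebesgue unit_square (?I g)"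
      by (intro set_integral_add set_integrable_pairing_term f g c)+
    have "pairing f \<phi> - pairing g \<phi> = (LINT x:unit_square|lebesgue. ?I f x - ?I g x)"
      unfolding pairing_def using set_integral_diff(2)[OF i] by simp
    also have "\<bar>\<dots>\<bar> \<le> (B1 + B2) * \<epsilon>"
    proof (rule square_integral_bound)
      show "set_integrable lebesgue unit_square (\<lambda>x. ?I f x - ?I g x)" using set_integral_diff(1)[OF i] by simp
      fix x assume x: "x \<in> unit_square"
      have n: "\<bar>f x $ i - g x $ i\<bar> \<le> \<epsilon>" for i
        using component_le_norm_cart[of "f x - g x" i] e[OF x] by simp
      have "\<bar>(f x $ 1 - g x $ 1) * div2 (\<lambda>y. fst (\<phi> y)) x\<bar> \<le> \<epsilon> * B1"
        unfolding abs_mult using n B1(2)[OF x] B1(1) by (intro mult_mono) (auto intro: order_trans[OF abs_ge_zero])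
      moreover have "\<bar>(f x $ 2 - g x $ 2) * div2 (\<lambda>y. snd (\<phi> y)) x\<bar> \<le> \<epsilon> * B2"
        unfolding abs_mult using n B2(2)[OF x] B2(1) by (intro mult_mono) (auto intro: order_trans[OF abs_ge_zero])
      ultimately show "\<bar>?I f x - ?I g x\<bar> \<le> (B1 + B2) * \<epsilon>" by (simp add: algebra_simps abs_le_iff)
    qed
    finally show ?thesis .
  qed
  then show thesis using that[of "B1 + B2"] B1 B2 by auto
qed

lemma Var_lower_semicontinuous:
  assumes f: "square_map f" and c: "ereal c < Var f unit_square"
  obtains \<rho> where "0 < \<rho>" "\<And>g. square_map g \<Longrightarrow> (\<And>x. x \<in> unit_square \<Longrightarrow> norm (f x - g x) \<le> \<rho>) \<Longrightarrow>
    ereal c < Var g unit_square"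
proof -
  from c obtain \<phi> where \<phi>: "var_test \<phi>" "c < pairing f \<phi>"
    unfolding Var_unit_square by (auto simp: less_SUP_iff)
  obtain C where C: "0 < C" "\<And>f g \<epsilon>. square_map f \<Longrightarrow> square_map g \<Longrightarrow>
    (\<And>x. x \<in> unit_square \<Longrightarrow> norm (f x - g x) \<le> \<epsilon>) \<Longrightarrow> \<bar>pairing f \<phi> - pairing g \<phi>\<bar> \<le> C * \<epsilon>"
    using pairing_continuous[OF \<phi>(1)] by blast
  \<comment> \<open>Half the gap above \<open>c\<close>, divided by the Lipschitz constant: the
    pairing with the single field \<open>\<phi>\<close> stays above \<open>c\<close>.\<close>
  define \<rho> where "\<rho> = (pairing f \<phi> - c) / (2 * C)"
  have "0 < \<rho>" using C(1) \<phi>(2) by (simp add: \<rho>_def)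
  moreover have "ereal c < Var g unit_square"
    if "square_map g" "\<And>x. x \<in> unit_square \<Longrightarrow> norm (f x - g x) \<le> \<rho>" for g
  proof -
    have "\<bar>pairing f \<phi> - pairing g \<phi>\<bar> \<le> (pairing f \<phi> - c) / 2"
      using C(2)[OF f that] C(1) by (simp add: \<rho>_def)
    then have "ereal c < ereal (pairing g \<phi>)" using \<phi>(2) unfolding abs_le_iff by simp
    then show ?thesis using pairing_le_Var[OF \<phi>(1), of g] by (rule less_le_trans)
  qed
  ultimately show thesis using that by blast
qed

lemma pairing_cong: "(\<And>x. x \<in> unit_square \<Longrightarrow> f x = g x) \<Longrightarrow> pairing f \<phi> = pairing g \<phi>"
  unfolding pairing_def by (intro set_lebesgue_integral_cong) auto

context shear
begin

definition pull2 :: "(real^2 \<Rightarrow> (real^2) \<times> (real^2)) \<Rightarrow> real^2 \<Rightarrow> (real^2) \<times> (real^2)" where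
  "pull2 \<phi> y = (pull (\<lambda>x. fst (\<phi> x)) y, pull (\<lambda>x. snd (\<phi> x)) y)"

lemma
  assumes "Ck_on 1 unit_square \<phi>" "compactly_supported_in unit_square \<phi>"
  shows pull2_C1: "Ck_on 1 unit_square (pull2 \<phi>)"
    and pull2_compactly_supported: "compactly_supported_in unit_square (pull2 \<phi>)"
proof -
  note c = C1_fst_snd[OF assms]
  \<comment> \<open>Splitting the pair into a sum of two linear embeddings reduces regularity and
    support to the closure lemmas for linear maps and sums.\<close>
  have eq: "pull2 \<phi> = (\<lambda>y. (pull (\<lambda>x. fst (\<phi> x)) y, 0) + (0, pull (\<lambda>x. snd (\<phi> x)) y))"
    by (simp add: fun_eq_iff pull2_def)
  show "Ck_on 1 unit_square (pull2 \<phi>)"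
    unfolding eq
    by (intro Ck_on_1_add Ck_on_1_bounded_linear[OF pull_C1(1)[OF c(1)], of "\<lambda>v. (v, 0)"]
      Ck_on_1_bounded_linear[OF pull_C1(1)[OF c(2)], of "\<lambda>v. (0, v)"]
      bounded_linear_Pair bounded_linear_ident bounded_linear_zero)
  show "compactly_supported_in unit_square (pull2 \<phi>)"
    unfolding eq
    using compactly_supported_in_comp[OF pull_compactly_supported[OF c(3)], of "\<lambda>v. (v, 0)"]
      compactly_supported_in_comp[OF pull_compactly_supported[OF c(4)], of "\<lambda>v. (0, v)"]
    by (intro compactly_supported_in_add) (auto simp: zero_prod_def)
qed

lemma square_map_comp_h: "square_map f \<Longrightarrow> square_map (\<lambda>x. f (h x))"
  using h_image unit_square_subset unfolding square_map_def
  by (auto intro!: continuous_on_compose2[of unit_square f] continuous_on_subset[OF h_cont])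

lemma pairing_comp_h:
  assumes f: "square_map f" and \<phi>: "Ck_on 1 unit_square \<phi>" "compactly_supported_in unit_square \<phi>"
  shows "pairing (\<lambda>x. f (h x)) \<phi> = pairing f (pull2 \<phi>)"
proof -
  note c = C1_fst_snd[OF \<phi>]
  have fc: "continuous_on unit_square (\<lambda>x. f x $ i)" for i
    using f by (auto simp: square_map_def intro: continuous_on_nth_comp)
  have "pairing (\<lambda>x. f (h x)) \<phi> =
      (LINT y:unit_square|lebesgue. f y $ 1 * div2 (pull (\<lambda>x. fst (\<phi> x))) y) +
      (LINT y:unit_square|lebesgue. f y $ 2 * div2 (pull (\<lambda>x. snd (\<phi> x))) y)"
    unfolding pairing_eq[OF square_map_comp_h[OF f] \<phi>]
    using integral_comp_h[OF fc square_map_bound[OF f] c(1) c(3)]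
      integral_comp_h[OF fc square_map_bound[OF f] c(2) c(4)] by simp
  then show ?thesis unfolding pairing_eq[OF f pull2_C1[OF \<phi>] pull2_compactly_supported[OF \<phi>]]
    by (simp add: pull2_def)
qed

end

text \<open>Unqualified names belong to the shear with profile \<open>\<tau>\<close>, names with
  prefix \<open>neg\<close> to the opposite one; both share the cutoff.\<close>

locale shear_pair = shear \<tau> \<tau>' \<tau>'' \<eta> \<eta>' \<eta>'' +
    neg: shear "\<lambda>t. - \<tau> t" "\<lambda>t. - \<tau>' t" "\<lambda>t. - \<tau>'' t" \<eta> \<eta>' \<eta>''
  for \<tau> \<tau>' \<tau>'' \<eta> \<eta>' \<eta>''
begin

text \<open>The two Jacobians add up to 2, so half the sum of the two pulled back test fields is again,
  up to the factor \<open>1 + \<kappa>\<close>, an admissible test field for \<open>f\<close>.\<close>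

lemma pairing_shear_sum:
  assumes f: "square_map f" and V: "Var f unit_square \<le> ereal V"
    and \<kappa>: "\<And>y. y \<in> unit_square \<Longrightarrow> \<bar>k y\<bar> \<le> \<kappa>"
    and \<phi>: "var_test \<phi>" and \<psi>: "var_test \<psi>"
  shows "pairing (\<lambda>x. f (h x)) \<phi> + pairing (\<lambda>x. f (neg.h x)) \<psi> \<le> 2 * (1 + \<kappa>) * V"
proof -
  have \<phi>': "Ck_on 1 unit_square \<phi>" "compactly_supported_in unit_square \<phi>"
    and \<psi>': "Ck_on 1 unit_square \<psi>" "compactly_supported_in unit_square \<psi>"
    using \<phi> \<psi> by (auto simp: var_test_def simp del: Ck_on.simps One_nat_def)
  note P = pull2_C1[OF \<phi>'] pull2_compactly_supported[OF \<phi>'] neg.pull2_C1[OF \<psi>'] neg.pull2_compactly_supported[OF \<psi>']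
  have \<kappa>0: "0 \<le> \<kappa>" using \<kappa> unit_square_nonempty by (meson abs_ge_zero ex_in_conv order_trans)
  \<comment> \<open>The factor 1/2 averages the two pulled back fields, the factor 1 / (1 +
    \<kappa>) compensates for the off-diagonal entry.\<close>
  define c where "c = 1 / (2 * (1 + \<kappa>))"
  have c: "0 < c" "c * (2 * (1 + \<kappa>)) = 1" using \<kappa>0 by (auto simp: c_def)
  define S where "S = (\<lambda>y. pull2 \<phi> y + neg.pull2 \<psi> y)"
  define \<Psi> where "\<Psi> = (\<lambda>y. c *\<^sub>R S y)"
  have S': "Ck_on 1 unit_square S" "compactly_supported_in unit_square S"
    unfolding S_def by (intro Ck_on_1_add compactly_supported_in_add P)+
  have \<Psi>': "Ck_on 1 unit_square \<Psi>" "compactly_supported_in unit_square \<Psi>"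
    unfolding \<Psi>_def by (intro Ck_on_1_bounded_linear[OF S'(1)] bounded_linear_scaleR_right)
      (rule compactly_supported_in_comp[OF S'(2)], simp)
  have "var_test \<Psi>"
    unfolding var_test_def
  proof (intro conjI ballI \<Psi>')
    fix y assume y: "y \<in> unit_square"
    have "linf4 (\<phi> (p y)) \<le> 1" "linf4 (\<psi> (neg.p y)) \<le> 1"
      using \<phi> \<psi> y p_image neg.p_image unfolding var_test_def by blast+
    note b = this[unfolded linf4_le_iff]
    have nk: "neg.k y = - k y" by (simp add: neg.k_def k_def)
    have wsum: "w y + neg.w y = 2" by (simp add: neg.w_def w_def)
    \<comment> \<open>First components: the Jacobian does not occur, each sign contributes at most 1
      + \<kappa>.\<close>
    have first: "\<bar>c * ((a - k y * b) + (a' - neg.k y * b'))\<bar> \<le> 1"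
      if "\<bar>a\<bar> \<le> 1" "\<bar>b\<bar> \<le> 1" "\<bar>a'\<bar> \<le> 1" "\<bar>b'\<bar> \<le> 1" for a b a' b'
    proof -
      have "\<bar>k y * b\<bar> \<le> \<kappa> * 1" "\<bar>neg.k y * b'\<bar> \<le> \<kappa> * 1"
        unfolding abs_mult nk abs_minus_cancel using that \<kappa>[OF y] \<kappa>0 by (intro mult_mono; simp)+
      then have "\<bar>(a - k y * b) + (a' - neg.k y * b')\<bar> \<le> 2 * (1 + \<kappa>)"
        using that unfolding abs_le_iff by (simp add: algebra_simps)
      then have "c * \<bar>(a - k y * b) + (a' - neg.k y * b')\<bar> \<le> c * (2 * (1 + \<kappa>))"
        using c(1) by (intro mult_left_mono) auto
      then show ?thesis using c(1) unfolding c(2) abs_mult by simp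
    qed
    \<comment> \<open>Second components: a single Jacobian may be nearly 2, but both are positive
      and their sum is 2.\<close>
    have second: "\<bar>c * (w y * b + neg.w y * b')\<bar> \<le> 1" if "\<bar>b\<bar> \<le> 1" "\<bar>b'\<bar> \<le> 1" for b b'
    proof -
      have "\<bar>w y * b\<bar> \<le> w y" "\<bar>neg.w y * b'\<bar> \<le> neg.w y"
        using that w_pos[of y] neg.w_pos[of y] by (auto simp: abs_mult)
      then have "\<bar>w y * b + neg.w y * b'\<bar> \<le> w y + neg.w y"
        by (intro order_trans[OF abs_triangle_ineq] add_mono)
      also have "\<dots> \<le> 2 * (1 + \<kappa>)" using wsum \<kappa>0 by simp
      finally have "\<bar>w y * b + neg.w y * b'\<bar> \<le> 2 * (1 + \<kappa>)" .
      then have "c * \<bar>w y * b + neg.w y * b'\<bar> \<le> c * (2 * (1 + \<kappa>))"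
        using c(1) by (intro mult_left_mono) auto
      then show ?thesis using c(1) unfolding c(2) abs_mult by simp
    qed
    show "linf4 (\<Psi> y) \<le> 1"
      unfolding linf4_le_iff \<Psi>_def S_def pull2_def neg.pull2_def pull_def neg.pull_def
      using b first second by simp
  qed
  then have "pairing f \<Psi> \<le> V" using pairing_le_Var[of \<Psi> f] V by (meson ereal_less_eq(3) order_trans)
  moreover have "pairing f \<Psi> = c * (pairing f (pull2 \<phi>) + pairing f (neg.pull2 \<psi>))"
  proof -
    have d: "div2 (\<lambda>y. fst (\<Psi> y)) x = c * (div2 (\<lambda>y. fst (pull2 \<phi> y)) x + div2 (\<lambda>y. fst (neg.pull2 \<psi> y)) x)"
      "div2 (\<lambda>y. snd (\<Psi> y)) x = c * (div2 (\<lambda>y. snd (pull2 \<phi> y)) x + div2 (\<lambda>y. snd (neg.pull2 \<psi> y)) x)"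
      if x: "x \<in> unit_square" for x
    proof -
      note cf = C1_fst_snd[OF P(1,2)] C1_fst_snd[OF P(3,4)]
      note df = cf(1,2,5,6)[THEN Ck_on_1_differentiable, OF x]
      show "div2 (\<lambda>y. fst (\<Psi> y)) x = c * (div2 (\<lambda>y. fst (pull2 \<phi> y)) x + div2 (\<lambda>y. fst (neg.pull2 \<psi> y)) x)"
        unfolding \<Psi>_def S_def using div2_scaleR[OF differentiable_add[OF df(1) df(3)], of c] div2_add[OF df(1) df(3)] by simp
      show "div2 (\<lambda>y. snd (\<Psi> y)) x = c * (div2 (\<lambda>y. snd (pull2 \<phi> y)) x + div2 (\<lambda>y. snd (neg.pull2 \<psi> y)) x)"
        unfolding \<Psi>_def S_def using div2_scaleR[OF differentiable_add[OF df(2) df(4)], of c] div2_add[OF df(2) df(4)] by simp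
    qed
    let ?I = "\<lambda>\<phi> x. f x $ 1 * div2 (\<lambda>y. fst (\<phi> y)) x + f x $ 2 * div2 (\<lambda>y. snd (\<phi> y)) x"
    have i: "set_integrable lebesgue unit_square (?I (pull2 \<phi>))" "set_integrable lebesgue unit_square (?I (neg.pull2 \<psi>))"
      by (intro set_integral_add set_integrable_pairing_term f C1_fst_snd P)+
    have "pairing f \<Psi> = (LINT x:unit_square|lebesgue. c * (?I (pull2 \<phi>) x + ?I (neg.pull2 \<psi>) x))"
      unfolding pairing_def by (intro set_lebesgue_integral_cong) (auto simp: d algebra_simps)
    also have "\<dots> = c * (pairing f (pull2 \<phi>) + pairing f (neg.pull2 \<psi>))"
      unfolding pairing_def using set_integral_add(2)[OF i] by simp
    finally show ?thesis .
  qed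
  ultimately have "c * (pairing f (pull2 \<phi>) + pairing f (neg.pull2 \<psi>)) \<le> V" by simp
  then have "pairing f (pull2 \<phi>) + pairing f (neg.pull2 \<psi>) \<le> 2 * (1 + \<kappa>) * V"
    using \<kappa>0 by (simp add: c_def pos_divide_le_eq mult.commute)
  then show ?thesis by (simp add: pairing_comp_h[OF f \<phi>'] neg.pairing_comp_h[OF f \<psi>'])
qed

end

section \<open>A smoothed triangle wave\<close>

text \<open>The limit for \<open>c \<rightarrow> 1\<close> is the triangle wave of period 1 with slopes \<open>\<plusminus>1\<close>.\<close>

definition wave :: "real \<Rightarrow> real \<Rightarrow> real" where
  "wave c x = arcsin (c * sin (2 * pi * x)) / (2 * pi)"

definition wave' :: "real \<Rightarrow> real \<Rightarrow> real" where
  "wave' c x = c * cos (2 * pi * x) / sqrt (1 - (c * sin (2 * pi * x))\<^sup>2)"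

definition wave'' :: "real \<Rightarrow> real \<Rightarrow> real" where
  "wave'' c x = - (2 * pi * c * sin (2 * pi * x)) / sqrt (1 - (c * sin (2 * pi * x))\<^sup>2) +
     2 * pi * c ^ 3 * (cos (2 * pi * x))\<^sup>2 * sin (2 * pi * x) /
       ((1 - (c * sin (2 * pi * x))\<^sup>2) * sqrt (1 - (c * sin (2 * pi * x))\<^sup>2))"

context
  fixes c :: real
  assumes c: "0 \<le> c" "c < 1"
begin

text \<open>The condition c < 1 keeps the argument of \<open>arcsin\<close> inside the open interval
  where it is smooth; this is the smoothing of the corners.\<close>

lemma wave_arg: "\<bar>c * sin y\<bar> < 1" "0 < 1 - (c * sin y)\<^sup>2"
proof -
  have "\<bar>c * sin y\<bar> \<le> c * 1" unfolding abs_mult using c by (intro mult_mono) auto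
  then show *: "\<bar>c * sin y\<bar> < 1" using c by simp
  then show "0 < 1 - (c * sin y)\<^sup>2" by (simp add: abs_square_less_1)
qed

lemma wave_has_derivative: "(wave c has_real_derivative wave' c x) (at x)"
proof -
  have "((\<lambda>x. c * sin (2 * pi * x)) has_real_derivative c * (cos (2 * pi * x) * (2 * pi))) (at x)"
    by (auto intro!: derivative_eq_intros)
  moreover have "(arcsin has_real_derivative inverse (sqrt (1 - (c * sin (2 * pi * x))\<^sup>2))) (at (c * sin (2 * pi * x)))"
    using wave_arg(1)[of "2 * pi * x"] by (intro DERIV_arcsin) auto
  ultimately have "((\<lambda>x. arcsin (c * sin (2 * pi * x)) / (2 * pi)) has_real_derivative
      inverse (sqrt (1 - (c * sin (2 * pi * x))\<^sup>2)) * (c * (cos (2 * pi * x) * (2 * pi))) / (2 * pi)) (at x)"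
    by (intro DERIV_cdivide) (rule DERIV_chain2)
  then show ?thesis by (simp add: wave_def[abs_def] wave'_def field_simps)
qed

lemma wave'_has_derivative: "(wave' c has_real_derivative wave'' c x) (at x)"
proof -
  define D where "D = 1 - (c * sin (2 * pi * x))\<^sup>2"
  have D: "0 < D" using wave_arg by (simp add: D_def)
  have d: "((\<lambda>x. 1 - (c * sin (2 * pi * x))\<^sup>2) has_real_derivative
      - (4 * pi * c\<^sup>2 * sin (2 * pi * x) * cos (2 * pi * x))) (at x)"
    by (auto intro!: derivative_eq_intros simp: power2_eq_square)
  have s: "((\<lambda>x. sqrt (1 - (c * sin (2 * pi * x))\<^sup>2)) has_real_derivative
      inverse (sqrt D) / 2 * - (4 * pi * c\<^sup>2 * sin (2 * pi * x) * cos (2 * pi * x))) (at x)"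
    using D unfolding D_def by (intro DERIV_chain2[OF DERIV_real_sqrt d])
  have n: "((\<lambda>x. c * cos (2 * pi * x)) has_real_derivative - (2 * pi * c * sin (2 * pi * x))) (at x)"
    by (auto intro!: derivative_eq_intros)
  have "((\<lambda>x. c * cos (2 * pi * x) / sqrt (1 - (c * sin (2 * pi * x))\<^sup>2)) has_real_derivative wave'' c x) (at x)"
  proof (rule DERIV_cong[OF DERIV_divide[OF n s]])
    show "sqrt (1 - (c * sin (2 * pi * x))\<^sup>2) \<noteq> 0" using D by (simp add: D_def)
    have "sqrt D * sqrt D = D" using D by simp
    then show "(- (2 * pi * c * sin (2 * pi * x)) * sqrt (1 - (c * sin (2 * pi * x))\<^sup>2) -
        c * cos (2 * pi * x) * (inverse (sqrt D) / 2 * - (4 * pi * c\<^sup>2 * sin (2 * pi * x) * cos (2 * pi * x)))) /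
        (sqrt (1 - (c * sin (2 * pi * x))\<^sup>2) * sqrt (1 - (c * sin (2 * pi * x))\<^sup>2)) = wave'' c x"
      unfolding wave''_def D_def[symmetric] using D
      by (simp add: divide_simps power2_eq_square power3_eq_cube)
  qed
  then show ?thesis by (simp add: wave'_def[abs_def])
qed

lemma wave''_continuous: "continuous_on UNIV (wave'' c)"
proof -
  have "sqrt (1 - (c * sin y)\<^sup>2) \<noteq> 0" "1 - (c * sin y)\<^sup>2 \<noteq> 0" for y
    using wave_arg(2)[of y] by auto
  then show ?thesis unfolding wave''_def[abs_def]
    by (intro continuous_intros) (auto simp del: real_sqrt_eq_0_iff)
qed

text \<open>Since c < 1, cos^2 = 1 - sin^2 is at most 1 - (c sin)^2, so the quotient is bounded by
  \<open>c\<close>. The strict bound is the injectivity condition of the shear.\<close>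

lemma wave'_bound: "\<bar>wave' c x\<bar> < 1"
proof -
  let ?s = "sin (2 * pi * x)" and ?k = "cos (2 * pi * x)"
  have "c\<^sup>2 * ?s\<^sup>2 \<le> 1 * ?s\<^sup>2" using c by (intro mult_right_mono) (auto simp: power_le_one)
  then have "?k\<^sup>2 \<le> 1 - (c * ?s)\<^sup>2"
    using sin_cos_squared_add[of "2 * pi * x"] unfolding power_mult_distrib by linarith
  then have "\<bar>?k\<bar> \<le> sqrt (1 - (c * ?s)\<^sup>2)" by (simp add: real_le_rsqrt)
  then have "c * \<bar>?k\<bar> \<le> c * sqrt (1 - (c * ?s)\<^sup>2)" using c by (intro mult_left_mono) auto
  also have "\<dots> < 1 * sqrt (1 - (c * ?s)\<^sup>2)" using c wave_arg(2) by (intro mult_strict_right_mono) auto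
  finally show ?thesis using c wave_arg(2)[of "2 * pi * x"]
    by (simp add: wave'_def abs_mult)
qed

lemma wave_bound: "\<bar>wave c x\<bar> \<le> 1/4"
proof -
  have "\<bar>arcsin (c * sin (2 * pi * x))\<bar> \<le> pi / 2"
    using arcsin_bounded[of "c * sin (2 * pi * x)"] wave_arg(1)[of "2 * pi * x"] by linarith
  then show ?thesis by (simp add: wave_def field_simps)
qed

text \<open>The maxima and minima of the wave. Adding it moves m + 1/4 to the right and m + 3/4 to
  the left, by nearly 1/4 when \<open>c\<close> is near 1; subtracting it contracts the
  complementary intervals in the same way.\<close>

lemma wave_values:
  "wave c (real m) = 0" "wave c (real m + 1/4) = arcsin c / (2 * pi)" "wave c (real m + 3/4) = - arcsin c / (2 * pi)"
proof -
  have s: "sin (2 * pi * (real m + y)) = sin (2 * pi * y)" for y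
    using sin_add[of "2 * pi * y" "real (2 * m) * pi"] cos_npi[of "2 * m"] sin_npi[of "2 * m"]
    by (simp add: algebra_simps)
  have "sin (2 * pi * (3/4)) = - 1"
    using sin_add[of pi "pi / 2"] by (simp add: field_simps)
  then show "wave c (real m) = 0" "wave c (real m + 1/4) = arcsin c / (2 * pi)" "wave c (real m + 3/4) = - arcsin c / (2 * pi)"
    using s[of 0] s[of "1/4"] s[of "3/4"] c by (auto simp: wave_def arcsin_minus)
qed

end

section \<open>Weighted means over vertical lines\<close>

text \<open>A scalar trace of the first coordinate on the vertical line at \<open>s\<close>.
  Averaging makes its increments computable from the weak derivative.\<close>

definition strip_mean :: "(real^2 \<Rightarrow> real^2) \<Rightarrow> real \<Rightarrow> real" where
  "strip_mean f s = (LINT t:{0<..<1}|lborel. f (vec2 s t) $ 1 * strip_bump t)"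

lemma set_integrable_strip_bump: "set_integrable lborel {0<..<1} strip_bump"
proof -
  obtain C where "\<And>t. strip_bump t \<le> C" using strip_bump_bounded by blast
  then show ?thesis
    using strip_bump_nonneg by (intro set_integrable_continuous_bounded[where B=C] continuous_on_strip_bump) auto
qed

lemma strip_mass_eq: "strip_mass = (LINT t:{0<..<1}|lborel. strip_bump t)"
  using set_integrable_strip_bump
  by (simp add: set_borel_integral_eq_integral strip_mass_def integral_open_interval_real)

lemma unit_interval_integral_bound:
  fixes F :: "real \<Rightarrow> real"
  assumes "set_integrable lborel {0<..<1} F" "\<And>x. x \<in> {0<..<1} \<Longrightarrow> \<bar>F x\<bar> \<le> B"
  shows "\<bar>LINT x:{0<..<1}|lborel. F x\<bar> \<le> B"
proof -
  have "\<bar>LINT x:{0<..<1}|lborel. F x\<bar> \<le> (LINT x:{0<..<1}|lborel. \<bar>F x\<bar>)"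
    using set_integral_norm_bound[OF assms(1)] by simp
  also have "\<dots> \<le> (LINT x:{0<..<(1::real)}|lborel. B)"
    using assms by (intro set_integral_mono set_integrable_abs) (auto simp: set_integrable_def)
  also have "\<dots> = B" by (simp add: set_lebesgue_integral_def)
  finally show ?thesis .
qed

lemma set_integrable_strip_mean:
  assumes f: "square_map f" and s: "0 < s" "s < 1"
  shows "set_integrable lborel {0<..<1} (\<lambda>t. f (vec2 s t) $ 1 * strip_bump t)"
proof -
  obtain C where C: "0 < C" "\<And>t. strip_bump t \<le> C" using strip_bump_bounded by blast
  show ?thesis
  proof (rule set_integrable_continuous_bounded)
    have "continuous_on {0<..<1} (\<lambda>t. f (vec2 s t))"
      using f s by (intro continuous_on_compose2[of unit_square f _ "\<lambda>t. vec2 s t", OF _ continuous_on_vec2])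
        (auto simp: square_map_def vec2_in_unit_square)
    then show "continuous_on {0<..<1} (\<lambda>t. f (vec2 s t) $ 1 * strip_bump t)"
      by (intro continuous_intros continuous_on_strip_bump)
    show "\<bar>f (vec2 s t) $ 1 * strip_bump t\<bar> \<le> 1 * C" if "t \<in> {0<..<1}" for t
      unfolding abs_mult using C strip_bump_nonneg[of t] square_map_bound[OF f, of "vec2 s t"] s that
      by (intro mult_mono) (auto simp: vec2_in_unit_square)
  qed auto
qed

text \<open>Two maps and two lines are allowed at once: equal lines give stability under uniform
  convergence, equal maps give continuity in \<open>s\<close>.\<close>

lemma strip_mean_close:
  assumes C: "\<And>t. strip_bump t \<le> C"
    and f: "square_map f" "0 < s" "s < 1" and g: "square_map g" "0 < s'" "s' < 1"
    and e: "\<And>t. t \<in> {0<..<1} \<Longrightarrow> norm (f (vec2 s t) - g (vec2 s' t)) \<le> \<epsilon>"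
  shows "\<bar>strip_mean f s - strip_mean g s'\<bar> \<le> \<epsilon> * C"
proof -
  note i = set_integrable_strip_mean[OF f] set_integrable_strip_mean[OF g]
  have "strip_mean f s - strip_mean g s' =
      (LINT t:{0<..<1}|lborel. f (vec2 s t) $ 1 * strip_bump t - g (vec2 s' t) $ 1 * strip_bump t)"
    unfolding strip_mean_def using set_integral_diff(2)[OF i] by simp
  also have "\<bar>\<dots>\<bar> \<le> \<epsilon> * C"
  proof (rule unit_interval_integral_bound[OF set_integral_diff(1)[OF i]])
    fix t :: real assume t: "t \<in> {0<..<1}"
    have "\<bar>f (vec2 s t) $ 1 - g (vec2 s' t) $ 1\<bar> \<le> \<epsilon>"
      using component_le_norm_cart[of "f (vec2 s t) - g (vec2 s' t)" 1] e[OF t] by simp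
    moreover have "0 \<le> strip_bump t" "strip_bump t \<le> C" using C strip_bump_nonneg by auto
    ultimately have "\<bar>f (vec2 s t) $ 1 - g (vec2 s' t) $ 1\<bar> * \<bar>strip_bump t\<bar> \<le> \<epsilon> * C"
      by (intro mult_mono) auto
    then show "\<bar>f (vec2 s t) $ 1 * strip_bump t - g (vec2 s' t) $ 1 * strip_bump t\<bar> \<le> \<epsilon> * C"
      by (simp add: left_diff_distrib flip: abs_mult)
  qed
  finally show ?thesis .
qed

lemma continuous_on_strip_mean:
  assumes f: "square_map f" "uniformly_continuous_on unit_square f"
  shows "continuous_on {0<..<1} (strip_mean f)"
proof -
  obtain C where C: "0 < C" "\<And>t. strip_bump t \<le> C" using strip_bump_bounded by blast
  show ?thesis unfolding continuous_on_iff
  proof (intro ballI allI impI)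
    fix s e :: real assume s: "s \<in> {0<..<1}" and e: "0 < e"
    obtain d where d: "0 < d" "\<And>x y. x \<in> unit_square \<Longrightarrow> y \<in> unit_square \<Longrightarrow> dist y x < d \<Longrightarrow> dist (f y) (f x) < e / (2 * C)"
      using f(2)[unfolded uniformly_continuous_on_def, rule_format, of "e / (2 * C)"] e C(1) by auto
    have "dist (strip_mean f s') (strip_mean f s) < e" if s': "s' \<in> {0<..<1}" "dist s' s < d" for s'
    proof -
      have "norm (f (vec2 s' t) - f (vec2 s t)) \<le> e / (2 * C)" if "t \<in> {0<..<1}" for t
      proof -
        have "dist (vec2 s' t) (vec2 s t) \<le> \<bar>s' - s\<bar>"
          unfolding dist_norm by (rule order_trans[OF norm_le_l1_cart]) (simp add: sum_2)
        then have "dist (f (vec2 s' t)) (f (vec2 s t)) < e / (2 * C)"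
          using s s' that by (intro d(2)) (auto simp: vec2_in_unit_square dist_real_def)
        then show ?thesis by (simp add: dist_norm)
      qed
      then have "\<bar>strip_mean f s' - strip_mean f s\<bar> \<le> e / (2 * C) * C"
        using s s' f(1) by (intro strip_mean_close C) auto
      also have "\<dots> < e" using C(1) e by simp
      finally show ?thesis by (simp add: dist_real_def)
    qed
    then show "\<exists>d>0. \<forall>x'\<in>{0<..<1}. dist x' s < d \<longrightarrow> dist (strip_mean f x') (strip_mean f s) < e"
      using d(1) by blast
  qed
qed

lemma strip_mean_bounded:
  assumes f: "square_map f" and C: "\<And>t. strip_bump t \<le> C" and s: "s \<in> {0<..<1}"
  shows "\<bar>strip_mean f s\<bar> \<le> C"
  unfolding strip_mean_def
proof (rule unit_interval_integral_bound)
  show "set_integrable lborel {0<..<1} (\<lambda>t. f (vec2 s t) $ 1 * strip_bump t)"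
    using s by (intro set_integrable_strip_mean f) auto
  show "\<bar>f (vec2 s t) $ 1 * strip_bump t\<bar> \<le> C" if "t \<in> {0<..<1}" for t
  proof -
    have "\<bar>f (vec2 s t) $ 1\<bar> * \<bar>strip_bump t\<bar> \<le> 1 * C"
      using C strip_bump_nonneg[of t] square_map_bound[OF f, of "vec2 s t"] s that
      by (intro mult_mono) (auto simp: vec2_in_unit_square)
    then show ?thesis by (simp add: abs_mult)
  qed
qed

text \<open>The weight vanishes outside the middle half, where \<open>\<eta>\<close> may differ from
  1; inside it \<open>h\<close> simply undoes the shift of the whole vertical line. Thus the means
  are carried along without any error.\<close>

lemma shear_strip_mean:
  assumes "shear \<tau> \<tau>' \<tau>'' \<eta> \<eta>' \<eta>''" "\<And>t. 1/4 \<le> t \<Longrightarrow> t \<le> 3/4 \<Longrightarrow> \<eta> t = 1"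
  shows "strip_mean (\<lambda>x. f (shear.h \<tau> \<eta> x)) (s + \<tau> s) = strip_mean f s"
proof -
  interpret shear \<tau> \<tau>' \<tau>'' \<eta> \<eta>' \<eta>'' by fact
  have "f (h (vec2 (s + \<tau> s) t)) $ 1 * strip_bump t = f (vec2 s t) $ 1 * strip_bump t" for t
  proof (cases "1/4 \<le> t \<and> t \<le> 3/4")
    case True
    then have "p (vec2 s t) = vec2 (s + \<tau> s) t" using assms(2) by (simp add: p_def)
    then have "h (vec2 (s + \<tau> s) t) = vec2 s t" using h_p[of "vec2 s t"] by simp
    then show ?thesis by simp
  next
    case False
    then have "strip_bump t = 0" by (intro strip_bump_eq_0) auto
    then show ?thesis by simp
  qed
  then show ?thesis by (simp only: strip_mean_def)
qed

lemma strip_mean_cong: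
  assumes "\<And>x. x \<in> unit_square \<Longrightarrow> f x = g x" "0 < s" "s < 1"
  shows "strip_mean f s = strip_mean g s"
  unfolding strip_mean_def using assms
  by (intro set_lebesgue_integral_cong) (auto simp: vec2_in_unit_square)

section \<open>Increments of Sobolev maps\<close>

lemma integral_mollifier_scaled:
  assumes "0 < e" "0 < a" "a + e < 1"
  shows "(LINT s:{0<..<1}|lborel. mollifier ((s - a) / e) / e) = 1"
    and "set_integrable lborel {0<..<1} (\<lambda>s. mollifier ((s - a) / e) / e)"
proof -
  have c: "continuous_on S (\<lambda>s. mollifier ((s - a) / e) / e)" for S
    using assms by (intro continuous_intros continuous_on_compose2[OF continuous_on_mollifier[of UNIV]]) auto
  obtain B where B: "\<And>s. 0 \<le> s \<Longrightarrow> s \<le> 1 \<Longrightarrow> \<bar>mollifier ((s - a) / e) / e\<bar> \<le> B"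
    using continuous_unit_interval_bounded[OF c] by blast
  show i: "set_integrable lborel {0<..<1} (\<lambda>s. mollifier ((s - a) / e) / e)"
    using B by (intro set_integrable_continuous_bounded[where B=B] c) auto
  have "((\<lambda>s. mollifier ((s - a) / e) / e) has_integral smooth_step ((1 - a) / e) - smooth_step ((0 - a) / e)) {0..1}"
  proof (rule fundamental_theorem_of_calculus)
    fix s :: real
    have "((\<lambda>s. smooth_step ((s - a) / e)) has_real_derivative mollifier ((s - a) / e) * (1 / e)) (at s)"
      using assms by (intro DERIV_chain2[OF smooth_step_has_derivative]) (auto intro!: derivative_eq_intros)
    then show "((\<lambda>s. smooth_step ((s - a) / e)) has_vector_derivative mollifier ((s - a) / e) / e) (at s within {0..1})"
      by (simp add: has_real_derivative_iff_has_vector_derivative[symmetric] has_field_derivative_at_within)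
  qed simp
  moreover have "smooth_step ((1 - a) / e) = 1" "smooth_step ((0 - a) / e) = 0"
    using assms by (intro smooth_step_eq_1 smooth_step_eq_0; simp add: field_simps)+
  ultimately have "((\<lambda>s. mollifier ((s - a) / e) / e) has_integral 1) {0..1}"
    by (simp only: diff_zero)
  then have "integral {0..1} (\<lambda>s. mollifier ((s - a) / e) / e) = 1" by (rule integral_unique)
  then show "(LINT s:{0<..<1}|lborel. mollifier ((s - a) / e) / e) = 1"
    using set_borel_integral_eq_integral(2)[OF i] by (metis integral_open_interval_real)
qed

text \<open>A one-sided approximate identity: the kernel has mass 1 and lives on (a, a + \<eta> m),
  where \<open>u\<close> is close to \<open>u a\<close>.\<close>

lemma mollifier_approximates:
  fixes u :: "real \<Rightarrow> real"
  assumes u: "continuous_on {0<..<1} u" "\<And>s. s \<in> {0<..<1} \<Longrightarrow> \<bar>u s\<bar> \<le> B"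
    and a: "0 < a" "a < 1"
    and \<eta>: "\<eta> \<longlonglongrightarrow> 0" "\<And>m. 0 < \<eta> m" "\<And>m. a + \<eta> m < 1"
  shows "(\<lambda>m. LINT s:{0<..<1}|lborel. mollifier ((s - a) / \<eta> m) / \<eta> m * u s) \<longlonglongrightarrow> u a"
proof (rule LIMSEQ_I)
  fix r :: real assume r: "0 < r"
  obtain d where d: "0 < d" "\<And>s. s \<in> {0<..<1} \<Longrightarrow> \<bar>s - a\<bar> < d \<Longrightarrow> \<bar>u s - u a\<bar> < r / 2"
    using u(1) a r unfolding continuous_on_iff dist_real_def
    by (metis greaterThanLessThan_iff half_gt_zero)
  obtain N where N: "\<And>m. N \<le> m \<Longrightarrow> \<eta> m < d"
    using LIMSEQ_D[OF \<eta>(1) d(1)] by fastforce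
  have "norm ((LINT s:{0<..<1}|lborel. mollifier ((s - a) / \<eta> m) / \<eta> m * u s) - u a) < r" if "N \<le> m" for m
  proof -
    let ?k = "\<lambda>s. mollifier ((s - a) / \<eta> m) / \<eta> m"
    note I = integral_mollifier_scaled[OF \<eta>(2) a(1) \<eta>(3), of m]
    have cu: "continuous_on {0<..<1} ?k"
      using \<eta>(2)[of m] by (intro continuous_intros continuous_on_compose2[OF continuous_on_mollifier[of UNIV]]) auto
    have "continuous_on {0..1} ?k"
      using \<eta>(2)[of m] by (intro continuous_intros continuous_on_compose2[OF continuous_on_mollifier[of UNIV]]) auto
    then obtain B' where B': "0 < B'" "\<And>s. 0 \<le> s \<Longrightarrow> s \<le> 1 \<Longrightarrow> \<bar>?k s\<bar> \<le> B'"
      using continuous_unit_interval_bounded by blast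
    have i: "set_integrable lborel {0<..<1} (\<lambda>s. ?k s * u s)"
    proof (rule set_integrable_continuous_bounded)
      show "\<bar>?k s * u s\<bar> \<le> B' * B" if "s \<in> {0<..<1}" for s
        unfolding abs_mult using B' u(2)[OF that] that by (intro mult_mono) auto
      show "continuous_on {0<..<1} (\<lambda>s. ?k s * u s)" by (intro continuous_on_mult cu u)
    qed auto
    have i': "set_integrable lborel {0<..<1} (\<lambda>s. ?k s * u a)"
      using I(2) by (intro set_integrable_mult_left) auto
    have "\<bar>(LINT s:{0<..<1}|lborel. ?k s * u s) - u a\<bar> = \<bar>LINT s:{0<..<1}|lborel. ?k s * u s - ?k s * u a\<bar>"
      using I(1) set_integral_diff(2)[OF i i'] by simp
    also have "\<dots> \<le> (LINT s:{0<..<1}|lborel. \<bar>?k s * u s - ?k s * u a\<bar>)"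
      using set_integral_norm_bound[OF set_integral_diff(1)[OF i i']] by simp
    also have "\<dots> \<le> (LINT s:{0<..<1}|lborel. ?k s * (r / 2))"
    proof (rule set_integral_mono)
      show "set_integrable lborel {0<..<1} (\<lambda>s. \<bar>?k s * u s - ?k s * u a\<bar>)"
        by (rule set_integrable_abs[OF set_integral_diff(1)[OF i i']])
      show "set_integrable lborel {0<..<1} (\<lambda>s. ?k s * (r / 2))"
        using I(2) by (intro set_integrable_mult_left) auto
      fix s :: real assume s: "s \<in> {0<..<1}"
      show "\<bar>?k s * u s - ?k s * u a\<bar> \<le> ?k s * (r / 2)"
      proof (cases "a < s \<and> s < a + \<eta> m")
        case True
        then have "\<bar>u s - u a\<bar> \<le> r / 2" using d(2)[OF s] N[OF that] by auto
        then have "?k s * \<bar>u s - u a\<bar> \<le> ?k s * (r / 2)"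
          using \<eta>(2)[of m] by (intro mult_left_mono divide_nonneg_nonneg mollifier_nonneg) auto
        moreover have "\<bar>?k s * u s - ?k s * u a\<bar> = ?k s * \<bar>u s - u a\<bar>"
          unfolding right_diff_distrib[symmetric] abs_mult
          using \<eta>(2)[of m] mollifier_nonneg[of "(s - a) / \<eta> m"] by simp
        ultimately show ?thesis by simp
      next
        case False
        then have "mollifier ((s - a) / \<eta> m) = 0"
          using \<eta>(2)[of m] by (intro mollifier_eq_0) (auto simp: field_simps)
        then show ?thesis by simp
      qed
    qed
    also have "\<dots> = r / 2" using I(1) by simp
    finally show ?thesis using r by simp
  qed
  then show "\<exists>no. \<forall>n\<ge>no. norm ((LINT s:{0<..<1}|lborel. mollifier ((s - a) / \<eta> n) / \<eta> n * u s) - u a) < r" by blast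
qed

text \<open>Stated for Borel factors, because the limiting weight contains the indicator of an
  interval.\<close>

lemma integrable_times_bounded_continuous:
  assumes G: "set_integrable lebesgue unit_square G"
    and b: "b \<in> borel_measurable borel" "\<And>x. \<bar>b x\<bar> \<le> B"
  shows "set_integrable lebesgue unit_square (\<lambda>x. G x * b x :: real)"
  unfolding set_integrable_def
proof (rule Bochner_Integration.integrable_bound)
  show "integrable lebesgue (\<lambda>x. B * (indicator unit_square x *\<^sub>R G x))"
    using G by (simp add: set_integrable_def)
  have "b \<in> borel_measurable lebesgue" using b(1) by (auto intro: measurable_completion)
  then have "(\<lambda>x. (indicator unit_square x *\<^sub>R G x) * b x) \<in> borel_measurable lebesgue"
    using G by (intro borel_measurable_times) (auto simp: set_integrable_def)
  then show "(\<lambda>x. indicator unit_square x *\<^sub>R (G x * b x)) \<in> borel_measurable lebesgue"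
    by (simp add: mult.assoc)
  have "\<bar>G x\<bar> * \<bar>b x\<bar> \<le> \<bar>B\<bar> * \<bar>G x\<bar>" for x
    using mult_right_mono[of "\<bar>b x\<bar>" "\<bar>B\<bar>" "\<bar>G x\<bar>"] b(2)[of x] by (simp add: mult.commute)
  then show "AE x in lebesgue. norm (indicator unit_square x *\<^sub>R (G x * b x)) \<le> norm (B * (indicator unit_square x *\<^sub>R G x))"
    by (auto simp: abs_mult indicator_def)
qed

lemma borel_measurable_strip_weight:
  "(\<lambda>x::real^2. indicator {a<..b} (x $ 1) * strip_bump (x $ 2)) \<in> borel_measurable borel"
proof (intro borel_measurable_times)
  show "(\<lambda>x::real^2. indicator {a<..b} (x $ 1) :: real) \<in> borel_measurable borel"
    by (intro measurable_compose[OF borel_measurable_continuous_onI[OF continuous_on_component[OF continuous_on_id]]]) auto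
  show "(\<lambda>x::real^2. strip_bump (x $ 2)) \<in> borel_measurable borel"
    by (intro borel_measurable_continuous_onI continuous_on_compose2[OF continuous_on_strip_bump[of UNIV]] continuous_intros) auto
qed

text \<open>The weak derivative is tested with a product of \<open>strip_bump\<close> and a smooth
  approximation of the indicator of (a, b]. The derivative of the latter is a kernel near
  \<open>a\<close> minus a kernel near \<open>b\<close>, so one side converges to a difference of
  means and the other, by dominated convergence, to the integral.\<close>

lemma Sobolev_increment:
  assumes f: "square_map f" "uniformly_continuous_on unit_square f"
    and G: "set_integrable lebesgue unit_square G" "weak_partial_deriv unit_square 1 (\<lambda>x. f x $ 1) G"
    and ab: "0 < a" "a < b" "b < 1"
  shows "strip_mean f b - strip_mean f a =
    (LINT x:unit_square|lebesgue. G x * (indicator {a<..b} (x $ 1) * strip_bump (x $ 2)))"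
proof -
  obtain C where C: "0 < C" "\<And>t. strip_bump t \<le> C" using strip_bump_bounded by blast
  \<comment> \<open>The transition width tends to 0 and stays below 1 - b, so the test functions
    have compact support in the square.\<close>
  define \<eta> where "\<eta> m = (1 - b) / real (m + 2)" for m
  have \<eta>0: "0 < \<eta> m" for m using ab by (simp add: \<eta>_def)
  have \<eta>1: "b + \<eta> m < 1" "a + \<eta> m < 1" for m
  proof -
    have "\<eta> m < 1 - b" using ab by (simp add: \<eta>_def divide_less_eq mult_less_cancel_left1)
    then show "b + \<eta> m < 1" "a + \<eta> m < 1" using ab by auto
  qed
  have \<eta>lim: "\<eta> \<longlonglongrightarrow> 0"
    unfolding \<eta>_def[abs_def] using LIMSEQ_ignore_initial_segment[OF lim_const_over_n, of "1 - b" 2] by simp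
  define \<alpha> where "\<alpha> m s = smooth_step ((s - a) / \<eta> m) - smooth_step ((s - b) / \<eta> m)" for m s
  define \<alpha>' where "\<alpha>' m s = mollifier ((s - a) / \<eta> m) / \<eta> m - mollifier ((s - b) / \<eta> m) / \<eta> m" for m s
  define \<psi> where "\<psi> m = (\<lambda>x::real^2. \<alpha> m (x $ 1) * strip_bump (x $ 2))" for m
  have Ck_\<alpha>: "Ck_real k (\<alpha> m)" for k m
    using Ck_real_diff[OF Ck_real_affine[OF Ck_real_smooth_step, of k 1 "1 / \<eta> m" "- a / \<eta> m"]
      Ck_real_affine[OF Ck_real_smooth_step, of k 1 "1 / \<eta> m" "- b / \<eta> m"]]
    by (simp add: \<alpha>_def[abs_def] diff_divide_distrib)
  have \<alpha>_deriv: "(\<alpha> m has_real_derivative \<alpha>' m s) (at s)" for m s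
  proof -
    have "((\<lambda>s. smooth_step ((s - c) / \<eta> m)) has_real_derivative mollifier ((s - c) / \<eta> m) * (1 / \<eta> m)) (at s)" for c
      using \<eta>0[of m] by (intro DERIV_chain2[OF smooth_step_has_derivative]) (auto intro!: derivative_eq_intros)
    from DERIV_diff[OF this[of a] this[of b]] show ?thesis by (simp add: \<alpha>_def[abs_def] \<alpha>'_def)
  qed
  have \<alpha>_bounds: "0 \<le> \<alpha> m s" "\<alpha> m s \<le> 1" for m s
  proof -
    have "(s - b) / \<eta> m \<le> (s - a) / \<eta> m" using \<eta>0[of m] ab by (intro divide_right_mono) auto
    then show "0 \<le> \<alpha> m s" using smooth_step_mono by (simp add: \<alpha>_def)
    show "\<alpha> m s \<le> 1" using smooth_step_bounds[of "(s - a) / \<eta> m"] smooth_step_bounds[of "(s - b) / \<eta> m"] by (simp add: \<alpha>_def)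
  qed
  have \<alpha>_zero: "\<alpha> m s = 0" if "s \<le> a \<or> b + \<eta> m \<le> s" for m s
  proof (cases "s \<le> a")
    case True
    then show ?thesis using \<eta>0[of m] ab by (simp add: \<alpha>_def smooth_step_eq_0 divide_nonpos_pos)
  next
    case False
    then have "1 \<le> (s - a) / \<eta> m" "1 \<le> (s - b) / \<eta> m"
      using that \<eta>0[of m] ab by (auto simp: pos_le_divide_eq)
    then show ?thesis by (simp add: \<alpha>_def smooth_step_eq_1)
  qed
  have supp: "compactly_supported_in unit_square (\<psi> m)" for m
    unfolding compactly_supported_in_def
  proof (intro exI[of _ "cbox (vec2 a (1/4)) (vec2 (b + \<eta> m) (3/4))"] conjI ballI)
    show "cbox (vec2 a (1/4)) (vec2 (b + \<eta> m) (3/4)) \<subseteq> unit_square"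
      using ab \<eta>1[of m] by (auto simp: mem_box_cart unit_square_def forall_2)
    fix x assume "x \<in> unit_square - cbox (vec2 a (1/4)) (vec2 (b + \<eta> m) (3/4))"
    then have "x $ 1 \<le> a \<or> b + \<eta> m \<le> x $ 1 \<or> x $ 2 \<le> 1/4 \<or> 3/4 \<le> x $ 2"
      by (auto simp: mem_box_cart forall_2 not_le)
    then show "\<psi> m x = 0" using \<alpha>_zero strip_bump_eq_0 by (auto simp: \<psi>_def)
  qed simp
  obtain \<beta>' where \<beta>': "\<And>t. (strip_bump has_real_derivative \<beta>' t) (at t)"
    using Ck_real_strip_bump[of 1] by auto
  have pd: "partial_deriv 1 (\<psi> m) x = \<alpha>' m (x $ 1) * strip_bump (x $ 2)" for m x
    unfolding \<psi>_def by (rule partial_deriv_tensor[OF \<alpha>_deriv \<beta>'])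
  have weak: "(LINT x:unit_square|lebesgue. f x $ 1 * (\<alpha>' m (x $ 1) * strip_bump (x $ 2))) =
      - (LINT x:unit_square|lebesgue. G x * \<psi> m x)" for m
  proof -
    have "\<forall>k. Ck_on k unit_square (\<psi> m)"
      unfolding \<psi>_def by (intro allI Ck_on_tensor Ck_\<alpha> Ck_real_strip_bump)
    then show ?thesis using G(2) supp[of m] unfolding weak_partial_deriv_def pd[symmetric] by blast
  qed
  note mean_cont = continuous_on_strip_mean[OF f]
  have mean_bound: "\<bar>strip_mean f s\<bar> \<le> C" if "s \<in> {0<..<1}" for s
    using that C by (intro strip_mean_bounded f) auto
  have ker_cont: "continuous_on S (\<lambda>s. mollifier ((s - c) / \<eta> m) / \<eta> m)" for S c m
    using \<eta>0[of m] by (intro continuous_intros continuous_on_compose2[OF continuous_on_mollifier[of UNIV]]) auto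
  have left: "(LINT x:unit_square|lebesgue. f x $ 1 * (\<alpha>' m (x $ 1) * strip_bump (x $ 2))) =
      (LINT s:{0<..<1}|lborel. mollifier ((s - a) / \<eta> m) / \<eta> m * strip_mean f s) -
      (LINT s:{0<..<1}|lborel. mollifier ((s - b) / \<eta> m) / \<eta> m * strip_mean f s)" for m
  proof -
    have ac: "continuous_on S (\<alpha>' m)" for S
      unfolding \<alpha>'_def by (intro continuous_on_diff ker_cont)
    obtain A where A: "0 < A" "\<And>s. 0 \<le> s \<Longrightarrow> s \<le> 1 \<Longrightarrow> \<bar>\<alpha>' m s\<bar> \<le> A"
      using continuous_unit_interval_bounded[OF ac] by blast
    have "(LINT x:unit_square|lebesgue. f x $ 1 * (\<alpha>' m (x $ 1) * strip_bump (x $ 2))) =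
        (LINT s:{0<..<1}|lborel. LINT t:{0<..<1}|lborel. f (vec2 s t) $ 1 * (\<alpha>' m s * strip_bump t))"
    proof (subst Fubini_unit_square)
      show "continuous_on unit_square (\<lambda>x. f x $ 1 * (\<alpha>' m (x $ 1) * strip_bump (x $ 2)))"
        using f(1) by (intro continuous_intros continuous_on_compose2[OF ac[of UNIV]]
          continuous_on_compose2[OF continuous_on_strip_bump[of UNIV]]) (auto simp: square_map_def)
      fix x assume x: "x \<in> unit_square"
      then have "\<bar>\<alpha>' m (x $ 1)\<bar> \<le> A" using A by (auto simp: unit_square_def less_imp_le)
      then show "\<bar>f x $ 1 * (\<alpha>' m (x $ 1) * strip_bump (x $ 2))\<bar> \<le> 1 * (A * C)"
        unfolding abs_mult using square_map_bound[OF f(1) x] A(1) C strip_bump_nonneg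
        by (intro mult_mono) auto
    qed simp
    also have "\<dots> = (LINT s:{0<..<1}|lborel. \<alpha>' m s * strip_mean f s)"
      by (simp add: strip_mean_def mult.left_commute)
    also have "\<dots> = (LINT s:{0<..<1}|lborel. mollifier ((s - a) / \<eta> m) / \<eta> m * strip_mean f s -
        mollifier ((s - b) / \<eta> m) / \<eta> m * strip_mean f s)"
      by (simp add: \<alpha>'_def left_diff_distrib)
    also have "\<dots> = (LINT s:{0<..<1}|lborel. mollifier ((s - a) / \<eta> m) / \<eta> m * strip_mean f s) -
        (LINT s:{0<..<1}|lborel. mollifier ((s - b) / \<eta> m) / \<eta> m * strip_mean f s)"
    proof (rule set_integral_diff(2))
      have "set_integrable lborel {0<..<1} (\<lambda>s. mollifier ((s - c) / \<eta> m) / \<eta> m * strip_mean f s)" for c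
      proof -
        obtain K where K: "0 < K" "\<And>s. 0 \<le> s \<Longrightarrow> s \<le> 1 \<Longrightarrow> \<bar>mollifier ((s - c) / \<eta> m) / \<eta> m\<bar> \<le> K"
          using continuous_unit_interval_bounded[OF ker_cont] by blast
        show ?thesis
        proof (rule set_integrable_continuous_bounded)
          show "\<bar>mollifier ((s - c) / \<eta> m) / \<eta> m * strip_mean f s\<bar> \<le> K * C" if "s \<in> {0<..<1}" for s
            unfolding abs_mult[of _ "strip_mean f s"] using K mean_bound[OF that] that by (intro mult_mono) auto
          show "continuous_on {0<..<1} (\<lambda>s. mollifier ((s - c) / \<eta> m) / \<eta> m * strip_mean f s)"
            by (intro continuous_on_mult ker_cont mean_cont)
        qed auto
      qed
      then show "set_integrable lborel {0<..<1} (\<lambda>s. mollifier ((s - a) / \<eta> m) / \<eta> m * strip_mean f s)"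
        "set_integrable lborel {0<..<1} (\<lambda>s. mollifier ((s - b) / \<eta> m) / \<eta> m * strip_mean f s)" by blast+
    qed
    finally show ?thesis .
  qed
  \<comment> \<open>The mean at \<open>a\<close> comes first since the approximate indicator rises
    at \<open>a\<close>; the minus sign of the weak derivative reverses the order at the
    end.\<close>
  have lim1: "(\<lambda>m. - (LINT x:unit_square|lebesgue. G x * \<psi> m x)) \<longlonglongrightarrow> strip_mean f a - strip_mean f b"
    unfolding weak[symmetric] left using ab \<eta>0 \<eta>1 \<eta>lim mean_cont mean_bound
    by (intro tendsto_diff mollifier_approximates) auto
  have lim2: "(\<lambda>m. LINT x:unit_square|lebesgue. G x * \<psi> m x) \<longlonglongrightarrow>
      (LINT x:unit_square|lebesgue. G x * (indicator {a<..b} (x $ 1) * strip_bump (x $ 2)))"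
    unfolding set_lebesgue_integral_def
  proof (rule integral_dominated_convergence)
    have \<psi>m: "\<psi> m \<in> borel_measurable borel" for m
      unfolding \<psi>_def by (intro borel_measurable_continuous_onI continuous_intros
        continuous_on_compose2[OF Ck_real_continuous[OF Ck_\<alpha>[of 0 m]]]
        continuous_on_compose2[OF continuous_on_strip_bump[of UNIV]]) auto
    have \<psi>b: "\<bar>\<psi> m x\<bar> \<le> C" for m x
    proof -
      have "\<bar>\<psi> m x\<bar> \<le> 1 * C"
        unfolding \<psi>_def abs_mult using \<alpha>_bounds C strip_bump_nonneg by (intro mult_mono) auto
      then show ?thesis by simp
    qed
    show "integrable lebesgue (\<lambda>x. C * \<bar>indicator unit_square x *\<^sub>R G x\<bar>)"
      using G(1) by (auto simp: set_integrable_def)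
    show "(\<lambda>x. indicator unit_square x *\<^sub>R (G x * \<psi> m x)) \<in> borel_measurable lebesgue" for m
      using integrable_times_bounded_continuous[OF G(1) \<psi>m \<psi>b] by (auto simp: set_integrable_def)
    have "\<bar>indicator {a<..b} s * strip_bump t\<bar> \<le> C" for s t
      using C strip_bump_nonneg[of t] by (auto simp: indicator_def)
    then show "(\<lambda>x. indicator unit_square x *\<^sub>R (G x * (indicator {a<..b} (x $ 1) * strip_bump (x $ 2)))) \<in> borel_measurable lebesgue"
      using integrable_times_bounded_continuous[OF G(1) borel_measurable_strip_weight] by (fastforce simp: set_integrable_def)
    show "AE x in lebesgue. (\<lambda>m. indicator unit_square x *\<^sub>R (G x * \<psi> m x)) \<longlonglongrightarrow>
        indicator unit_square x *\<^sub>R (G x * (indicator {a<..b} (x $ 1) * strip_bump (x $ 2)))"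
    proof (rule AE_I2)
      fix x :: "real^2"
      let ?s = "x $ 1"
      have small: "\<forall>\<^sub>F m in sequentially. \<eta> m < d" if "0 < d" for d
        using \<eta>lim that by (rule order_tendstoD)
      \<comment> \<open>Both transitions lie to the right of their base points: the value at
        \<open>a\<close> is always 0 and the value at \<open>b\<close> is eventually 1. Hence the
        limit is the half-open interval.\<close>
      have "\<forall>\<^sub>F m in sequentially. \<alpha> m ?s = indicator {a<..b} ?s"
      proof (cases "a < ?s \<and> ?s \<le> b")
        case True
        have "\<alpha> m ?s = 1" if "\<eta> m < ?s - a" for m
          using True that \<eta>0[of m] by (simp add: \<alpha>_def smooth_step_eq_0 smooth_step_eq_1 divide_nonpos_pos pos_le_divide_eq)
        then show ?thesis using small[of "?s - a"] True by (auto elim!: eventually_mono)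
      next
        case False
        then consider "?s \<le> a" | "b < ?s" by linarith
        then show ?thesis
        proof cases
          case 1
          then show ?thesis using \<alpha>_zero by auto
        next
          case 2
          then show ?thesis using small[of "?s - b"] \<alpha>_zero
            by (auto elim!: eventually_mono simp: indicator_def)
        qed
      qed
      then have "(\<lambda>m. \<alpha> m ?s) \<longlonglongrightarrow> indicator {a<..b} ?s" by (rule tendsto_eventually)
      then show "(\<lambda>m. indicator unit_square x *\<^sub>R (G x * \<psi> m x)) \<longlonglongrightarrow>
          indicator unit_square x *\<^sub>R (G x * (indicator {a<..b} ?s * strip_bump (x $ 2)))"
        unfolding \<psi>_def by (intro tendsto_intros)
    qed
    show "AE x in lebesgue. norm (indicator unit_square x *\<^sub>R (G x * \<psi> m x)) \<le> C * \<bar>indicator unit_square x *\<^sub>R G x\<bar>" for m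
    proof (rule AE_I2)
      fix x
      show "norm (indicator unit_square x *\<^sub>R (G x * \<psi> m x)) \<le> C * \<bar>indicator unit_square x *\<^sub>R G x\<bar>"
        using mult_right_mono[OF \<psi>b[of m x], of "\<bar>G x\<bar>"] by (auto simp: indicator_def abs_mult mult.commute)
    qed
  qed
  show ?thesis using LIMSEQ_unique[OF lim1 tendsto_minus[OF lim2]] by simp
qed

text \<open>Truncate at a height \<open>n\<close> above which little mass remains; on a set of
  measure at most \<open>d\<close> the truncated part contributes no more than n d.\<close>

lemma absolutely_continuous_integral:
  fixes G :: "real^2 \<Rightarrow> real"
  assumes G: "integrable lebesgue G" and e: "0 < e"
  obtains d where "0 < d" "\<And>A. A \<in> sets lebesgue \<Longrightarrow> emeasure lebesgue A \<le> ennreal d \<Longrightarrow>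
    (LINT x|lebesgue. \<bar>G x\<bar> * indicator A x) < e"
proof -
  have "(\<lambda>n. LINT x|lebesgue. \<bar>G x\<bar> - min \<bar>G x\<bar> (real n)) \<longlonglongrightarrow> (LINT (x::real^2)|lebesgue. 0)"
  proof (rule integral_dominated_convergence[where w="\<lambda>x. \<bar>G x\<bar>"])
    show "AE x in lebesgue. (\<lambda>n. \<bar>G x\<bar> - min \<bar>G x\<bar> (real n)) \<longlonglongrightarrow> 0"
    proof (rule AE_I2)
      fix x
      obtain N where N: "\<bar>G x\<bar> \<le> real N" using real_arch_simple by blast
      have "\<forall>\<^sub>F n in sequentially. \<bar>G x\<bar> - min \<bar>G x\<bar> (real n) = 0"
        unfolding eventually_sequentially
        by (intro exI[of _ N] allI impI) (use N in \<open>auto simp: min_def\<close>)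
      then show "(\<lambda>n. \<bar>G x\<bar> - min \<bar>G x\<bar> (real n)) \<longlonglongrightarrow> 0" by (rule tendsto_eventually)
    qed
  qed (use G in auto)
  then have "\<forall>\<^sub>F n in sequentially. (LINT x|lebesgue. \<bar>G x\<bar> - min \<bar>G x\<bar> (real n)) < e / 2"
    by (rule order_tendstoD) (use e in auto)
  then obtain n where n: "(LINT x|lebesgue. \<bar>G x\<bar> - min \<bar>G x\<bar> (real n)) < e / 2"
    by (auto simp: eventually_sequentially)
  \<comment> \<open>The summand 1 avoids division by zero and makes n d strictly smaller than e /
    2.\<close>
  define d where "d = e / (2 * (real n + 1))"
  have d: "0 < d" "real n * d < e / 2"
    using e by (auto simp: d_def field_simps)
  have gi: "integrable lebesgue (\<lambda>x. \<bar>G x\<bar> - min \<bar>G x\<bar> (real n))"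
    by (rule Bochner_Integration.integrable_bound[OF G]) (use G in auto)
  have "(LINT x|lebesgue. \<bar>G x\<bar> * indicator A x) < e"
    if A: "A \<in> sets lebesgue" "emeasure lebesgue A \<le> ennreal d" for A
  proof -
    have fin: "emeasure lebesgue A < \<infinity>" using A(2) by (auto intro: le_less_trans)
    have Ai: "integrable lebesgue (\<lambda>x. real n * indicator A x)"
      using A(1) fin by (intro integrable_mult_right integrable_real_indicator)
    have "(LINT x|lebesgue. \<bar>G x\<bar> * indicator A x) \<le>
        (LINT x|lebesgue. (\<bar>G x\<bar> - min \<bar>G x\<bar> (real n)) + real n * indicator A x)"
    proof (rule integral_mono)
      show "integrable lebesgue (\<lambda>x. \<bar>G x\<bar> * indicator A x)"
        using G A(1) by (intro integrable_real_mult_indicator) auto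
      show "integrable lebesgue (\<lambda>x. (\<bar>G x\<bar> - min \<bar>G x\<bar> (real n)) + real n * indicator A x)"
        by (intro Bochner_Integration.integrable_add gi Ai)
    qed (auto simp: indicator_def)
    also have "\<dots> = (LINT x|lebesgue. \<bar>G x\<bar> - min \<bar>G x\<bar> (real n)) + real n * measure lebesgue A"
      using Bochner_Integration.integral_add[OF gi Ai] A(1) fin by simp
    also have "real n * measure lebesgue A \<le> real n * d"
      using A(2) d(1) by (intro mult_left_mono) (auto simp: measure_def enn2real_leI)
    finally show ?thesis using n d(2) by linarith
  qed
  then show thesis using that d(1) by blast
qed

section \<open>Maps with concentrated horizontal increments\<close>

text \<open>The share 1/8 does not depend on \<open>k\<close>, only the permitted total length
  shrinks. Strict inequality for the increments makes the condition open, finitely many intervals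
  keep it stable, and their half-open form matches \<open>Sobolev_increment\<close>.\<close>

definition concentrated :: "nat \<Rightarrow> (real^2 \<Rightarrow> real^2) \<Rightarrow> bool" where
  "concentrated k f \<longleftrightarrow> (\<exists>(N::nat) l u. (\<forall>i<N. 0 < l i \<and> l i < u i \<and> u i < 1) \<and>
     disjoint_family_on (\<lambda>i. {l i<..u i}) {..<N} \<and> (\<Sum>i<N. u i - l i) < 1 / (real k + 1) \<and>
     strip_mass / 8 < (\<Sum>i<N. strip_mean f (u i) - strip_mean f (l i)))"

lemma emeasure_vertical_strip:
  assumes "0 < l" "l < u" "u < 1"
  shows "{x \<in> unit_square. x $ 1 \<in> {l<..u}} \<in> sets lebesgue"
    and "emeasure lebesgue {x \<in> unit_square. x $ 1 \<in> {l<..u}} \<le> ennreal (u - l)"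
proof -
  have "(\<lambda>x::real^2. x $ 1) \<in> borel_measurable borel"
    by (intro borel_measurable_continuous_onI continuous_intros)
  then have "(\<lambda>x::real^2. x $ 1) -` {l<..u} \<inter> space borel \<in> sets borel" by (rule measurable_sets) simp
  then have "unit_square \<inter> (\<lambda>x::real^2. x $ 1) -` {l<..u} \<in> sets borel"
    by (intro sets.Int) auto
  then have *: "{x \<in> unit_square. x $ 1 \<in> {l<..u}} \<in> sets borel" by (simp add: Int_def vimage_def conj_commute)
  then show "{x \<in> unit_square. x $ 1 \<in> {l<..u}} \<in> sets lebesgue" by simp
  have "emeasure lebesgue {x \<in> unit_square. x $ 1 \<in> {l<..u}} = emeasure lborel {x \<in> unit_square. x $ 1 \<in> {l<..u}}"
    using * by simp
  also have "\<dots> \<le> emeasure lborel (cbox (vec2 l 0) (vec2 u 1))"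
    by (intro emeasure_mono) (auto simp: mem_box_cart forall_2 unit_square_def less_imp_le)
  also have "\<dots> = ennreal (u - l)"
    using assms by (subst emeasure_lborel_cbox)
      (auto simp: Basis_vec_def UNIV_2 axis_eq_axis inner_axis)
  finally show "emeasure lebesgue {x \<in> unit_square. x $ 1 \<in> {l<..u}} \<le> ennreal (u - l)" .
qed

text \<open>The sum of increments is at most a bound for \<open>strip_bump\<close> times the
  integral of the modulus of the weak derivative over the strips. Their measure is the total length,
  so absolute continuity of the integral pushes this below the fixed share.\<close>

lemma Sobolev_not_concentrated:
  assumes f: "square_map f" "uniformly_continuous_on unit_square f" and W: "f \<in> W11 unit_square"
  obtains k where "\<not> concentrated k f"
proof -
  obtain C where C: "0 < C" "\<And>t. strip_bump t \<le> C" using strip_bump_bounded by blast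
  obtain G where G: "set_integrable lebesgue unit_square G" "weak_partial_deriv unit_square 1 (\<lambda>x. f x $ 1) G"
    using W by (auto simp: W11_def)
  let ?G = "\<lambda>x. indicator unit_square x * G x"
  have Gi: "integrable lebesgue ?G" using G(1) by (simp add: set_integrable_def)
  have "0 < strip_mass / (8 * C)" using strip_mass_pos C by simp
  then obtain d where d: "0 < d" "\<And>A. A \<in> sets lebesgue \<Longrightarrow> emeasure lebesgue A \<le> ennreal d \<Longrightarrow>
      (LINT x|lebesgue. \<bar>?G x\<bar> * indicator A x) < strip_mass / (8 * C)"
    using absolutely_continuous_integral[OF Gi] by blast
  obtain k where k: "1 / (real k + 1) < d"
    using d(1) reals_Archimedean[of d] by (auto simp: inverse_eq_divide add.commute)
  have "\<not> concentrated k f"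
  proof
    assume "concentrated k f"
    then obtain N :: nat and l u where lu: "\<And>i. i < N \<Longrightarrow> 0 < l i \<and> l i < u i \<and> u i < 1"
      and disj: "disjoint_family_on (\<lambda>i. {l i<..u i}) {..<N}"
      and len: "(\<Sum>i<N. u i - l i) < 1 / (real k + 1)"
      and inc: "strip_mass / 8 < (\<Sum>i<N. strip_mean f (u i) - strip_mean f (l i))"
      unfolding concentrated_def by blast
    define A where "A i = {x \<in> unit_square. x $ 1 \<in> {l i<..u i}}" for i
    define B where "B = (\<Union>i<N. A i)"
    have Am: "A i \<in> sets lebesgue" "emeasure lebesgue (A i) \<le> ennreal (u i - l i)" if "i < N" for i
      using emeasure_vertical_strip[of "l i" "u i"] lu[OF that] by (auto simp: A_def)
    have Bm: "B \<in> sets lebesgue" using Am(1) by (auto simp: B_def)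
    have "emeasure lebesgue B \<le> (\<Sum>i<N. emeasure lebesgue (A i))"
      unfolding B_def using Am(1) by (intro emeasure_subadditive_finite) auto
    also have "\<dots> \<le> (\<Sum>i<N. ennreal (u i - l i))" using Am(2) by (intro sum_mono) auto
    also have "\<dots> = ennreal (\<Sum>i<N. u i - l i)" using lu by (intro sum_ennreal) (auto simp: less_imp_le)
    also have "\<dots> \<le> ennreal d" using len k by (intro ennreal_leI) auto
    finally have Bd: "emeasure lebesgue B \<le> ennreal d" .
    have term_integrable: "integrable lebesgue (\<lambda>x. ?G x * (indicator {l i<..u i} (x $ 1) * strip_bump (x $ 2)))"
      if "i < N" for i
    proof -
      have b: "(\<lambda>x::real^2. indicator {l i<..u i} (x $ 1) * strip_bump (x $ 2)) \<in> borel_measurable borel"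
        using borel_measurable_strip_weight .
      have "\<bar>indicator {l i<..u i} (x $ 1) * strip_bump (x $ 2)\<bar> \<le> C" for x :: "real^2"
        using C strip_bump_nonneg[of "x $ 2"] by (auto simp: indicator_def)
      from integrable_times_bounded_continuous[OF G(1) b this] show ?thesis
        by (simp add: set_integrable_def mult.assoc)
    qed
    have "(\<Sum>i<N. strip_mean f (u i) - strip_mean f (l i)) =
        (\<Sum>i<N. LINT x|lebesgue. ?G x * (indicator {l i<..u i} (x $ 1) * strip_bump (x $ 2)))"
      using lu by (intro sum.cong refl)
        (simp add: Sobolev_increment[OF f G] set_lebesgue_integral_def mult.assoc)
    also have "\<dots> = (LINT x|lebesgue. (\<Sum>i<N. ?G x * (indicator {l i<..u i} (x $ 1) * strip_bump (x $ 2))))"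
      using term_integrable by (intro Bochner_Integration.integral_sum[symmetric]) auto
    also have "\<dots> \<le> (LINT x|lebesgue. C * (\<bar>?G x\<bar> * indicator B x))"
    proof (rule integral_mono)
      show "integrable lebesgue (\<lambda>x. \<Sum>i<N. ?G x * (indicator {l i<..u i} (x $ 1) * strip_bump (x $ 2)))"
        using term_integrable by (intro Bochner_Integration.integrable_sum) auto
      show "integrable lebesgue (\<lambda>x. C * (\<bar>?G x\<bar> * indicator B x))"
        using Gi Bm by (intro integrable_mult_right integrable_real_mult_indicator integrable_abs)
      fix x :: "real^2"
      \<comment> \<open>Disjointness keeps the sum of the indicators at most 1, so nothing in the
        integral over \<open>B\<close> is counted twice.\<close>
      have ind: "(\<Sum>i<N. indicator {l i<..u i} (x $ 1)) = (indicator (\<Union>i<N. {l i<..u i}) (x $ 1) :: real)"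
        by (rule indicator_UN_disjoint[OF finite_lessThan disj, symmetric])
      have "(\<Sum>i<N. ?G x * (indicator {l i<..u i} (x $ 1) * strip_bump (x $ 2))) =
          ?G x * strip_bump (x $ 2) * (indicator (\<Union>i<N. {l i<..u i}) (x $ 1))"
        unfolding ind[symmetric] by (simp add: sum_distrib_left mult_ac)
      also have "\<dots> \<le> C * (\<bar>?G x\<bar> * indicator B x)"
      proof (cases "x \<in> B")
        case True
        then have "?G x * strip_bump (x $ 2) \<le> \<bar>?G x\<bar> * C"
          using C strip_bump_nonneg by (intro mult_mono) auto
        then show ?thesis using True by (auto simp: indicator_def B_def A_def mult.commute)
      next
        case False
        then show ?thesis by (auto simp: indicator_def B_def A_def)
      qed
      finally show "(\<Sum>i<N. ?G x * (indicator {l i<..u i} (x $ 1) * strip_bump (x $ 2))) \<le> C * (\<bar>?G x\<bar> * indicator B x)" .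
    qed
    also have "\<dots> = C * (LINT x|lebesgue. \<bar>?G x\<bar> * indicator B x)" by simp
    also have "\<dots> < C * (strip_mass / (8 * C))"
      using d(2)[OF Bm Bd] C(1) by (intro mult_strict_left_mono)
    also have "\<dots> = strip_mass / 8" using C(1) by simp
    finally show False using inc by simp
  qed
  then show thesis using that by blast
qed

text \<open>Each interval is [i + \<theta>, i + \<theta> + 1/2] / n with \<open>\<rho>\<close> / n
  cut off at both ends. The offset 1/4 belongs to the shear with the plus sign, 3/4 to the other;
  the bound on \<open>real N + \<theta>\<close> keeps the last right endpoint below 1.\<close>

lemma concentratedI:
  assumes n: "0 < n" and N: "real N + \<theta> - 1/2 \<le> real n" and \<rho>: "0 < \<rho>" "\<rho> < 1/4" and \<theta>: "0 \<le> \<theta>" and Nn: "N \<le> n"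
    and k: "1/2 - 2 * \<rho> < 1 / (real k + 1)"
    and inc: "strip_mass / 8 < (\<Sum>i<N. strip_mean f ((real i + \<theta> + 1/2 - \<rho>) / real n) - strip_mean f ((real i + \<theta> + \<rho>) / real n))"
  shows "concentrated k f"
  unfolding concentrated_def
proof (intro exI conjI allI impI)
  let ?l = "\<lambda>i. (real i + \<theta> + \<rho>) / real n" and ?u = "\<lambda>i. (real i + \<theta> + 1/2 - \<rho>) / real n"
  fix i assume i: "i < N"
  show "0 < ?l i" using n \<rho> \<theta> by simp
  show "?l i < ?u i" using n \<rho> by (intro divide_strict_right_mono) auto
  have "real i + 1 \<le> real N" using i by linarith
  then show "?u i < 1" using n N \<rho> by (simp add: divide_less_eq)
next
  let ?l = "\<lambda>i. (real i + \<theta> + \<rho>) / real n" and ?u = "\<lambda>i. (real i + \<theta> + 1/2 - \<rho>) / real n"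
  have "{?l i<..?u i} \<inter> {?l j<..?u j} = {}" if "i < j" for i j
  proof -
    have "real i + 1 \<le> real j" using that by linarith
    then have "?u i \<le> ?l j" using n \<rho> by (intro divide_right_mono) auto
    then show ?thesis by auto
  qed
  then show "disjoint_family_on (\<lambda>i. {?l i<..?u i}) {..<N}"
    unfolding disjoint_family_on_def by (metis Int_commute linorder_neqE_nat)
  have "(\<Sum>i<N. ?u i - ?l i) = (\<Sum>i<N. (1/2 - 2 * \<rho>) / real n)"
    by (intro sum.cong refl) (simp add: diff_divide_distrib[symmetric])
  also have "\<dots> = real N / real n * (1/2 - 2 * \<rho>)" by simp
  also have "\<dots> \<le> 1 * (1/2 - 2 * \<rho>)" using Nn n \<rho> by (intro mult_right_mono) auto
  finally show "(\<Sum>i<N. ?u i - ?l i) < 1 / (real k + 1)" using k by simp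
qed (rule inc)

section \<open>Closeness in the metric, openness and boundary values\<close>

lemma sup_norm_le:
  assumes "\<And>x. x \<in> unit_square \<Longrightarrow> norm (u x) \<le> e"
  shows "sup_norm u \<le> e"
proof -
  have "bdd_above ((\<lambda>x. norm (u x)) ` unit_square)" using assms by (intro bdd_aboveI2)
  then show ?thesis using assms unit_square_nonempty by (auto simp: sup_norm_eq intro: cSUP_least)
qed

lemma BV_homeos_square_map: "f \<in> BV_homeos M \<Longrightarrow> square_map f"
  by (auto simp: BV_homeos_def square_homeos_def square_map_def homeomorphism_def)

lemma norm_diff_le_dX:
  assumes "f \<in> BV_homeos M" "g \<in> BV_homeos M" "x \<in> unit_square"
  shows "norm (f x - g x) \<le> dX M f g"
proof -
  have b: "bdd_above ((\<lambda>x. norm (f x - g x)) ` unit_square)"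
    using assms BV_homeos_square_map by (intro bdd_above_norm_diff) (auto simp: square_map_def)
  have "norm (f x - g x) \<le> sup_norm (\<lambda>x. f x - g x)"
    unfolding sup_norm_eq[OF b] by (rule cSUP_upper[OF assms(3) b])
  then show ?thesis using sup_norm_nonneg[of "\<lambda>y. inv_into unit_square f y - inv_into unit_square g y"]
    unfolding dX_def by linarith
qed

text \<open>The intervals chosen for \<open>f\<close> also work for nearby maps: only finitely many
  means change, each by at most a multiple of the uniform distance.\<close>

lemma concentrated_open:
  assumes "f \<in> BV_homeos M" "concentrated k f"
  obtains r where "0 < r" "\<And>g. g \<in> BV_homeos M \<Longrightarrow> dX M f g < r \<Longrightarrow> concentrated k g"
proof -
  obtain C where C: "0 < C" "\<And>t. strip_bump t \<le> C" using strip_bump_bounded by blast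
  obtain N :: nat and l u where lu: "\<And>i. i < N \<Longrightarrow> 0 < l i \<and> l i < u i \<and> u i < 1"
    and disj: "disjoint_family_on (\<lambda>i. {l i<..u i}) {..<N}"
    and len: "(\<Sum>i<N. u i - l i) < 1 / (real k + 1)"
    and inc: "strip_mass / 8 < (\<Sum>i<N. strip_mean f (u i) - strip_mean f (l i))"
    using assms(2) unfolding concentrated_def by blast
  define gap where "gap = (\<Sum>i<N. strip_mean f (u i) - strip_mean f (l i)) - strip_mass / 8"
  \<comment> \<open>There are 2 N means, each changing by at most r C, and 2 N r C is smaller than
    \<open>gap\<close>.\<close>
  define r where "r = gap / (2 * C * (real N + 1))"
  have gap: "0 < gap" using inc by (simp add: gap_def)
  then have r: "0 < r" using C by (simp add: r_def)
  have "concentrated k g" if g: "g \<in> BV_homeos M" and d: "dX M f g < r" for g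
  proof -
    have close: "\<bar>strip_mean f s - strip_mean g s\<bar> \<le> r * C" if "0 < s" "s < 1" for s
    proof (rule strip_mean_close[OF C(2)])
      fix t :: real assume "t \<in> {0<..<1}"
      then have "vec2 s t \<in> unit_square" using that by (simp add: vec2_in_unit_square)
      from norm_diff_le_dX[OF assms(1) g this] show "norm (f (vec2 s t) - g (vec2 s t)) \<le> r" using d by simp
    qed (use that assms(1) g BV_homeos_square_map in auto)
    have "(\<Sum>i<N. strip_mean f (u i) - strip_mean f (l i)) - (\<Sum>i<N. strip_mean g (u i) - strip_mean g (l i)) =
        (\<Sum>i<N. (strip_mean f (u i) - strip_mean g (u i)) - (strip_mean f (l i) - strip_mean g (l i)))"
      by (simp add: sum_subtractf[symmetric] algebra_simps)
    also have "\<dots> \<le> (\<Sum>i<N. 2 * r * C)"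
    proof (rule sum_mono)
      fix i assume "i \<in> {..<N}"
      then have "\<bar>strip_mean f (u i) - strip_mean g (u i)\<bar> \<le> r * C" "\<bar>strip_mean f (l i) - strip_mean g (l i)\<bar> \<le> r * C"
        using lu[of i] by (auto intro!: close)
      then show "(strip_mean f (u i) - strip_mean g (u i)) - (strip_mean f (l i) - strip_mean g (l i)) \<le> 2 * r * C"
        by linarith
    qed
    also have "\<dots> = gap * (real N / (real N + 1))" using C(1) by (simp add: r_def)
    also have "\<dots> < gap * 1" using gap by (intro mult_strict_left_mono) auto
    finally have "strip_mass / 8 < (\<Sum>i<N. strip_mean g (u i) - strip_mean g (l i))" by (simp add: gap_def)
    then show ?thesis unfolding concentrated_def using lu disj len by blast
  qed
  then show thesis using that r by blast
qed

lemma BV_homeos_extension: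
  assumes "f \<in> BV_homeos M"
  shows "\<exists>F. continuous_on (cbox 0 1) F \<and> (\<forall>x\<in>unit_square. F x = f x) \<and>
    (\<forall>x\<in>cbox 0 1 - unit_square. F x = x)"
  using assms unfolding BV_homeos_def identity_on_boundary_def closure_unit_square frontier_unit_square by blast

lemma BV_homeos_uniformly_continuous:
  assumes "f \<in> BV_homeos M" shows "uniformly_continuous_on unit_square f"
proof -
  obtain F where F: "continuous_on (cbox 0 1) F" "\<And>x. x \<in> unit_square \<Longrightarrow> F x = f x"
    "\<And>x. x \<in> cbox 0 1 - unit_square \<Longrightarrow> F x = x"
    using BV_homeos_extension[OF assms] by blast
  have "uniformly_continuous_on (cbox 0 1) F" using F(1) by (rule compact_uniformly_continuous) (rule compact_cbox)
  moreover have "unit_square \<subseteq> cbox 0 (1::real^2)" by (simp add: unit_square_eq_box box_subset_cbox)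
  ultimately have "uniformly_continuous_on unit_square F"
    unfolding uniformly_continuous_on_def by (meson subsetD)
  then show ?thesis using F(2) by (simp add: uniformly_continuous_on_def)
qed

text \<open>The extension by the identity is uniformly continuous on the closed square, so near a
  vertical side the first coordinate differs from its boundary value 0 or 1 by at most 1/4.\<close>

lemma strip_mean_boundary:
  assumes f: "f \<in> BV_homeos M"
  obtains d where "0 < d" "\<And>s. 0 < s \<Longrightarrow> s < 1 \<Longrightarrow> s < d \<Longrightarrow> strip_mean f s \<le> strip_mass / 4"
    "\<And>s. 0 < s \<Longrightarrow> s < 1 \<Longrightarrow> 1 - d < s \<Longrightarrow> 3 / 4 * strip_mass \<le> strip_mean f s"
proof -
  obtain F where F: "continuous_on (cbox 0 1) F" "\<And>x. x \<in> unit_square \<Longrightarrow> F x = f x"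
    "\<And>x. x \<in> cbox 0 1 - unit_square \<Longrightarrow> F x = x"
    using BV_homeos_extension[OF f] by blast
  have "uniformly_continuous_on (cbox 0 1) F" using F(1) by (rule compact_uniformly_continuous) (rule compact_cbox)
  then obtain d where d: "0 < d" "\<And>x y. x \<in> cbox 0 1 \<Longrightarrow> y \<in> cbox 0 1 \<Longrightarrow> dist y x < d \<Longrightarrow> dist (F y) (F x) < 1/4"
    unfolding uniformly_continuous_on_def by (metis zero_less_divide_1_iff zero_less_numeral)
  have key: "\<bar>f (vec2 s t) $ 1 - e\<bar> \<le> 1/4"
    if "0 < s" "s < 1" "t \<in> {0<..<1}" "\<bar>s - e\<bar> < d" "e = 0 \<or> e = 1" for s t e
  proof -
    have m: "vec2 s t \<in> unit_square" "vec2 s t \<in> cbox 0 1" "vec2 e t \<in> cbox 0 1" "vec2 e t \<notin> unit_square"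
      using that by (auto simp: mem_box_cart forall_2 unit_square_def)
    have "dist (vec2 s t) (vec2 e t) \<le> \<bar>s - e\<bar>"
      unfolding dist_norm by (rule order_trans[OF norm_le_l1_cart]) (simp add: sum_2)
    then have "dist (F (vec2 s t)) (F (vec2 e t)) < 1/4" using that m by (intro d(2)) auto
    then have "norm (f (vec2 s t) - vec2 e t) < 1/4" using F m by (simp add: dist_norm)
    then show ?thesis using component_le_norm_cart[of "f (vec2 s t) - vec2 e t" 1] by simp
  qed
  have mi: "set_integrable lborel {0<..<1} (\<lambda>t. a * strip_bump t)" for a
    using set_integrable_strip_bump by (intro set_integrable_mult_right) auto
  have mass: "a * strip_mass = (LINT t:{0<..<1}|lborel. a * strip_bump t)" for a
    by (simp add: strip_mass_eq)
  note fi = set_integrable_strip_mean[OF BV_homeos_square_map[OF f]]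
  show thesis
  proof
    show "0 < d" by fact
    fix s :: real assume s: "0 < s" "s < 1"
    show "strip_mean f s \<le> strip_mass / 4" if "s < d"
    proof -
      have "f (vec2 s t) $ 1 \<le> 1/4" if "t \<in> {0<..<1}" for t
      proof -
        have "\<bar>f (vec2 s t) $ 1 - 0\<bar> \<le> 1/4" using s \<open>s < d\<close> by (intro key[OF s that]) auto
        then show ?thesis by linarith
      qed
      then have "strip_mean f s \<le> 1/4 * strip_mass"
        unfolding strip_mean_def mass
        by (intro set_integral_mono fi s mi mult_right_mono strip_bump_nonneg) auto
      then show ?thesis by simp
    qed
    show "3 / 4 * strip_mass \<le> strip_mean f s" if "1 - d < s"
    proof -
      have "f (vec2 s t) $ 1 \<ge> 3/4" if "t \<in> {0<..<1}" for t
      proof -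
        have "\<bar>f (vec2 s t) $ 1 - 1\<bar> \<le> 1/4" using s \<open>1 - d < s\<close> by (intro key[OF s that]) auto
        then show ?thesis by linarith
      qed
      then show ?thesis unfolding strip_mean_def mass
        by (intro set_integral_mono fi s mi mult_right_mono strip_bump_nonneg) auto
    qed
  qed
qed

section \<open>Deforming a homeomorphism by a shear\<close>

context shear
begin

text \<open>Restriction makes the composite extensional, as membership in
  \<open>square_homeos\<close> demands.\<close>

definition deform :: "(real^2 \<Rightarrow> real^2) \<Rightarrow> real^2 \<Rightarrow> real^2" where
  "deform f = restrict (\<lambda>x. f (h x)) unit_square"

lemma deform_eq: "x \<in> unit_square \<Longrightarrow> deform f x = f (h x)"
  by (simp add: deform_def)

lemma norm_h_diff:
  assumes "\<And>t. \<bar>\<tau> t\<bar> \<le> T" "x \<in> unit_square"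
  shows "norm (h x - x) \<le> T"
proof -
  have "p (h x) = x" using assms(2) unit_square_subset by (intro p_h) auto
  then show ?thesis using norm_p_diff[of "h x"] assms(1)[of "h x $ 1"] by (simp add: norm_minus_commute)
qed

text \<open>Precomposing with \<open>h\<close> means postcomposing the inverse with
  \<open>p\<close>. The inverses therefore differ by at most the displacement of the shear, whatever
  the modulus of continuity of \<open>f\<close>.\<close>

lemma inv_into_deform:
  assumes f: "inj_on f unit_square" "f ` unit_square = unit_square" and y: "y \<in> unit_square"
  shows "inv_into unit_square (deform f) y = p (inv_into unit_square f y)"
proof (rule inv_into_f_eq)
  have i: "inv_into unit_square f y \<in> unit_square" using f y by (intro inv_into_into) auto
  then show "p (inv_into unit_square f y) \<in> unit_square" using p_image by blast
  then show "deform f (p (inv_into unit_square f y)) = y"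
    using f y by (simp add: deform_eq h_p f_inv_into_f)
  show "inj_on (deform f) unit_square"
  proof (rule inj_onI)
    fix a b assume ab: "a \<in> unit_square" "b \<in> unit_square" "deform f a = deform f b"
    then have "h a = h b" using f(1) h_image by (auto simp: deform_eq dest!: inj_onD)
    then show "a = b" using p_h ab unit_square_subset by (metis subsetD)
  qed
qed

lemma deform_square_homeos:
  assumes "f \<in> square_homeos" shows "deform f \<in> square_homeos"
proof -
  obtain g where g: "homeomorphism unit_square unit_square f g"
    using assms by (auto simp: square_homeos_def)
  have "homeomorphism unit_square unit_square (deform f) (\<lambda>y. p (g y))"
  proof (rule homeomorphismI)
    have "continuous_on unit_square (\<lambda>x. f (h x))"
      by (rule continuous_on_compose2[OF homeomorphism_cont1[OF g] continuous_on_subset[OF h_cont unit_square_subset]])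
        (simp add: h_image)
    then show "continuous_on unit_square (deform f)" by (simp add: deform_eq cong: continuous_on_cong)
    show "continuous_on unit_square (\<lambda>y. p (g y))"
      by (rule continuous_on_compose2[OF p_cont[of UNIV] homeomorphism_cont2[OF g]]) simp
    show "deform f ` unit_square \<subseteq> unit_square"
      using homeomorphism_image1[OF g] h_image by (auto simp: deform_eq)
    show "(\<lambda>y. p (g y)) ` unit_square \<subseteq> unit_square"
      using homeomorphism_image2[OF g] p_image by auto
    fix x assume x: "x \<in> unit_square"
    then have "h x \<in> unit_square" using h_image by blast
    then show "p (g (deform f x)) = x"
      using x unit_square_subset by (simp add: deform_eq homeomorphism_apply1[OF g] p_h subset_iff)
    have "g x \<in> unit_square" using x homeomorphism_image2[OF g] by blast
    then have "p (g x) \<in> unit_square" using p_image by blast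
    then show "deform f (p (g x)) = x"
      using x by (simp add: deform_eq h_p homeomorphism_apply2[OF g])
  qed
  moreover have "deform f \<in> extensional unit_square" by (simp add: deform_def)
  ultimately show ?thesis by (auto simp: square_homeos_def)
qed

lemma deform_identity_on_boundary:
  assumes "identity_on_boundary f" shows "identity_on_boundary (deform f)"
proof -
  obtain F where F: "continuous_on (cbox 0 1) F" "\<And>x. x \<in> unit_square \<Longrightarrow> F x = f x"
    "\<And>x. x \<in> cbox 0 1 - unit_square \<Longrightarrow> F x = x"
    using assms unfolding identity_on_boundary_def closure_unit_square frontier_unit_square by blast
  have hc: "h ` cbox 0 1 = cbox 0 1"
  proof -
    have "h ` p ` cbox 0 1 = cbox 0 1" by (simp add: image_image h_p)
    then show ?thesis by (simp only: p_image_closed)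
  qed
  have "continuous_on (cbox 0 1) (\<lambda>x. F (h x))"
    by (rule continuous_on_compose2[OF F(1) h_cont]) (simp add: hc)
  moreover have "F (h x) = deform f x" if "x \<in> unit_square" for x
    using that h_image F(2) by (auto simp: deform_eq)
  moreover have "F (h x) = x" if "x \<in> cbox 0 1 - unit_square" for x
    using that h_fixes_boundary F(3) by simp
  ultimately show ?thesis
    unfolding identity_on_boundary_def closure_unit_square frontier_unit_square by blast
qed

lemma Var_deform: "Var (deform f) unit_square = Var (\<lambda>x. f (h x)) unit_square"
  unfolding Var_unit_square by (intro SUP_cong refl arg_cong[of _ _ ereal] pairing_cong) (auto simp: deform_eq)

lemma deform_close:
  assumes f: "f \<in> BV_homeos M" and T: "\<And>t. \<bar>\<tau> t\<bar> \<le> T" "T \<le> e"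
    and d: "\<And>x. x \<in> unit_square \<Longrightarrow> norm (f x - f (h x)) \<le> e"
    and V: "Var (deform f) unit_square < ereal M"
  shows "deform f \<in> BV_homeos M"
    and "dX M f (deform f) \<le> e + e + \<bar>1 / (M - real_of_ereal (Var f unit_square)) -
      1 / (M - real_of_ereal (Var (deform f) unit_square))\<bar>"
proof -
  show "deform f \<in> BV_homeos M"
    using f V deform_square_homeos deform_identity_on_boundary
    by (auto simp: BV_homeos_def intro: less_trans[OF V])
  have fsq: "inj_on f unit_square" "f ` unit_square = unit_square"
    using f by (auto simp: BV_homeos_def square_homeos_def homeomorphism_def intro: inj_on_inverseI)
  have "sup_norm (\<lambda>x. f x - deform f x) \<le> e"
    using d by (intro sup_norm_le) (simp add: deform_eq)
  moreover have "sup_norm (\<lambda>y. inv_into unit_square f y - inv_into unit_square (deform f) y) \<le> e"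
  proof (rule sup_norm_le)
    fix y assume y: "y \<in> unit_square"
    show "norm (inv_into unit_square f y - inv_into unit_square (deform f) y) \<le> e"
      using norm_p_diff[of "inv_into unit_square f y"] T(1)[of "inv_into unit_square f y $ 1"] T(2)
      by (simp add: inv_into_deform[OF fsq y] norm_minus_commute)
  qed
  ultimately show "dX M f (deform f) \<le> e + e + \<bar>1 / (M - real_of_ereal (Var f unit_square)) -
      1 / (M - real_of_ereal (Var (deform f) unit_square))\<bar>"
    unfolding dX_def by linarith
qed

end

text \<open>In the inequality for the sum of the two pairings, one test field is fixed whose pairing
  exceeds \<open>a\<close>; what is left bounds every pairing of the other map.\<close>

lemma (in shear_pair) Var_shear_le:
  assumes f: "square_map f" and V: "Var f unit_square \<le> ereal V"
    and \<kappa>: "\<And>y. y \<in> unit_square \<Longrightarrow> \<bar>k y\<bar> \<le> \<kappa>"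
  shows "ereal a < Var (\<lambda>x. f (neg.h x)) unit_square \<Longrightarrow> Var (\<lambda>x. f (h x)) unit_square \<le> ereal (2 * (1 + \<kappa>) * V - a)"
    and "ereal a < Var (\<lambda>x. f (h x)) unit_square \<Longrightarrow> Var (\<lambda>x. f (neg.h x)) unit_square \<le> ereal (2 * (1 + \<kappa>) * V - a)"
proof -
  assume "ereal a < Var (\<lambda>x. f (neg.h x)) unit_square"
  then obtain \<psi> where \<psi>: "var_test \<psi>" "a < pairing (\<lambda>x. f (neg.h x)) \<psi>"
    unfolding Var_unit_square by (auto simp: less_SUP_iff)
  have "pairing (\<lambda>x. f (h x)) \<phi> \<le> 2 * (1 + \<kappa>) * V - a" if "var_test \<phi>" for \<phi>
    using pairing_shear_sum[OF f V \<kappa> that \<psi>(1)] \<psi>(2) by linarith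
  then show "Var (\<lambda>x. f (h x)) unit_square \<le> ereal (2 * (1 + \<kappa>) * V - a)"
    unfolding Var_unit_square by (auto intro!: SUP_least)
next
  assume "ereal a < Var (\<lambda>x. f (h x)) unit_square"
  then obtain \<phi> where \<phi>: "var_test \<phi>" "a < pairing (\<lambda>x. f (h x)) \<phi>"
    unfolding Var_unit_square by (auto simp: less_SUP_iff)
  have "pairing (\<lambda>x. f (neg.h x)) \<psi> \<le> 2 * (1 + \<kappa>) * V - a" if "var_test \<psi>" for \<psi>
    using pairing_shear_sum[OF f V \<kappa> \<phi>(1) that] \<phi>(2) by linarith
  then show "Var (\<lambda>x. f (neg.h x)) unit_square \<le> ereal (2 * (1 + \<kappa>) * V - a)"
    unfolding Var_unit_square by (auto intro!: SUP_least)
qed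

section \<open>Density of the concentrated maps\<close>

lemma shear_uminus:
  assumes "shear \<tau> \<tau>' \<tau>'' \<eta> \<eta>' \<eta>''"
  shows "shear (\<lambda>t. - \<tau> t) (\<lambda>t. - \<tau>' t) (\<lambda>t. - \<tau>'' t) \<eta> \<eta>' \<eta>''"
proof -
  interpret shear \<tau> \<tau>' \<tau>'' \<eta> \<eta>' \<eta>'' by fact
  show ?thesis
    by unfold_locales (use \<tau>_ends \<eta>_ends \<tau>'_bound in
      \<open>auto intro!: DERIV_minus \<tau>_deriv \<tau>'_deriv \<eta>_deriv \<eta>'_deriv \<eta>''_cont \<eta>_bounds continuous_on_minus \<tau>''_cont\<close>)
qed

lemma shear_pair_wave:
  assumes c: "0 \<le> c" "c < 1" and n: "0 < n"
    and \<eta>'': "\<And>t. (cutoff' has_real_derivative \<eta>'' t) (at t)" "continuous_on UNIV \<eta>''"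
  shows "shear_pair (\<lambda>t. wave c (real n * t) / real n) (\<lambda>t. wave' c (real n * t))
    (\<lambda>t. real n * wave'' c (real n * t)) cutoff cutoff' \<eta>''"
proof -
  have d: "((\<lambda>t. real n * t) has_real_derivative real n) (at t)" for t
    by (auto intro!: derivative_eq_intros)
  have "shear (\<lambda>t. wave c (real n * t) / real n) (\<lambda>t. wave' c (real n * t))
    (\<lambda>t. real n * wave'' c (real n * t)) cutoff cutoff' \<eta>''"
  proof
    fix t
    show "((\<lambda>t. wave c (real n * t) / real n) has_real_derivative wave' c (real n * t)) (at t)"
      using DERIV_cdivide[OF DERIV_chain2[OF wave_has_derivative[OF c] d], of "real n"] n by simp
    show "((\<lambda>t. wave' c (real n * t)) has_real_derivative real n * wave'' c (real n * t)) (at t)"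
      using DERIV_chain2[OF wave'_has_derivative[OF c] d] by (simp add: mult.commute)
    show "continuous_on UNIV (\<lambda>t. real n * wave'' c (real n * t))"
      by (intro continuous_intros continuous_on_compose2[OF wave''_continuous[OF c]]) auto
    show "wave c (real n * 0) / real n = 0" "wave c (real n * 1) / real n = 0"
      using wave_values(1)[OF c, of 0] wave_values(1)[OF c, of n] by simp_all
    show "\<bar>wave' c (real n * t)\<bar> < 1" by (rule wave'_bound[OF c])
  qed (auto intro: cutoff_has_derivative \<eta>'' cutoff_bounds simp: cutoff_eq_0)
  then show ?thesis using shear_uminus by (auto simp: shear_pair_def)
qed

text \<open>The two families alternate because i + 5/4 is the left end for the index i + 1. The
  chain starts and ends with an interval of the first kind, hence one more of these.\<close>

lemma alternating_telescope:
  fixes \<phi> :: "real \<Rightarrow> real"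
  shows "(\<Sum>i<Suc m. \<phi> (real i + 3/4) - \<phi> (real i + 1/4)) + (\<Sum>i<m. \<phi> (real i + 5/4) - \<phi> (real i + 3/4)) =
    \<phi> (real m + 3/4) - \<phi> (1/4)"
proof (induction m)
  case (Suc m)
  have "real (Suc m) + 1/4 = real m + 5/4" by simp
  then have "\<phi> (real (Suc m) + 1/4) = \<phi> (real m + 5/4)" by (simp only:)
  then show ?case using Suc unfolding sum.lessThan_Suc by linarith
qed simp

lemma concentrated_dense:
  assumes f: "f \<in> BV_homeos M" and r: "0 < r"
  obtains g where "g \<in> BV_homeos M" "dX M f g < r" "concentrated j g"
proof -
  have fsq: "square_map f" by (rule BV_homeos_square_map[OF f])
  have "Var f unit_square < ereal M" using f by (simp add: BV_homeos_def)
  then obtain V where V: "Var f unit_square = ereal V" "0 \<le> V" "V < M"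
    using Var_nonneg[of f] by (cases "Var f unit_square") auto
  \<comment> \<open>Controls the third term of \<open>dX\<close>, which receives r/4; the two
    uniform distances receive r/8 each.\<close>
  have "isCont (\<lambda>t. 1 / (M - t)) V" using V(3) by (intro continuous_intros) auto
  then obtain d0 where d0: "0 < d0" "\<And>t. \<bar>t - V\<bar> < d0 \<Longrightarrow> \<bar>1 / (M - t) - 1 / (M - V)\<bar> < r / 4"
    using r unfolding continuous_at_eps_delta dist_real_def by (meson divide_pos_pos zero_less_numeral)
  \<comment> \<open>Tolerance for the variation: \<open>d0\<close> serves the third term of
    \<open>dX\<close>, and \<open>M - V\<close> keeps the deformed maps below the bound
    \<open>M\<close>.\<close>
  define \<epsilon> where "\<epsilon> = min d0 (M - V)"
  have \<epsilon>: "0 < \<epsilon>" "\<epsilon> \<le> d0" "\<epsilon> \<le> M - V" using d0(1) V(3) by (auto simp: \<epsilon>_def)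
  have "ereal (V - \<epsilon> / 4) < Var f unit_square" using V(1) \<epsilon>(1) by simp
  then obtain \<rho> where \<rho>: "0 < \<rho>" "\<And>g. square_map g \<Longrightarrow> (\<And>x. x \<in> unit_square \<Longrightarrow> norm (f x - g x) \<le> \<rho>) \<Longrightarrow>
      ereal (V - \<epsilon> / 4) < Var g unit_square"
    using Var_lower_semicontinuous[OF fsq] by metis
  have "0 < min \<rho> (r / 8)" using \<rho>(1) r by simp
  then obtain \<delta> where \<delta>: "0 < \<delta>" "\<And>x y. x \<in> unit_square \<Longrightarrow> y \<in> unit_square \<Longrightarrow> dist y x < \<delta> \<Longrightarrow> dist (f y) (f x) < min \<rho> (r / 8)"
    using BV_homeos_uniformly_continuous[OF f] unfolding uniformly_continuous_on_def by metis
  obtain b where b: "0 < b" "\<And>s. 0 < s \<Longrightarrow> s < 1 \<Longrightarrow> s < b \<Longrightarrow> strip_mean f s \<le> strip_mass / 4"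
    "\<And>s. 0 < s \<Longrightarrow> s < 1 \<Longrightarrow> 1 - b < s \<Longrightarrow> 3 / 4 * strip_mass \<le> strip_mean f s"
    using strip_mean_boundary[OF f] by metis
  obtain K where K: "0 < K" "\<And>t. 0 \<le> t \<Longrightarrow> t \<le> 1 \<Longrightarrow> \<bar>cutoff' t\<bar> \<le> K" using cutoff'_bounded by metis
  obtain \<eta>'' where \<eta>'': "\<And>t. (cutoff' has_real_derivative \<eta>'' t) (at t)" "continuous_on UNIV \<eta>''"
    using Ck_real_cutoff'[of 1] by auto
  \<comment> \<open>Bounds the displacement. \<open>\<delta>\<close> and \<open>r / 8\<close> keep
    the maps and their inverses close, \<open>b\<close> brings the outermost quarter points near the
    sides, and the last entry limits the error of the cutoff in the variation to \<epsilon>/4; V + 1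
    stands for \<open>V\<close>, which may be 0.\<close>
  define \<mu> where "\<mu> = min (min \<delta> (r / 8)) (min b (\<epsilon> / (8 * K * (V + 1))))"
  have "0 < \<mu>" using \<delta>(1) r b(1) \<epsilon>(1) K(1) V(2) by (simp add: \<mu>_def)
  then obtain m where m: "1 / real (Suc m) < \<mu>"
    using reals_Archimedean by (auto simp: inverse_eq_divide)
  define n where "n = Suc m"
  \<comment> \<open>Both a bound for the displacement, the wave being at most 1/4, and the distance
    of the first and last quarter points to the vertical sides.\<close>
  define T where "T = 1 / (4 * real n)"
  have n: "0 < n" by (simp add: n_def)
  have "T \<le> 1 / real (Suc m)" by (simp add: T_def n_def field_simps)
  then have T: "0 < T" "T < \<delta>" "T \<le> r / 8" "T < b" "T \<le> \<epsilon> / (8 * K * (V + 1))"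
    using m n by (auto simp: \<mu>_def T_def)
  have KV: "2 * (K * T) * V \<le> \<epsilon> / 4"
  proof -
    have "2 * (K * T) * V \<le> 2 * (K * (\<epsilon> / (8 * K * (V + 1)))) * V"
      using T(5) K(1) V(2) by (intro mult_right_mono mult_left_mono) auto
    also have "\<dots> = \<epsilon> / 4 * (V / (V + 1))" using K(1) V(2) by (auto simp: divide_simps)
    also have "\<dots> \<le> \<epsilon> / 4 * 1" using V(2) \<epsilon>(1) by (intro mult_left_mono) auto
    finally show ?thesis by simp
  qed

  \<comment> \<open>Prescribes the height \<sigma> of the wave through c = sin \<theta>. An interval
    of length 1/2, in units of 1/n, shrinks to 1/2 - 2 \<sigma> = 1/(2 (j + 2)), which is below 1/(j
    + 1).\<close>
  define \<theta> where "\<theta> = pi / 2 - pi / (2 * (real j + 2))"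
  define \<sigma> where "\<sigma> = \<theta> / (2 * pi)"
  have j2: "0 < 1 / (2 * (real j + 2))" "1 / (2 * (real j + 2)) \<le> 1/4" by (auto simp: field_simps)
  have "\<theta> = pi / 2 - pi * (1 / (2 * (real j + 2)))" by (simp add: \<theta>_def)
  moreover have "0 < pi * (1 / (2 * (real j + 2)))" "pi * (1 / (2 * (real j + 2))) \<le> pi * (1/4)"
    using j2 by (intro mult_pos_pos mult_left_mono; simp)+
  ultimately have \<theta>: "0 < \<theta>" "\<theta> < pi / 2" using pi_gt_zero by linarith+
  have "\<theta> = pi * (1/2 - 1 / (2 * (real j + 2)))" by (simp add: \<theta>_def algebra_simps)
  then have \<sigma>_eq: "\<sigma> = 1/4 - 1 / (4 * (real j + 2))" by (simp add: \<sigma>_def diff_divide_distrib)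
  have \<sigma>: "0 < \<sigma>" "\<sigma> < 1/4" using \<theta> by (auto simp: \<sigma>_def field_simps)
  have \<sigma>j: "1/2 - 2 * \<sigma> < 1 / (real j + 1)" by (simp add: \<sigma>_eq field_simps)
  define c where "c = sin \<theta>"
  have c: "0 \<le> c" "c < 1"
    using \<theta> sin_gt_zero[of \<theta>] sin_monotone_2pi[of \<theta> "pi / 2"] by (auto simp: c_def)
  have "arcsin c = \<theta>" unfolding c_def using \<theta> by (intro arcsin_sin) auto
  then have wv: "wave c (real i + 1/4) = \<sigma>" "wave c (real i + 3/4) = - \<sigma>" for i
    using wave_values[OF c, of i] by (simp_all add: \<sigma>_def)

  interpret S: shear_pair "\<lambda>t. wave c (real n * t) / real n" "\<lambda>t. wave' c (real n * t)"
    "\<lambda>t. real n * wave'' c (real n * t)" cutoff cutoff' \<eta>''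
    by (rule shear_pair_wave[OF c n \<eta>''])

  have \<tau>T: "\<bar>wave c (real n * t) / real n\<bar> \<le> T" for t
    using wave_bound[OF c, of "real n * t"] n by (simp add: T_def abs_divide field_simps)
  have \<kappa>: "\<bar>S.k y\<bar> \<le> K * T" if "y \<in> unit_square" for y
  proof -
    have "\<bar>wave c (real n * y $ 1) / real n\<bar> * \<bar>cutoff' (y $ 2)\<bar> \<le> T * K"
      using K that T(1) \<tau>T by (intro mult_mono) (auto simp: unit_square_def less_imp_le)
    then show ?thesis unfolding S.k_def abs_mult[of _ "cutoff' _"] by (simp only: mult.commute)
  qed
  have close: "norm (f x - f y) \<le> min \<rho> (r / 8)"
    if "x \<in> unit_square" "y \<in> unit_square" "norm (y - x) \<le> T" for x y
    using \<delta>(2)[OF that(2) that(1)] that(3) T(2) by (simp add: dist_norm norm_minus_commute)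
  have cp: "norm (f x - f (S.h x)) \<le> min \<rho> (r / 8)" "norm (f x - f (S.neg.h x)) \<le> min \<rho> (r / 8)"
    if x: "x \<in> unit_square" for x
  proof -
    have "norm (S.h x - x) \<le> T" "norm (S.neg.h x - x) \<le> T"
      using \<tau>T x by (auto intro!: S.norm_h_diff S.neg.norm_h_diff)
    moreover have "S.h x \<in> unit_square" "S.neg.h x \<in> unit_square"
      using x S.h_image S.neg.h_image by blast+
    ultimately show "norm (f x - f (S.h x)) \<le> min \<rho> (r / 8)" "norm (f x - f (S.neg.h x)) \<le> min \<rho> (r / 8)"
      using x by (auto intro!: close simp del: min.bounded_iff)
  qed
  have low: "ereal (V - \<epsilon> / 4) < Var (\<lambda>x. f (S.h x)) unit_square"
    "ereal (V - \<epsilon> / 4) < Var (\<lambda>x. f (S.neg.h x)) unit_square"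
    using cp by (auto intro!: \<rho>(2) S.square_map_comp_h S.neg.square_map_comp_h fsq)
  have up: "Var (\<lambda>x. f (S.h x)) unit_square \<le> ereal (V + \<epsilon> / 2)"
    "Var (\<lambda>x. f (S.neg.h x)) unit_square \<le> ereal (V + \<epsilon> / 2)"
  proof -
    \<comment> \<open>The upper bound for one sign, obtained from the lower bound V - \<epsilon>/4
      for the opposite sign.\<close>
    have "2 * (1 + K * T) * V - (V - \<epsilon> / 4) \<le> V + \<epsilon> / 2" using KV by (simp add: algebra_simps)
    then show "Var (\<lambda>x. f (S.h x)) unit_square \<le> ereal (V + \<epsilon> / 2)"
      "Var (\<lambda>x. f (S.neg.h x)) unit_square \<le> ereal (V + \<epsilon> / 2)"
      using S.Var_shear_le[OF fsq _ \<kappa>, of V "V - \<epsilon> / 4"] low V(1)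
      by (auto intro: order_trans)
  qed
  have third: "v < ereal M \<and> \<bar>1 / (M - real_of_ereal (Var f unit_square)) - 1 / (M - real_of_ereal v)\<bar> < r / 4"
    if vb: "ereal (V - \<epsilon> / 4) < v" "v \<le> ereal (V + \<epsilon> / 2)" for v
  proof -
    obtain v' where v': "v = ereal v'" using vb by (cases v) auto
    have "\<bar>v' - V\<bar> < d0" "v' < M" using vb \<epsilon> unfolding v' by auto
    then show ?thesis using d0(2)[of v'] by (simp add: v' V(1) abs_minus_commute)
  qed
  have Sp: "S.deform f \<in> BV_homeos M" "dX M f (S.deform f) < r"
  proof -
    note * = third[OF low(1) up(1), folded S.Var_deform]
    note ** = S.deform_close[OF f \<tau>T T(3) _ conjunct1[OF *]]
    show "S.deform f \<in> BV_homeos M" using cp by (intro **(1)) auto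
    have "dX M f (S.deform f) \<le> r / 8 + r / 8 + \<bar>1 / (M - real_of_ereal (Var f unit_square)) -
      1 / (M - real_of_ereal (Var (S.deform f) unit_square))\<bar>" using cp by (intro **(2)) auto
    then show "dX M f (S.deform f) < r" using * r by linarith
  qed
  have \<tau>T': "\<bar>- (wave c (real n * t) / real n)\<bar> \<le> T" for t using \<tau>T by simp
  have Sm: "S.neg.deform f \<in> BV_homeos M" "dX M f (S.neg.deform f) < r"
  proof -
    note * = third[OF low(2) up(2), folded S.neg.Var_deform]
    note ** = S.neg.deform_close[OF f \<tau>T' T(3) _ conjunct1[OF *]]
    show "S.neg.deform f \<in> BV_homeos M" using cp by (intro **(1)) auto
    have "dX M f (S.neg.deform f) \<le> r / 8 + r / 8 + \<bar>1 / (M - real_of_ereal (Var f unit_square)) -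
      1 / (M - real_of_ereal (Var (S.neg.deform f) unit_square))\<bar>" using cp by (intro **(2)) auto
    then show "dX M f (S.neg.deform f) < r" using * r by linarith
  qed

  have mean_plus: "strip_mean (S.deform f) s = strip_mean f t"
    if "0 < s" "s < 1" "s = t + wave c (real n * t) / real n" for s t
  proof -
    have "strip_mean (S.deform f) s = strip_mean (\<lambda>x. f (S.h x)) s"
      using that by (intro strip_mean_cong) (auto simp: S.deform_eq)
    also have "\<dots> = strip_mean f t"
      unfolding that(3) using shear_strip_mean[OF S.shear_axioms cutoff_eq_1] by simp
    finally show ?thesis .
  qed
  have mean_minus: "strip_mean (S.neg.deform f) s = strip_mean f t"
    if "0 < s" "s < 1" "s = t - wave c (real n * t) / real n" for s t
  proof -
    have "strip_mean (S.neg.deform f) s = strip_mean (\<lambda>x. f (S.neg.h x)) s"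
      using that by (intro strip_mean_cong) (auto simp: S.neg.deform_eq)
    also have "\<dots> = strip_mean f t"
      unfolding that(3) using shear_strip_mean[OF S.neg.shear_axioms cutoff_eq_1, of f t] by simp
    finally show ?thesis .
  qed
  \<comment> \<open>Rescaled so that the extrema of the wave sit at the quarter points i + 1/4 and i
    + 3/4.\<close>
  define \<phi> where "\<phi> x = strip_mean f (x / real n)" for x
  \<comment> \<open>The line at (i + 3/4)/n moves left and the line at (i + 1/4)/n moves right, both
    by \<sigma>/n, taking their means with them.\<close>
  have plus: "strip_mean (S.deform f) ((real i + 1/4 + 1/2 - \<sigma>) / real n) = \<phi> (real i + 3/4)"
    "strip_mean (S.deform f) ((real i + 1/4 + \<sigma>) / real n) = \<phi> (real i + 1/4)" if "i < n" for i
  proof -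
    have i: "real i + 1 \<le> real n" using that by linarith
    show "strip_mean (S.deform f) ((real i + 1/4 + 1/2 - \<sigma>) / real n) = \<phi> (real i + 3/4)"
      unfolding \<phi>_def using n \<sigma> i wv by (intro mean_plus) (auto simp: divide_simps)
    show "strip_mean (S.deform f) ((real i + 1/4 + \<sigma>) / real n) = \<phi> (real i + 1/4)"
      unfolding \<phi>_def using n \<sigma> i wv by (intro mean_plus) (auto simp: divide_simps)
  qed
  \<comment> \<open>Only i < m = n - 1 is possible, since the interval for i = m would stick out
    beyond 1.\<close>
  have minus: "strip_mean (S.neg.deform f) ((real i + 3/4 + 1/2 - \<sigma>) / real n) = \<phi> (real i + 5/4)"
    "strip_mean (S.neg.deform f) ((real i + 3/4 + \<sigma>) / real n) = \<phi> (real i + 3/4)" if "i < m" for i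
  proof -
    have i: "real i + 2 \<le> real n" using that unfolding n_def by linarith
    have w5: "wave c (real i + 5/4) = \<sigma>" using wv(1)[of "Suc i"] by (simp add: algebra_simps)
    show "strip_mean (S.neg.deform f) ((real i + 3/4 + 1/2 - \<sigma>) / real n) = \<phi> (real i + 5/4)"
      unfolding \<phi>_def using n \<sigma> i w5 by (intro mean_minus) (auto simp: divide_simps)
    show "strip_mean (S.neg.deform f) ((real i + 3/4 + \<sigma>) / real n) = \<phi> (real i + 3/4)"
      unfolding \<phi>_def using n \<sigma> i wv by (intro mean_minus) (auto simp: divide_simps)
  qed
  have "\<phi> (1/4) \<le> strip_mass / 4"
    unfolding \<phi>_def using n T by (intro b(2)) (auto simp: T_def)
  moreover have "3/4 * strip_mass \<le> \<phi> (real m + 3/4)"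
  proof -
    have "(real m + 3/4) / real n = 1 - T" using n by (simp add: T_def n_def field_simps)
    moreover have "T < 1" "0 < T" using n by (auto simp: T_def divide_less_eq)
    ultimately show ?thesis unfolding \<phi>_def using T(4) by (intro b(3)) auto
  qed
  \<comment> \<open>Between the outermost quarter points the mean grows from at most 1/4 to at least
    3/4 of \<open>strip_mass\<close>. One of the two sums is then at least a quarter of it, which
    exceeds the required eighth.\<close>
  ultimately have "strip_mass / 2 \<le> (\<Sum>i<n. \<phi> (real i + 3/4) - \<phi> (real i + 1/4)) + (\<Sum>i<m. \<phi> (real i + 5/4) - \<phi> (real i + 3/4))"
    unfolding n_def alternating_telescope by linarith
  then consider "strip_mass / 8 < (\<Sum>i<n. \<phi> (real i + 3/4) - \<phi> (real i + 1/4))"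
    | "strip_mass / 8 < (\<Sum>i<m. \<phi> (real i + 5/4) - \<phi> (real i + 3/4))"
    using strip_mass_pos by linarith
  then show thesis
  proof cases
    case 1
    have "concentrated j (S.deform f)"
      using 1 plus by (intro concentratedI[OF n _ \<sigma> _ order_refl \<sigma>j, where \<theta>="1/4"]) auto
    then show ?thesis using that Sp by blast
  next
    case 2
    have "concentrated j (S.neg.deform f)"
      using 2 minus by (intro concentratedI[OF n _ \<sigma> _ _ \<sigma>j, where N=m and \<theta>="3/4"]) (auto simp: n_def)
    then show ?thesis using that Sm by blast
  qed
qed

theorem proposition5p5:
  fixes M :: real
  assumes "M > 2"
  shows "first_category_in (Metric_space.mtopology (BV_homeos M) (dX M))
           (BV_homeos M \<inter> W11 unit_square)"
proof -
  interpret Metric_space "BV_homeos M" "dX M" by (rule Metric_space_BV_homeos)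
  define U where "U j = {f \<in> BV_homeos M. concentrated j f}" for j
  have "openin mtopology (U j)" for j
    unfolding openin_mtopology
  proof (intro conjI allI impI)
    fix f assume "f \<in> U j"
    then obtain r where "0 < r" "\<And>g. g \<in> BV_homeos M \<Longrightarrow> dX M f g < r \<Longrightarrow> concentrated j g"
      using concentrated_open[of f M j] unfolding U_def by blast
    then show "\<exists>r>0. mball f r \<subseteq> U j" by (intro exI[of _ r]) (auto simp: U_def)
  qed (auto simp: U_def)
  moreover have "mtopology closure_of U j = topspace mtopology" for j
    unfolding metric_closure_of topspace_mtopology
  proof (intro subset_antisym subsetI CollectI conjI allI impI)
    fix f and r :: real assume f: "f \<in> BV_homeos M" and r: "0 < r"
    obtain g where "g \<in> BV_homeos M" "dX M f g < r" "concentrated j g"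
      by (rule concentrated_dense[OF f r])
    then show "\<exists>g\<in>U j. g \<in> mball f r" using f by (auto simp: U_def)
  qed auto
  moreover have "(\<Inter>j. U j) \<subseteq> topspace mtopology - BV_homeos M \<inter> W11 unit_square"
  proof
    fix f assume "f \<in> (\<Inter>j. U j)"
    then have f: "f \<in> BV_homeos M" and conc: "concentrated j f" for j by (auto simp: U_def)
    have "f \<notin> W11 unit_square"
      using Sobolev_not_concentrated[OF BV_homeos_square_map[OF f] BV_homeos_uniformly_continuous[OF f]] conc by metis
    then show "f \<in> topspace mtopology - BV_homeos M \<inter> W11 unit_square" using f by simp
  qed
  ultimately show ?thesis unfolding first_category_in_def residual_in_def by blast
qed

end
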